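(* Let $\mathcal F$ be a differential field of characteristic $0$ with pairwise commuting derivations $\Delta=\{\partial_1,\dots,\partial_m\}$, let $D=\mathcal F[\partial_1,\dots,\partial_m]$ be the ring of linear differential operators over $\mathcal F$, and let $\Sigma\subset\mathcal F\{y_1,\dots,y_n\}$ be a system of linear differential polynomials such that $\operatorname{ord}_{y_j}f\le e_j$ for all $f\in\Sigma$ and $1\le j\le n$. Let $M/N$ be the module of differentials of $\Sigma$, and suppose that $a_m(\omega_{[\Sigma]})=0$. Then there exist a differential field extension $\mathcal G$ of $\mathcal F$ and elements $c_2,\dots,c_n\in\mathcal G$ such that, with $\tilde D=\mathcal G\otimes_{\mathcal F}D$ and $\psi=m_1+c_2m_2+\dots+c_nm_n$, the $\tilde D$-module $M/N$ (after extending scalars to $\mathcal G$) is generated by $\psi$, i.e. equals $\tilde D\psi$; and for each $j=1,\dots,n$, the elements $\lambda_j\in\tilde D$ with $\lambda_j\psi=m_j$ can be taken with $$\operatorname{ord}\lambda_j\le 2^m(e_1+\dots+e_n).$$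
   Context: $\mathcal F\{y_1,\dots,y_n\}$ is the ring of differential polynomials: the polynomial ring over $\mathcal F$ in the indeterminates $\theta y_j$, $\theta=\partial_1^{i_1}\cdots\partial_m^{i_m}$, $1\le j\le n$; the order of $\theta$ is $i_1+\dots+i_m$. A differential polynomial is linear if it has degree $1$ in these indeterminates. $D$ consists of skew polynomials $\sum a_\theta\theta$ with $\partial_i a=a\partial_i+\partial_i(a)$; the order of an operator is the maximal order of $\theta$ with $a_\theta\ne0$. Let $M$ be the free $D$-module with basis $m_1,\dots,m_n$ ($m_j$ identified with the differential of $y_j$). A linear $f=\sum_j\sum_\theta a_{\theta,j}\theta y_j+a_0$ gives the element $\sum_j\sigma_j m_j\in M$ with $\sigma_j=\sum_\theta a_{\theta,j}\theta$, and $\operatorname{ord}_{y_j}f=\operatorname{ord}\sigma_j$. $N$ is the $D$-submodule of $M$ generated by the elements corresponding to $f\in\Sigma$; $M/N$ is the module of differentials. Filter $M$ by $M_r=\sum_j D_r m_j$ where $D_r$ is the set of operators of order $\le r$, and $M/N$ by $M_r/(M_r\cap N)$. The Kolchin dimension polynomial $\omega_{[\Sigma]}(s)$ is the numerical polynomial equal to $\dim_{\mathcal F}M_s/(M_s\cap N)$ for large $s$; writing it as $\sum_{i=0}^d a_i\binom{s+i}{i}$ with $a_i\in\mathbb Z$, $a_i(\omega_{[\Sigma]})$ denotes the coefficient $a_i$ (with $a_m=0$ if $d<m$). *)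

theory Defs
  imports Complex_Main "HOL-Algebra.Ring" "HOL-Algebra.RingHom" "HOL-Library.Function_Algebras"
begin

text \<open>Multi-indices theta = d_1^(i_1) ... d_m^(i_m), encoded as functions nat => nat
  vanishing outside {0..<m}; the order of theta is i_1 + ... + i_m.\<close>

definition midx :: "nat \<Rightarrow> (nat \<Rightarrow> nat) set" where
  "midx m = {\<theta>. \<forall>i\<ge>m. \<theta> i = 0}"

definition mi_ord :: "nat \<Rightarrow> (nat \<Rightarrow> nat) \<Rightarrow> nat" where
  "mi_ord m \<theta> = (\<Sum>i<m. \<theta> i)"

definition type_ring :: "'a::field ring" where
  "type_ring = \<lparr>carrier = UNIV, mult = (*), one = 1, zero = 0, add = (+)\<rparr>"

definition is_derivation :: "('b, 'c) ring_scheme \<Rightarrow> ('b \<Rightarrow> 'b) \<Rightarrow> bool" where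
  "is_derivation R D \<longleftrightarrow>
     (\<forall>x\<in>carrier R. D x \<in> carrier R) \<and>
     (\<forall>x\<in>carrier R. \<forall>y\<in>carrier R.
        D (x \<oplus>\<^bsub>R\<^esub> y) = D x \<oplus>\<^bsub>R\<^esub> D y \<and>
        D (x \<otimes>\<^bsub>R\<^esub> y) = x \<otimes>\<^bsub>R\<^esub> D y \<oplus>\<^bsub>R\<^esub> D x \<otimes>\<^bsub>R\<^esub> y)"

definition diff_ring :: "('b, 'c) ring_scheme \<Rightarrow> (nat \<Rightarrow> 'b \<Rightarrow> 'b) \<Rightarrow> nat \<Rightarrow> bool" where
  "diff_ring R d m \<longleftrightarrow>
     (\<forall>i<m. is_derivation R (d i)) \<and>
     (\<forall>i<m. \<forall>j<m. \<forall>x\<in>carrier R. d i (d j x) = d j (d i x))"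

text \<open>Linear differential operators sum a_theta theta over R: coefficient functions with
  finite support on multi-indices.\<close>

definition ops :: "('b, 'c) ring_scheme \<Rightarrow> nat \<Rightarrow> ((nat \<Rightarrow> nat) \<Rightarrow> 'b) set" where
  "ops R m = {L. (\<forall>\<theta>. L \<theta> \<in> carrier R) \<and> (\<forall>\<theta>. \<theta> \<notin> midx m \<longrightarrow> L \<theta> = \<zero>\<^bsub>R\<^esub>)
                 \<and> finite {\<theta>. L \<theta> \<noteq> \<zero>\<^bsub>R\<^esub>}}"

definition op_supp :: "('b, 'c) ring_scheme \<Rightarrow> ((nat \<Rightarrow> nat) \<Rightarrow> 'b) \<Rightarrow> (nat \<Rightarrow> nat) set" where
  "op_supp R L = {\<theta>. L \<theta> \<noteq> \<zero>\<^bsub>R\<^esub>}"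

text \<open>ord L <= r (vacuous for the zero operator).\<close>
definition ord_le :: "('b, 'c) ring_scheme \<Rightarrow> nat \<Rightarrow> ((nat \<Rightarrow> nat) \<Rightarrow> 'b) \<Rightarrow> nat \<Rightarrow> bool" where
  "ord_le R m L r \<longleftrightarrow> (\<forall>\<theta>. L \<theta> \<noteq> \<zero>\<^bsub>R\<^esub> \<longrightarrow> mi_ord m \<theta> \<le> r)"

definition op_const :: "('b, 'c) ring_scheme \<Rightarrow> 'b \<Rightarrow> ((nat \<Rightarrow> nat) \<Rightarrow> 'b)" where
  "op_const R c = (\<lambda>\<theta>. if (\<forall>i. \<theta> i = 0) then c else \<zero>\<^bsub>R\<^esub>)"

definition op_zero :: "('b, 'c) ring_scheme \<Rightarrow> ((nat \<Rightarrow> nat) \<Rightarrow> 'b)" where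
  "op_zero R = (\<lambda>\<theta>. \<zero>\<^bsub>R\<^esub>)"

definition dpow :: "(nat \<Rightarrow> 'b \<Rightarrow> 'b) \<Rightarrow> nat \<Rightarrow> (nat \<Rightarrow> nat) \<Rightarrow> 'b \<Rightarrow> 'b" where
  "dpow d m \<nu> x = foldr (\<lambda>i y. (d i ^^ \<nu> i) y) [0..<m] x"

definition mbinom :: "nat \<Rightarrow> (nat \<Rightarrow> nat) \<Rightarrow> (nat \<Rightarrow> nat) \<Rightarrow> nat" where
  "mbinom m \<theta> \<nu> = (\<Prod>i<m. \<theta> i choose \<nu> i)"

text \<open>Product in the skew polynomial ring D = R[d_1,...,d_m] with d_i a = a d_i + d_i(a),
  written out via the Leibniz rule
  (a theta)(b theta') = sum over nu <= theta of binom(theta,nu) a d^nu(b) (theta - nu + theta').\<close>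
definition op_mul :: "('b, 'c) ring_scheme \<Rightarrow> (nat \<Rightarrow> 'b \<Rightarrow> 'b) \<Rightarrow> nat \<Rightarrow>
    ((nat \<Rightarrow> nat) \<Rightarrow> 'b) \<Rightarrow> ((nat \<Rightarrow> nat) \<Rightarrow> 'b) \<Rightarrow> ((nat \<Rightarrow> nat) \<Rightarrow> 'b)" where
  "op_mul R d m L L' = (\<lambda>\<kappa>.
     finsum R (\<lambda>\<theta>. finsum R (\<lambda>\<theta>'. finsum R
        (\<lambda>\<nu>. add_pow R (mbinom m \<theta> \<nu>) (L \<theta> \<otimes>\<^bsub>R\<^esub> dpow d m \<nu> (L' \<theta>')))
        {\<nu> \<in> midx m. (\<forall>i. \<nu> i \<le> \<theta> i) \<and> (\<lambda>i. \<theta> i - \<nu> i + \<theta>' i) = \<kappa>})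
      (op_supp R L')) (op_supp R L))"

text \<open>The free D-module M with basis m_1,...,m_n: vectors j |-> sigma_j (j in {1..n}).\<close>

definition mvecs :: "('b, 'c) ring_scheme \<Rightarrow> nat \<Rightarrow> nat \<Rightarrow> (nat \<Rightarrow> (nat \<Rightarrow> nat) \<Rightarrow> 'b) set" where
  "mvecs R m n = {v. (\<forall>j. v j \<in> ops R m) \<and> (\<forall>j. j \<notin> {1..n} \<longrightarrow> v j = op_zero R)}"

definition op_act :: "('b, 'c) ring_scheme \<Rightarrow> (nat \<Rightarrow> 'b \<Rightarrow> 'b) \<Rightarrow> nat \<Rightarrow>
    ((nat \<Rightarrow> nat) \<Rightarrow> 'b) \<Rightarrow> (nat \<Rightarrow> (nat \<Rightarrow> nat) \<Rightarrow> 'b) \<Rightarrow> (nat \<Rightarrow> (nat \<Rightarrow> nat) \<Rightarrow> 'b)" where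
  "op_act R d m L v = (\<lambda>j. op_mul R d m L (v j))"

definition dsubmod :: "('b, 'c) ring_scheme \<Rightarrow> (nat \<Rightarrow> 'b \<Rightarrow> 'b) \<Rightarrow> nat \<Rightarrow>
    (nat \<Rightarrow> (nat \<Rightarrow> nat) \<Rightarrow> 'b) set \<Rightarrow> (nat \<Rightarrow> (nat \<Rightarrow> nat) \<Rightarrow> 'b) set" where
  "dsubmod R d m S = {w. \<exists>K Lf. finite K \<and> K \<subseteq> S \<and> (\<forall>s\<in>K. Lf s \<in> ops R m) \<and>
      w = (\<lambda>j \<theta>. finsum R (\<lambda>s. op_act R d m (Lf s) s j \<theta>) K)}"

definition basis_vec :: "('b, 'c) ring_scheme \<Rightarrow> nat \<Rightarrow> (nat \<Rightarrow> (nat \<Rightarrow> nat) \<Rightarrow> 'b)" where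
  "basis_vec R j = (\<lambda>k. if k = j then op_const R \<one>\<^bsub>R\<^esub> else op_zero R)"

text \<open>Linear differential polynomials f = sum_j sum_theta a_{theta,j} theta y_j + a_0 in
  F{y_1,...,y_n}, encoded as (coefficients, a_0); linear = degree exactly 1.\<close>
definition lin_dpoly :: "nat \<Rightarrow> nat \<Rightarrow> (nat \<Rightarrow> (nat \<Rightarrow> nat) \<Rightarrow> 'a::field) \<times> 'a \<Rightarrow> bool" where
  "lin_dpoly m n f \<longleftrightarrow> fst f \<in> mvecs type_ring m n \<and> (\<exists>j \<theta>. fst f j \<theta> \<noteq> 0)"

definition fscale :: "'a::field \<Rightarrow> (nat \<Rightarrow> (nat \<Rightarrow> nat) \<Rightarrow> 'a) \<Rightarrow> (nat \<Rightarrow> (nat \<Rightarrow> nat) \<Rightarrow> 'a)" where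
  "fscale a v = (\<lambda>j \<theta>. a * v j \<theta>)"

definition filt :: "nat \<Rightarrow> nat \<Rightarrow> nat \<Rightarrow> (nat \<Rightarrow> (nat \<Rightarrow> nat) \<Rightarrow> 'a::field) set" where
  "filt m n r = {v \<in> mvecs type_ring m n. \<forall>j. ord_le type_ring m (v j) r}"

definition modN :: "(nat \<Rightarrow> 'a::field \<Rightarrow> 'a) \<Rightarrow> nat \<Rightarrow>
    ((nat \<Rightarrow> (nat \<Rightarrow> nat) \<Rightarrow> 'a) \<times> 'a) set \<Rightarrow> (nat \<Rightarrow> (nat \<Rightarrow> nat) \<Rightarrow> 'a) set" where
  "modN d m \<Sigma> = dsubmod type_ring d m (fst ` \<Sigma>)"

text \<open>dim_F M_s/(M_s intersect N).\<close>
definition hilb :: "(nat \<Rightarrow> 'a::field \<Rightarrow> 'a) \<Rightarrow> nat \<Rightarrow> nat \<Rightarrow>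
    ((nat \<Rightarrow> (nat \<Rightarrow> nat) \<Rightarrow> 'a) \<times> 'a) set \<Rightarrow> nat \<Rightarrow> nat" where
  "hilb d m n \<Sigma> s = vector_space.dim (fscale :: 'a \<Rightarrow> _) (filt m n s)
                    - vector_space.dim fscale (filt m n s \<inter> modN d m \<Sigma>)"

definition kolchin_top_coeff_zero :: "(nat \<Rightarrow> 'a::field \<Rightarrow> 'a) \<Rightarrow> nat \<Rightarrow> nat \<Rightarrow>
    ((nat \<Rightarrow> (nat \<Rightarrow> nat) \<Rightarrow> 'a) \<times> 'a) set \<Rightarrow> bool" where
  "kolchin_top_coeff_zero d m n \<Sigma> \<longleftrightarrow>
     (\<exists>a :: nat \<Rightarrow> int. (\<forall>\<^sub>F s in sequentially.
         int (hilb d m n \<Sigma> s) = (\<Sum>i\<le>m. a i * int ((s + i) choose i))) \<and> a m = 0)"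

end

theory Submission
  imports Defs "HOL-Library.Poly_Mapping" "HOL-Library.Countable"
    "HOL-Computational_Algebra.Fraction_Field"
begin

text \<open>
  Adjoin differential indeterminates \<open>c\<^sub>2, \<dots>, c\<^sub>n\<close> to the base field. The Kolchin condition gives
  \<open>n\<close> elements of \<open>\<Sigma>\<close> that are left independent over \<open>D\<close>: otherwise some \<open>D m\<^sub>j\<close> would be free
  and meet \<open>N\<close> trivially, so the Hilbert function would be at least \<open>binomial (s + m) m\<close>. They stay
  independent after the extension. With \<open>s = 2\<^sup>m (e\<^sub>1 + \<dots> + e\<^sub>n)\<close>, a relation
  \<open>\<lambda> \<psi> + \<Sum> L\<^sub>i f\<^sub>i = 0\<close> with all multipliers of order at most \<open>s\<close> is a linear system with
  \<open>(n + 1) binomial (s + m) m\<close> unknowns and \<open>\<Sum>\<^sub>j binomial (s + e\<^sub>j + m) m\<close> equations, which is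
  underdetermined; independence of the \<open>f\<^sub>i\<close> forces \<open>\<lambda> \<noteq> 0\<close>. Applying the partial derivative with
  respect to \<open>\<theta> c\<^sub>j\<close>, for \<open>\<theta>\<close> of maximal order in \<open>\<lambda>\<close>, turns this relation into an expression of
  \<open>m\<^sub>j\<close> as a multiple of \<open>\<psi>\<close> modulo \<open>N\<close>, without increasing the order.
\<close>

text \<open>The number \<open>2 ^ m\<close> enters only through 2 m <= 2^m: for s >= 2 m (e_1 + ...
  + e_n), raising the order bound from s to s + e_j multiplies the number of multi-indices by at
  most 1 + 2 m e_j / (s + 1), and these excesses add up to less than the unknowns contributed by the
  one extra operator \<lambda>. The f_i have coefficients in the base field, so the derivation by
  \<theta> c_j acts only on the coefficients of \<lambda> and of the L_i and on \<psi>. Maximal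
  order of \<theta> matters because, by the Leibniz rule, higher terms of \<lambda> could also
  produce \<theta> c_j. This reaches m_2, ..., m_n; then m_1 is \<psi> minus the c_j m_j. Two
  constraints shape the text. \<open>op_mul\<close> is the closed Leibniz formula, awkward for
  associativity, so the algebra uses a product built from iterated left multiplication by the
  derivations, and the two are compared afterwards. The extension field must have its carrier in
  \<open>'a list\<close>, so it is built as a type and then copied along an injection;
  characteristic 0 lets scalars encode natural numbers.\<close>

lemma additive_sum:
  assumes "h 0 = 0" "\<And>x y. h (x + y) = h x + h y"
  shows "h (sum f A) = (\<Sum>x\<in>A. h (f x))"
  using sum_comp_morphism[of h f A] assms by (simp add: o_def)

lemma sum_closed_under_add:
  assumes "0 \<in> S" "\<And>x y. x \<in> S \<Longrightarrow> y \<in> S \<Longrightarrow> x + y \<in> S" "\<And>a. a \<in> A \<Longrightarrow> f a \<in> S"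
  shows "sum f A \<in> S"
  using assms(3) by (induction A rule: infinite_finite_induct) (use assms(1,2) in auto)

lemma sum_fun_apply: "sum f A x = (\<Sum>a\<in>A. f a x)"
  by (induction A rule: infinite_finite_induct) auto

section \<open>Multi-indices and iterated operators\<close>

lemma zero_midx [simp]: "0 \<in> midx m"
  by (simp add: midx_def)

lemma midx_upd_Suc: "\<theta> \<in> midx m \<Longrightarrow> i < m \<Longrightarrow> \<theta>(i := k) \<in> midx m"
  by (auto simp: midx_def)

lemma midx_add [simp]: "\<theta> \<in> midx m \<Longrightarrow> \<kappa> \<in> midx m \<Longrightarrow> \<theta> + \<kappa> \<in> midx m"
  by (auto simp: midx_def)

lemma midx_le: "\<theta> \<in> midx m \<Longrightarrow> \<nu> \<le> \<theta> \<Longrightarrow> \<nu> \<in> midx m"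
  by (auto simp: midx_def le_fun_def) (metis le_zero_eq)

lemma mi_ord_zero [simp]: "mi_ord m 0 = 0"
  by (simp add: mi_ord_def)

lemma mi_ord_zero' [simp]: "mi_ord m (\<lambda>_. 0) = 0"
  by (simp add: mi_ord_def)

lemma mi_ord_add [simp]: "mi_ord m (\<theta> + \<kappa>) = mi_ord m \<theta> + mi_ord m \<kappa>"
  by (simp add: mi_ord_def sum.distrib)

lemma mi_ord_upd_Suc: "i < m \<Longrightarrow> mi_ord m (\<theta>(i := Suc (\<theta> i))) = Suc (mi_ord m \<theta>)"
  by (simp add: mi_ord_def sum.remove[of "{..<m}" i])

lemma mi_ord_eq_0: "\<theta> \<in> midx m \<Longrightarrow> mi_ord m \<theta> = 0 \<Longrightarrow> \<theta> = 0"
  by (auto simp: mi_ord_def midx_def fun_eq_iff Ball_def) (metis not_less)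

text \<open>Builds \<theta> up by one derivation at a time, by induction on the order. The step has
  the shape of \<open>dpow_upd_Suc\<close>, so iterated operators unfold along it.\<close>

lemma midx_induct [consumes 1, case_names zero Suc]:
  assumes "\<theta> \<in> midx m" "P 0"
    and step: "\<And>\<theta> i. \<theta> \<in> midx m \<Longrightarrow> i < m \<Longrightarrow> P \<theta> \<Longrightarrow> P (\<theta>(i := Suc (\<theta> i)))"
  shows "P \<theta>"
  using assms(1)
proof (induction "mi_ord m \<theta>" arbitrary: \<theta>)
  case 0
  then show ?case using mi_ord_eq_0 assms(2) by metis
next
  case (Suc k)
  then obtain i where i: "i < m" "\<theta> i \<noteq> 0"
    unfolding mi_ord_def by (metis lessThan_iff nat.distinct(1) sum.neutral)
  define \<nu> where "\<nu> = \<theta>(i := \<theta> i - 1)"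
  have \<theta>: "\<theta> = \<nu>(i := Suc (\<nu> i))" using i by (auto simp: \<nu>_def)
  have \<nu>: "\<nu> \<in> midx m" using Suc.prems i by (auto simp: \<nu>_def midx_upd_Suc)
  have "k = mi_ord m \<nu>" using Suc.hyps(2) mi_ord_upd_Suc[OF i(1), of \<nu>] \<theta> by simp
  with Suc.hyps(1) \<nu> have "P \<nu>" by blast
  then show ?case using step[OF \<nu> i(1)] \<theta> by simp
qed

lemma dpow_zero [simp]: "dpow f m 0 x = x"
  unfolding dpow_def by (induction m arbitrary: x) auto

lemma dpow_zero' [simp]: "dpow f m (\<lambda>_. 0) x = x"
  using dpow_zero unfolding zero_fun_def .

lemma dpow_Suc_eq: "dpow f (Suc m) \<nu> x = dpow f m \<nu> ((f m ^^ \<nu> m) x)"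
  by (simp add: dpow_def)

lemma dpow_cong: "(\<And>i. i < m \<Longrightarrow> \<nu> i = \<mu> i) \<Longrightarrow> dpow f m \<nu> x = dpow f m \<mu> x"
  by (induction m arbitrary: x) (auto simp: dpow_Suc_eq dpow_def[of _ 0])

text \<open>The tool for every transfer of iterated operators: \<open>h\<close> may be an inclusion
  of constants, an encoding, a projection or right multiplication by a fixed operator, and
  \<open>S\<close> holds an invariant such as membership in the operator ring.\<close>

lemma dpow_intertwine:
  assumes "\<And>i y. i < m \<Longrightarrow> y \<in> S \<Longrightarrow> g i y \<in> S \<and> f i (h y) = h (g i y)" "y \<in> S"
  shows "dpow f m \<nu> (h y) = h (dpow g m \<nu> y)" "dpow g m \<nu> y \<in> S"
proof -
  have funpow: "(f i ^^ k) (h y) = h ((g i ^^ k) y) \<and> (g i ^^ k) y \<in> S" if "i < m" "y \<in> S" for i k y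
    using that assms(1) by (induction k) auto
  have "dpow f l \<nu> (h y) = h (dpow g l \<nu> y) \<and> dpow g l \<nu> y \<in> S" if "l \<le> m" "y \<in> S" for l y
    using that
  proof (induction l arbitrary: y)
    case (Suc l)
    then show ?case using funpow[of l y "\<nu> l"] by (auto simp: dpow_Suc_eq)
  qed (auto simp: dpow_def)
  then show "dpow f m \<nu> (h y) = h (dpow g m \<nu> y)" "dpow g m \<nu> y \<in> S" using assms(2) by auto
qed

lemma dpow_commute:
  assumes "\<And>i x. i < m \<Longrightarrow> f i (h x) = h (f i x)"
  shows "dpow f m \<nu> (h x) = h (dpow f m \<nu> x)"
  by (rule dpow_intertwine(1)[of m UNIV]) (use assms in auto)

text \<open>\<open>dpow\<close> applies its factors in a fixed order, so the extra
  \<open>f i\<close> sits in the middle and has to be moved outwards past the powers of smaller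
  index.\<close>

lemma dpow_upd_Suc:
  assumes comm: "\<And>i j x. i < m \<Longrightarrow> j < m \<Longrightarrow> f i (f j x) = f j (f i x)" and i: "i < m"
  shows "dpow f m (\<nu>(i := Suc (\<nu> i))) x = f i (dpow f m \<nu> x)"
proof -
  have "dpow f l (\<nu>(i := Suc (\<nu> i))) x = f i (dpow f l \<nu> x)" if "i < l" "l \<le> m" for l
    using that
  proof (induction l arbitrary: x)
    case (Suc l)
    show ?case
    proof (cases "i = l")
      case True
      have "dpow f l (\<nu>(i := Suc (\<nu> i))) y = dpow f l \<nu> y" for y
        by (rule dpow_cong) (use True in auto)
      moreover have "dpow f l \<nu> (f i y) = f i (dpow f l \<nu> y)" for y
        by (rule dpow_commute) (use comm Suc.prems i in auto)
      ultimately show ?thesis using True by (simp add: dpow_Suc_eq del: fun_upd_apply) simp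
    next
      case False
      then show ?thesis using Suc by (simp add: dpow_Suc_eq)
    qed
  qed simp
  with i show ?thesis by blast
qed

section \<open>The ring of linear differential operators\<close>

lemma type_ring_simps [simp]:
  "carrier type_ring = UNIV" "mult type_ring = (*)" "one type_ring = 1"
  "zero type_ring = 0" "add type_ring = (+)"
  by (auto simp: type_ring_def)

lemma ops_type_ring: "L \<in> ops type_ring m \<longleftrightarrow> (\<forall>\<theta>. \<theta> \<notin> midx m \<longrightarrow> L \<theta> = 0) \<and> finite {\<theta>. L \<theta> \<noteq> 0}"
  by (simp add: ops_def)

definition op_scale :: "'a::field \<Rightarrow> ((nat \<Rightarrow> nat) \<Rightarrow> 'a) \<Rightarrow> ((nat \<Rightarrow> nat) \<Rightarrow> 'a)" where
  "op_scale c L = (\<lambda>\<theta>. c * L \<theta>)"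

definition op_single :: "(nat \<Rightarrow> nat) \<Rightarrow> 'a::field \<Rightarrow> ((nat \<Rightarrow> nat) \<Rightarrow> 'a)" where
  "op_single \<theta> c = (\<lambda>\<kappa>. if \<kappa> = \<theta> then c else 0)"

text \<open>Left multiplication by the generator \<open>\<partial>\<^sub>i\<close>.\<close>
definition op_D :: "(nat \<Rightarrow> 'a::field \<Rightarrow> 'a) \<Rightarrow> nat \<Rightarrow> ((nat \<Rightarrow> nat) \<Rightarrow> 'a) \<Rightarrow> ((nat \<Rightarrow> nat) \<Rightarrow> 'a)" where
  "op_D d i L = (\<lambda>\<kappa>. d i (L \<kappa>) + (if \<kappa> i = 0 then 0 else L (\<kappa>(i := \<kappa> i - 1))))"

text \<open>The coefficients of the left factor only scale, and \<theta> acts by iterating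
  \<open>op_D\<close>. Associativity then rests on the behaviour of a single generator, which the
  closed formula of \<open>op_mul\<close> does not show.\<close>

definition op_times :: "(nat \<Rightarrow> 'a::field \<Rightarrow> 'a) \<Rightarrow> nat \<Rightarrow>
    ((nat \<Rightarrow> nat) \<Rightarrow> 'a) \<Rightarrow> ((nat \<Rightarrow> nat) \<Rightarrow> 'a) \<Rightarrow> ((nat \<Rightarrow> nat) \<Rightarrow> 'a)" where
  "op_times d m X Y = (\<Sum>\<theta> | X \<theta> \<noteq> 0. op_scale (X \<theta>) (dpow (op_D d) m \<theta> Y))"

lemma op_D_apply: "op_D d i L \<kappa> = d i (L \<kappa>) + (if \<kappa> i = 0 then 0 else L (\<kappa>(i := \<kappa> i - 1)))"
  by (simp add: op_D_def)

lemma op_scale_simps [simp]: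
  "op_scale 0 L = 0" "op_scale c 0 = 0" "op_scale 1 L = L"
  "op_scale (a + b) L = op_scale a L + op_scale b L"
  "op_scale a (L + L') = op_scale a L + op_scale a L'"
  "op_scale a (op_scale b L) = op_scale (a * b) L"
  by (auto simp: op_scale_def fun_eq_iff algebra_simps)

lemma op_scale_uminus: "op_scale (- a) L = - op_scale a L"
  by (simp add: op_scale_def fun_eq_iff)

lemma op_scale_sum: "op_scale a (sum f A) = (\<Sum>x\<in>A. op_scale a (f x))"
  by (rule additive_sum[where h = "op_scale a"]) auto

lemma ops_zero [simp]: "0 \<in> ops type_ring m"
  by (simp add: ops_type_ring)

lemma ops_add [simp]: "X \<in> ops type_ring m \<Longrightarrow> Y \<in> ops type_ring m \<Longrightarrow> X + Y \<in> ops type_ring m"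
proof -
  assume *: "X \<in> ops type_ring m" "Y \<in> ops type_ring m"
  have "{\<theta>. (X + Y) \<theta> \<noteq> 0} \<subseteq> {\<theta>. X \<theta> \<noteq> 0} \<union> {\<theta>. Y \<theta> \<noteq> 0}" by auto
  then have "finite {\<theta>. (X + Y) \<theta> \<noteq> 0}" by (rule finite_subset) (use * in \<open>auto simp: ops_type_ring\<close>)
  with * show ?thesis by (simp add: ops_type_ring)
qed

lemma ops_scale [simp]: "X \<in> ops type_ring m \<Longrightarrow> op_scale c X \<in> ops type_ring m"
  by (auto simp: ops_type_ring op_scale_def elim!: finite_subset[rotated])

lemma ops_sum [simp]: "(\<And>x. x \<in> A \<Longrightarrow> f x \<in> ops type_ring m) \<Longrightarrow> sum f A \<in> ops type_ring m"
  by (rule sum_closed_under_add) auto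

lemma ops_single [simp]: "\<theta> \<in> midx m \<Longrightarrow> op_single \<theta> c \<in> ops type_ring m"
  by (auto simp: ops_type_ring op_single_def)

lemma op_single_0 [simp]: "op_single \<theta> 0 = 0"
  by (auto simp: op_single_def)

lemma ops_eq_sum_single:
  assumes "finite A" "{\<theta>. X \<theta> \<noteq> 0} \<subseteq> A"
  shows "X = (\<Sum>\<theta>\<in>A. op_single \<theta> (X \<theta>))"
proof
  fix \<kappa>
  have "(\<Sum>\<theta>\<in>A. op_single \<theta> (X \<theta>)) \<kappa> = (\<Sum>\<theta>\<in>A. if \<kappa> = \<theta> then X \<theta> else 0)"
    by (simp add: sum_fun_apply op_single_def)
  also have "\<dots> = X \<kappa>" using assms by (auto simp: sum.delta')
  finally show "X \<kappa> = (\<Sum>\<theta>\<in>A. op_single \<theta> (X \<theta>)) \<kappa>" by simp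
qed

lemma ops_D:
  assumes "\<And>i. i < m \<Longrightarrow> d i 0 = 0" "i < m" "L \<in> ops type_ring m"
  shows "op_D d i L \<in> ops type_ring m"
proof -
  have "{\<theta>. op_D d i L \<theta> \<noteq> 0} \<subseteq> {\<theta>. L \<theta> \<noteq> 0} \<union> (\<lambda>\<theta>. \<theta>(i := Suc (\<theta> i))) ` {\<theta>. L \<theta> \<noteq> 0}"
  proof
    fix \<kappa> assume a: "\<kappa> \<in> {\<theta>. op_D d i L \<theta> \<noteq> 0}"
    show "\<kappa> \<in> {\<theta>. L \<theta> \<noteq> 0} \<union> (\<lambda>\<theta>. \<theta>(i := Suc (\<theta> i))) ` {\<theta>. L \<theta> \<noteq> 0}"
    proof (cases "L \<kappa> = 0")
      case True
      with a assms have *: "\<kappa> i \<noteq> 0" "L (\<kappa>(i := \<kappa> i - 1)) \<noteq> 0"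
        by (auto simp: op_D_def split: if_splits)
      then have "\<kappa> = (\<lambda>\<theta>. \<theta>(i := Suc (\<theta> i))) (\<kappa>(i := \<kappa> i - 1))" by auto
      with * show ?thesis by blast
    qed auto
  qed
  then have "finite {\<theta>. op_D d i L \<theta> \<noteq> 0}"
    by (rule finite_subset) (use assms in \<open>auto simp: ops_type_ring\<close>)
  moreover have "op_D d i L \<kappa> = 0" if "\<kappa> \<notin> midx m" for \<kappa>
  proof -
    have "\<kappa>(i := \<kappa> i - 1) \<notin> midx m" using that assms(2) unfolding midx_def by auto
    then show ?thesis using that assms by (simp add: op_D_def ops_type_ring)
  qed
  ultimately show ?thesis by (simp add: ops_type_ring)
qed

locale dfield =
  fixes d :: "nat \<Rightarrow> 'a::field \<Rightarrow> 'a" and m :: nat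
  assumes d_add: "i < m \<Longrightarrow> d i (x + y) = d i x + d i y"
    and d_mult: "i < m \<Longrightarrow> d i (x * y) = x * d i y + d i x * y"
    and d_comm: "i < m \<Longrightarrow> j < m \<Longrightarrow> d i (d j x) = d j (d i x)"
begin

abbreviation "opset \<equiv> ops (type_ring :: 'a ring) m"
abbreviation "th \<equiv> dpow (op_D d) m"
abbreviation tms (infixl "\<star>" 75) where "X \<star> Y \<equiv> op_times d m X Y"

lemma d_zero [simp]: "i < m \<Longrightarrow> d i 0 = 0"
  using d_add[of i 0 0] by (metis add.right_neutral add_left_cancel)

lemma d_of_nat_mult: "i < m \<Longrightarrow> d i (of_nat k * x) = of_nat k * d i x"
  by (induction k) (auto simp: d_add algebra_simps)

lemma D_add: "i < m \<Longrightarrow> op_D d i (X + Y) = op_D d i X + op_D d i Y"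
  by (auto simp: op_D_def d_add fun_eq_iff)

lemma D_zero [simp]: "i < m \<Longrightarrow> op_D d i 0 = 0"
  by (auto simp: op_D_def fun_eq_iff)

lemma D_sum: "i < m \<Longrightarrow> op_D d i (sum f A) = (\<Sum>x\<in>A. op_D d i (f x))"
  by (rule additive_sum[where h = "op_D d i"]) (auto simp: D_add)

lemma D_scale: "i < m \<Longrightarrow> op_D d i (op_scale c X) = op_scale (d i c) X + op_scale c (op_D d i X)"
  by (auto simp: op_D_def op_scale_def d_mult fun_eq_iff algebra_simps)

lemma D_comm: "i < m \<Longrightarrow> j < m \<Longrightarrow> op_D d i (op_D d j X) = op_D d j (op_D d i X)"
  by (cases "i = j") (auto simp: op_D_def d_add d_comm fun_eq_iff fun_upd_twist)

lemma th_upd_Suc: "i < m \<Longrightarrow> th (\<nu>(i := Suc (\<nu> i))) X = op_D d i (th \<nu> X)"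
  by (rule dpow_upd_Suc) (auto simp: D_comm)

lemma th_add: "th \<nu> (X + Y) = th \<nu> X + th \<nu> Y"
proof -
  \<comment> \<open>Both iterations run in parallel on pairs; addition and the two projections all
    intertwine this joint iteration.\<close>
  let ?g = "\<lambda>i p. (op_D d i (fst p), op_D d i (snd p))"
  have "th \<nu> ((\<lambda>p. fst p + snd p) (X, Y)) = (\<lambda>p. fst p + snd p) (dpow ?g m \<nu> (X, Y))"
    by (rule dpow_intertwine(1)[of m UNIV, where h = "\<lambda>p. fst p + snd p"]) (simp_all add: D_add)
  moreover have "th \<nu> (fst (X, Y)) = fst (dpow ?g m \<nu> (X, Y))"
    by (rule dpow_intertwine(1)[of m UNIV, where h = fst]) simp_all
  moreover have "th \<nu> (snd (X, Y)) = snd (dpow ?g m \<nu> (X, Y))"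
    by (rule dpow_intertwine(1)[of m UNIV, where h = snd]) simp_all
  ultimately show ?thesis by simp
qed

lemma th_zero [simp]: "th \<nu> 0 = 0"
  using th_add[of \<nu> 0 0] by (metis add.right_neutral add_left_cancel)

lemma th_sum: "th \<nu> (sum f A) = (\<Sum>x\<in>A. th \<nu> (f x))"
  by (rule additive_sum[where h = "th \<nu>"]) (auto simp: th_add)

lemma ops_th [simp]: "X \<in> opset \<Longrightarrow> th \<nu> X \<in> opset"
  by (rule dpow_intertwine(2)[of m opset "op_D d" "op_D d" id]) (auto simp: ops_D)

lemma times_superset:
  assumes "finite A" "{\<theta>. X \<theta> \<noteq> 0} \<subseteq> A"
  shows "X \<star> Y = (\<Sum>\<theta>\<in>A. op_scale (X \<theta>) (th \<theta> Y))"
  unfolding op_times_def by (rule sum.mono_neutral_left) (use assms in auto)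

lemma ops_times [simp]: "Y \<in> opset \<Longrightarrow> X \<star> Y \<in> opset"
  by (auto simp: op_times_def)

lemma times_add_right: "X \<star> (Y + Z) = X \<star> Y + X \<star> Z"
  by (simp add: op_times_def th_add sum.distrib)

lemma times_zero_right [simp]: "X \<star> 0 = 0"
  by (simp add: op_times_def)

lemma times_zero_left [simp]: "0 \<star> X = 0"
  by (simp add: op_times_def)

lemma times_sum_right: "X \<star> sum f A = (\<Sum>x\<in>A. X \<star> f x)"
  by (rule additive_sum[where h = "\<lambda>Y. X \<star> Y"]) (auto simp: times_add_right)

lemma times_add_left:
  assumes "X \<in> opset" "Y \<in> opset"
  shows "(X + Y) \<star> Z = X \<star> Z + Y \<star> Z"
proof -
  let ?A = "{\<theta>. X \<theta> \<noteq> 0} \<union> {\<theta>. Y \<theta> \<noteq> 0}"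
  have f: "finite ?A" using assms by (auto simp: ops_type_ring)
  show ?thesis
    by (subst (1 2 3) times_superset[OF f]) (auto simp: sum.distrib)
qed

lemma times_sum_left:
  "(\<And>x. x \<in> A \<Longrightarrow> f x \<in> opset) \<Longrightarrow> sum f A \<star> Z = (\<Sum>x\<in>A. f x \<star> Z)"
proof (cases "finite A")
  case True
  then show "(\<And>x. x \<in> A \<Longrightarrow> f x \<in> opset) \<Longrightarrow> sum f A \<star> Z = (\<Sum>x\<in>A. f x \<star> Z)"
  proof (induction A)
    case (insert x F)
    then have "(f x + sum f F) \<star> Z = f x \<star> Z + sum f F \<star> Z"
      by (intro times_add_left ops_sum) auto
    with insert show ?case by (simp only: sum.insert insert_iff simp_thms)
  qed (simp only: sum.empty times_zero_left)
qed simp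

lemma times_scale_left:
  "X \<in> opset \<Longrightarrow> op_scale c X \<star> Y = op_scale c (X \<star> Y)"
  by (subst (1 2) times_superset[of "{\<theta>. X \<theta> \<noteq> 0}"])
    (auto simp: ops_type_ring op_scale_sum, auto simp: op_scale_def)

lemma times_single_left: "op_single \<theta> c \<star> Y = op_scale c (th \<theta> Y)"
  by (subst times_superset[of "{\<theta>}"]) (auto simp: op_single_def)

lemma D_single: "i < m \<Longrightarrow> op_D d i (op_single \<theta> c) = op_single \<theta> (d i c) + op_single (\<theta>(i := Suc (\<theta> i))) c"
proof
  fix \<kappa>
  assume i: "i < m"
  have "\<kappa> i \<noteq> 0 \<and> \<kappa>(i := \<kappa> i - 1) = \<theta> \<longleftrightarrow> \<kappa> = \<theta>(i := Suc (\<theta> i))"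
    by (auto simp: fun_upd_idem)
  then show "op_D d i (op_single \<theta> c) \<kappa> = (op_single \<theta> (d i c) + op_single (\<theta>(i := Suc (\<theta> i))) c) \<kappa>"
    using i by (cases "\<kappa> i = 0"; cases "\<kappa> = \<theta>")
      (auto simp only: op_D_def op_single_def plus_fun_apply if_True if_False d_zero simp_thms add_0_right add_0_left split: if_splits)
qed

text \<open>Both sides are additive in \<open>X\<close>, so only a single term c \<theta> matters,
  where the claim is the commutation rule \<partial>_i c = c \<partial>_i + d_i(c).\<close>

lemma D_times:
  assumes i: "i < m" and X: "X \<in> opset"
  shows "op_D d i (X \<star> Y) = op_D d i X \<star> Y"
proof -
  let ?A = "{\<theta>. X \<theta> \<noteq> 0}"
  have f: "finite ?A" using X by (simp add: ops_type_ring)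
  have A: "\<theta> \<in> midx m" if "\<theta> \<in> ?A" for \<theta> using that X by (auto simp: ops_type_ring)
  have X_eq: "X = (\<Sum>\<theta>\<in>?A. op_single \<theta> (X \<theta>))" by (rule ops_eq_sum_single[OF f]) simp
  have "op_D d i X \<star> Y = (\<Sum>\<theta>\<in>?A. (op_D d i (op_single \<theta> (X \<theta>))) \<star> Y)"
    by (subst X_eq, subst D_sum[OF i], subst times_sum_left) (use A i in \<open>auto intro!: ops_D\<close>)
  also have "\<dots> = (\<Sum>\<theta>\<in>?A. op_scale (d i (X \<theta>)) (th \<theta> Y) + op_scale (X \<theta>) (op_D d i (th \<theta> Y)))"
    by (rule sum.cong) (use A i in \<open>auto simp: D_single times_add_left midx_upd_Suc times_single_left th_upd_Suc\<close>)
  also have "\<dots> = op_D d i (X \<star> Y)"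
    unfolding op_times_def by (simp add: D_sum[OF i] D_scale[OF i])
  finally show ?thesis by simp
qed

text \<open>The coefficients of \<open>X\<close> pass through as scalars, so it suffices that
  \<open>th \<theta>\<close> commutes with right multiplication by \<open>Z\<close>, and this is
  \<open>D_times\<close> iterated.\<close>

lemma times_assoc:
  assumes "Y \<in> opset"
  shows "(X \<star> Y) \<star> Z = X \<star> (Y \<star> Z)"
proof -
  have "th \<theta> (Y \<star> Z) = th \<theta> Y \<star> Z" for \<theta>
    by (rule dpow_intertwine(1)[of m opset]) (use assms in \<open>auto simp: ops_D D_times\<close>)
  moreover have "(X \<star> Y) \<star> Z = (\<Sum>\<theta> | X \<theta> \<noteq> 0. op_scale (X \<theta>) (th \<theta> Y \<star> Z))"
    unfolding op_times_def[of d m X Y]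
    by (subst times_sum_left) (use assms in \<open>auto simp: times_scale_left\<close>)
  ultimately show ?thesis by (simp add: op_times_def[of d m X])
qed

lemma times_one_left: "op_single 0 1 \<star> X = X"
  by (simp add: times_single_left)

end

section \<open>Counting\<close>

definition mi_upto :: "nat \<Rightarrow> nat \<Rightarrow> (nat \<Rightarrow> nat) set" where
  "mi_upto m s = {\<theta> \<in> midx m. mi_ord m \<theta> \<le> s}"

text \<open>Stars and bars: the slack s - ord \<theta>, appended as one more entry, turns the
  inequality into a list of fixed sum.\<close>

lemma mi_upto_bij:
  "bij_betw (\<lambda>\<theta>. map \<theta> [0..<m] @ [s - mi_ord m \<theta>]) (mi_upto m s)
     {l :: nat list. length l = Suc m \<and> sum_list l = s}"
proof (rule bij_betw_byWitness[where f' = "\<lambda>l i. if i < m then l ! i else 0"])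
  have ord: "mi_ord m \<theta> = sum_list (map \<theta> [0..<m])" for \<theta>
    by (simp add: mi_ord_def sum_list_distinct_conv_sum_set atLeast0LessThan)
  show "\<forall>\<theta>\<in>mi_upto m s. (\<lambda>i. if i < m then (map \<theta> [0..<m] @ [s - mi_ord m \<theta>]) ! i else 0) = \<theta>"
    by (auto simp: mi_upto_def midx_def fun_eq_iff nth_append)
  show "(\<lambda>\<theta>. map \<theta> [0..<m] @ [s - mi_ord m \<theta>]) ` mi_upto m s
      \<subseteq> {l. length l = Suc m \<and> sum_list l = s}"
    by (auto simp: mi_upto_def ord)
  have *: "\<exists>l' x. l = l' @ [x] \<and> length l' = m" if "length l = Suc m" for l :: "nat list"
    using that by (metis append_butlast_last_id diff_Suc_1 length_0_conv length_butlast nat.distinct(1))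
  have map: "map (\<lambda>i. if i < m then (l @ [x]) ! i else 0) [0..<m] = l"
    if "length l = m" for l and x :: nat
    using that by (intro nth_equalityI) (auto simp: nth_append)
  show "\<forall>l\<in>{l. length l = Suc m \<and> sum_list l = s}.
      map (\<lambda>i. if i < m then l ! i else 0) [0..<m] @ [s - mi_ord m (\<lambda>i. if i < m then l ! i else 0)] = l"
  proof
    fix l :: "nat list" assume l: "l \<in> {l. length l = Suc m \<and> sum_list l = s}"
    then obtain l' x where l': "l = l' @ [x]" "length l' = m" using * by blast
    show "map (\<lambda>i. if i < m then l ! i else 0) [0..<m] @ [s - mi_ord m (\<lambda>i. if i < m then l ! i else 0)] = l"
      unfolding ord l'(1) map[OF l'(2)] using l l'(1) by auto
  qed
  show "(\<lambda>l i. if i < m then l ! i else 0) ` {l. length l = Suc m \<and> sum_list l = s} \<subseteq> mi_upto m s"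
  proof clarify
    fix l :: "nat list" assume l: "length l = Suc m" "s = sum_list l"
    then obtain l' x where l': "l = l' @ [x]" "length l' = m" using * by blast
    show "(\<lambda>i. if i < m then l ! i else 0) \<in> mi_upto m (sum_list l)"
      unfolding mi_upto_def mem_Collect_eq ord l'(1) map[OF l'(2)] by (simp add: midx_def)
  qed
qed

lemma finite_mi_upto [simp]: "finite (mi_upto m s)"
proof -
  have "{l :: nat list. length l = Suc m \<and> sum_list l = s}
      \<subseteq> {l. set l \<subseteq> {..s} \<and> length l = Suc m}"
    using member_le_sum_list by fastforce
  then have "finite {l :: nat list. length l = Suc m \<and> sum_list l = s}"
    by (rule finite_subset) (simp add: finite_lists_length_eq)
  then show ?thesis using bij_betw_finite[OF mi_upto_bij] by blast
qed

lemma card_mi_upto: "card (mi_upto m s) = (s + m) choose m"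
  using bij_betw_same_card[OF mi_upto_bij, of m s] card_length_sum_list[of "Suc m" s]
    binomial_symmetric[of m "s + m"] by simp

text \<open>With x = e / (s + 1), the quotient of the two binomials is a product of m factors (s + e
  + k) / (s + k) <= 1 + x, and (1 + x)^m (1 - m x) <= 1 whenever 1 - m x >= 0; otherwise the left
  side is not positive. The induction takes in one factor at a time.\<close>

lemma binomial_shift_bound:
  "real ((s + e + m) choose m) * (1 - real m * (real e / real (s + 1))) \<le> real ((s + m) choose m)"
proof (induction m)
  case (Suc m)
  let ?x = "real e / real (s + 1)" and ?b = "real ((s + e + m) choose m)" and ?c = "real ((s + m) choose m)"
  show ?case
  proof (cases "1 - real (Suc m) * ?x \<ge> 0")
    case False
    then show ?thesis by (meson mult_nonneg_nonpos of_nat_0_le_iff order.trans linorder_not_le less_imp_le)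
  next
    case True
    have x: "?x \<ge> 0" by simp
    have binom: "real ((n + Suc m) choose Suc m) = real ((n + m) choose m) * (real (n + Suc m) / real (Suc m))" for n
      using Suc_times_binomial[of m "n + m"] by (simp add: field_simps del: of_nat_Suc binomial_Suc_Suc
          flip: of_nat_mult of_nat_add)
    have "real (s + e + Suc m) \<le> real (s + Suc m) * (1 + ?x)"
    proof -
      have "real (s + 1) * ?x \<le> real (s + Suc m) * ?x" by (intro mult_right_mono x) simp
      moreover have "real (s + 1) * ?x = real e" by simp
      ultimately show ?thesis by (simp add: distrib_left)
    qed
    then have "?b * (real (s + e + Suc m) / real (Suc m)) * (1 - real (Suc m) * ?x)
        \<le> ?b * (real (s + Suc m) * (1 + ?x) / real (Suc m)) * (1 - real (Suc m) * ?x)"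
      by (intro mult_right_mono mult_left_mono divide_right_mono True) auto
    also have "\<dots> = (real (s + Suc m) / real (Suc m)) * (?b * ((1 + ?x) * (1 - real (Suc m) * ?x)))"
      by simp
    also have "\<dots> \<le> (real (s + Suc m) / real (Suc m)) * (?b * (1 - real m * ?x))"
    proof (intro mult_left_mono)
      have "(1 + x) * (1 - real (Suc m) * x) = 1 - real m * x - real (Suc m) * x * x" for x
        by (simp add: algebra_simps)
      then show "(1 + ?x) * (1 - real (Suc m) * ?x) \<le> 1 - real m * ?x" using x
        by (simp only: diff_le_eq le_add_same_cancel1) (intro mult_nonneg_nonneg, auto)
    qed auto
    also have "\<dots> \<le> (real (s + Suc m) / real (Suc m)) * ?c"
      by (intro mult_left_mono Suc.IH) auto
    finally show ?thesis using binom[of s] binom[of "s + e"] by (simp only: mult.commute mult.assoc)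
  qed
qed simp

text \<open>Each summand exceeds binomial (s + m) m by at most the fraction 2 m e_j / (s + 1) of it,
  and these fractions sum to at most s / (s + 1) < 1.\<close>

lemma sum_binomial_less:
  assumes "finite J" and s: "s = 2 ^ m * (\<Sum>j\<in>J. e j)"
  shows "(\<Sum>j\<in>J. (s + e j + m) choose m) < (card J + 1) * ((s + m) choose m)"
proof -
  let ?c = "real ((s + m) choose m)"
  have pow: "2 * m \<le> 2 ^ m"
  proof (cases m)
    case (Suc k)
    then show ?thesis using Suc_leI[OF less_exp[of k]] by simp
  qed simp
  have "2 * m * (\<Sum>j\<in>J. e j) \<le> s" unfolding s by (rule mult_right_mono[OF pow]) simp
  then have sum: "2 * real m * (\<Sum>j\<in>J. real (e j)) \<le> real s"
    by (metis (mono_tags) of_nat_le_iff of_nat_mult of_nat_numeral of_nat_sum)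
  have cpos: "?c > 0" by simp
  have "real ((s + e j + m) choose m) \<le> ?c * (1 + 2 * real m * real (e j) / real (s + 1))" if "j \<in> J" for j
  proof -
    let ?y = "real m * (real (e j) / real (s + 1))" and ?b = "real ((s + e j + m) choose m)"
    have "real (e j) \<le> (\<Sum>j\<in>J. real (e j))" by (rule member_le_sum) (use that assms in auto)
    then have "2 * real m * real (e j) \<le> 2 * real m * (\<Sum>j\<in>J. real (e j))"
      by (rule mult_left_mono) simp
    with sum have "2 * real m * real (e j) \<le> real (s + 1)" by simp
    then have y: "0 \<le> ?y" "2 * ?y \<le> 1" by (auto simp: field_simps)
    \<comment> \<open>Inverts the factor 1 - y of the shift bound: 1 / (1 - y) <= 1 + 2 y as long as
      0 <= y <= 1/2.\<close>
    have "1 \<le> (1 - y) * (1 + 2 * y)" if "0 \<le> y" "2 * y \<le> 1" for y :: real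
      using mult_nonneg_nonneg[of y "1 - 2 * y"] that by (simp add: algebra_simps)
    from this[OF y] have "?b \<le> ?b * ((1 - ?y) * (1 + 2 * ?y))"
      by (metis mult_left_mono mult.right_neutral of_nat_0_le_iff)
    also have "\<dots> = ?b * (1 - ?y) * (1 + 2 * ?y)" by simp
    also have "\<dots> \<le> ?c * (1 + 2 * ?y)"
      by (rule mult_right_mono[OF binomial_shift_bound]) (use y in simp)
    finally show ?thesis by (simp add: mult.assoc)
  qed
  then have "(\<Sum>j\<in>J. real ((s + e j + m) choose m)) \<le> (\<Sum>j\<in>J. ?c * (1 + 2 * real m * real (e j) / real (s + 1)))"
    by (rule sum_mono)
  also have "\<dots> = ?c * (real (card J) + 2 * real m * (\<Sum>j\<in>J. real (e j)) / real (s + 1))"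
    by (simp add: sum_distrib_left[symmetric] sum.distrib sum_divide_distrib[symmetric] del: of_nat_add)
  also have "\<dots> < ?c * (real (card J) + 1)"
    using sum by (intro mult_strict_left_mono[OF _ cpos]) (simp add: field_simps)
  finally have "real (\<Sum>j\<in>J. (s + e j + m) choose m) < real ((card J + 1) * ((s + m) choose m))"
    by (simp add: algebra_simps)
  then show ?thesis by linarith
qed

text \<open>Gaussian elimination, one equation at a time: a nonzero entry \<open>a e p\<close>
  serves as pivot, and eliminating it costs one unknown for one equation.\<close>

lemma underdetermined_system:
  fixes a :: "'e \<Rightarrow> 'u \<Rightarrow> 'b::field"
  assumes "finite E" "finite U" "card E < card U"
  shows "\<exists>x. (\<exists>u\<in>U. x u \<noteq> 0) \<and> (\<forall>e\<in>E. (\<Sum>u\<in>U. x u * a e u) = 0)"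
  using assms
proof (induction E arbitrary: U a)
  case empty
  then obtain u where "u \<in> U" by fastforce
  then show ?case by (intro exI[of _ "\<lambda>_. 1"]) auto
next
  case (insert e E)
  show ?case
  proof (cases "\<forall>u\<in>U. a e u = 0")
    case True
    obtain x where "\<exists>u\<in>U. x u \<noteq> 0" "\<forall>e\<in>E. (\<Sum>u\<in>U. x u * a e u) = 0"
      using insert.IH[of U a] insert.prems insert.hyps by auto
    with True show ?thesis by (intro exI[of _ x]) auto
  next
    case False
    then obtain p where p: "p \<in> U" "a e p \<noteq> 0" by auto
    let ?U = "U - {p}"
    define b where "b = (\<lambda>f u. a f u - a f p * a e u / a e p)"
    have "card E < card ?U" using insert.prems insert.hyps p by (simp add: card_Diff_singleton)
    moreover have "finite ?U" using insert.prems by simp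
    ultimately obtain x where x: "\<exists>u\<in>?U. x u \<noteq> 0" "\<forall>f\<in>E. (\<Sum>u\<in>?U. x u * b f u) = 0"
      using insert.IH[of ?U b] by blast
    \<comment> \<open>The value of the pivot unknown that solves equation \<open>e\<close>; by the
      choice of \<open>b\<close>, it also completes the solution of the reduced system to one of the
      remaining equations.\<close>
    define t where "t = - (\<Sum>u\<in>?U. x u * a e u) / a e p"
    define y where "y = x(p := t)"
    have y: "(\<Sum>u\<in>U. y u * a f u) = t * a f p + (\<Sum>u\<in>?U. x u * a f u)" for f
      using insert.prems(1) p(1) by (subst sum.remove[of _ p]) (auto simp: y_def intro!: sum.cong)
    have "(\<Sum>u\<in>U. y u * a f u) = 0" if "f \<in> insert e E" for f
    proof (cases "f = e")
      case True
      then show ?thesis unfolding y t_def using p by simp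
    next
      case False
      then have "0 = (\<Sum>u\<in>?U. x u * b f u)" using that x by auto
      also have "\<dots> = (\<Sum>u\<in>?U. x u * a f u) - (\<Sum>u\<in>?U. x u * a e u) * (a f p / a e p)"
        unfolding b_def by (simp add: right_diff_distrib sum_subtractf sum_distrib_right mult.assoc
            sum_divide_distrib mult.commute[of "a f p"] mult.left_commute[of _ "a f p"])
      finally show ?thesis unfolding y t_def by (simp add: field_simps)
    qed
    moreover have "\<exists>u\<in>U. y u \<noteq> 0" using x(1) by (auto simp: y_def)
    ultimately show ?thesis by blast
  qed
qed

section \<open>Relations of bounded order between vectors of operators\<close>

context dfield
begin

abbreviation "ordle \<equiv> ord_le (type_ring :: 'a ring) m"

lemma ordle_iff: "ordle X r \<longleftrightarrow> (\<forall>\<theta>. X \<theta> \<noteq> 0 \<longrightarrow> mi_ord m \<theta> \<le> r)"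
  by (simp add: ord_le_def)

lemma ordle_D:
  assumes "i < m" "ordle X r"
  shows "ordle (op_D d i X) (Suc r)"
  unfolding ordle_iff
proof (intro allI impI)
  fix \<kappa> assume a: "op_D d i X \<kappa> \<noteq> 0"
  show "mi_ord m \<kappa> \<le> Suc r"
  proof (cases "X \<kappa> = 0")
    case True
    with a assms have *: "\<kappa> i \<noteq> 0" "X (\<kappa>(i := \<kappa> i - 1)) \<noteq> 0"
      by (auto simp: op_D_def split: if_splits)
    then have "mi_ord m (\<kappa>(i := \<kappa> i - 1)) \<le> r" using assms by (simp add: ordle_iff)
    with mi_ord_upd_Suc[OF assms(1), of "\<kappa>(i := \<kappa> i - 1)"] * show ?thesis by simp
  qed (use assms in \<open>auto simp: ordle_iff intro: le_SucI\<close>)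
qed

lemma ordle_th:
  assumes "\<theta> \<in> midx m" "ordle X r"
  shows "ordle (th \<theta> X) (mi_ord m \<theta> + r)"
  using assms(1)
proof (induction \<theta> rule: midx_induct)
  case (Suc \<theta> i)
  then show ?case using ordle_D[of i "th \<theta> X"] by (simp only: th_upd_Suc mi_ord_upd_Suc add_Suc)
qed (use assms in simp)

text \<open>Scalars stand to the left of \<theta>, so the coefficients of the unknown operators are
  never differentiated; this is what makes the relation an ordinary linear system over the
  field.\<close>

lemma exists_relation:
  assumes fin: "finite I" "finite J" and card: "card J < card I"
    and v: "\<And>i j. i \<in> I \<Longrightarrow> j \<in> J \<Longrightarrow> v i j \<in> opset \<and> ordle (v i j) (e j)"
    and s: "s = 2 ^ m * (\<Sum>j\<in>J. e j)"
  shows "\<exists>X. (\<forall>i. X i \<in> opset \<and> ordle (X i) s) \<and> (\<exists>i\<in>I. X i \<noteq> 0) \<and>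
           (\<forall>j\<in>J. (\<Sum>i\<in>I. X i \<star> v i j) = 0)"
proof -
  let ?E = "SIGMA j:J. mi_upto m (s + e j)" and ?U = "I \<times> mi_upto m s"
  have "card ?E = (\<Sum>j\<in>J. (s + e j + m) choose m)" using fin by (simp add: card_mi_upto)
  also have "\<dots> < (card J + 1) * ((s + m) choose m)" by (rule sum_binomial_less[OF fin(2) s])
  also have "\<dots> \<le> card I * ((s + m) choose m)" using card by (intro mult_right_mono) auto
  also have "\<dots> = card ?U" by (simp add: card_mi_upto card_cartesian_product)
  finally have less: "card ?E < card ?U" .
  have "finite ?E" "finite ?U" using fin by auto
  from underdetermined_system[OF this less, of "\<lambda>(j, \<kappa>) (i, \<theta>). th \<theta> (v i j) \<kappa>"]
  obtain x where x: "\<exists>u\<in>?U. x u \<noteq> 0"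
    "\<forall>f\<in>?E. (\<Sum>u\<in>?U. x u * (case f of (j, \<kappa>) \<Rightarrow> \<lambda>(i, \<theta>). th \<theta> (v i j) \<kappa>) u) = 0"
    by blast
  define X where "X = (\<lambda>i \<theta>. if \<theta> \<in> mi_upto m s then x (i, \<theta>) else 0)"
  have supp: "{\<theta>. X i \<theta> \<noteq> 0} \<subseteq> mi_upto m s" for i by (auto simp: X_def)
  have "finite {\<theta>. X i \<theta> \<noteq> 0}" for i by (rule finite_subset[OF supp]) simp
  then have X: "X i \<in> opset" "ordle (X i) s" for i
    by (auto simp: ops_type_ring ordle_iff X_def mi_upto_def)
  have "(\<Sum>i\<in>I. X i \<star> v i j) \<kappa> = 0" if j: "j \<in> J" for j \<kappa>
  proof -
    have "(\<Sum>i\<in>I. X i \<star> v i j) \<kappa> = (\<Sum>i\<in>I. \<Sum>\<theta>\<in>mi_upto m s. X i \<theta> * th \<theta> (v i j) \<kappa>)"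
      by (simp add: sum_fun_apply times_superset[OF finite_mi_upto supp] op_scale_def)
    also have "\<dots> = (\<Sum>i\<in>I. \<Sum>\<theta>\<in>mi_upto m s. x (i, \<theta>) * th \<theta> (v i j) \<kappa>)"
      by (auto simp: X_def intro!: sum.cong)
    also have "\<dots> = (\<Sum>u\<in>?U. x u * (case u of (i, \<theta>) \<Rightarrow> th \<theta> (v i j) \<kappa>))"
      by (simp add: sum.cartesian_product case_prod_beta)
    also have "\<dots> = 0"
    proof (cases "\<kappa> \<in> mi_upto m (s + e j)")
      case True
      with x(2) j show ?thesis by (auto simp: case_prod_beta)
    next
      case False
      \<comment> \<open>Beyond order s + e_j the coefficient vanishes whatever the unknowns are, so
        no equation had to be imposed there.\<close>
      have "th \<theta> (v i j) \<kappa> = 0" if "i \<in> I" "\<theta> \<in> mi_upto m s" for i \<theta>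
      proof (rule ccontr)
        assume nz: "th \<theta> (v i j) \<kappa> \<noteq> 0"
        have \<theta>: "\<theta> \<in> midx m" "mi_ord m \<theta> \<le> s" using that by (auto simp: mi_upto_def)
        have "mi_ord m \<kappa> \<le> mi_ord m \<theta> + e j"
          using ordle_th[OF \<theta>(1), of "v i j" "e j"] v[OF that(1) j] nz by (auto simp: ordle_iff)
        moreover have "\<kappa> \<in> midx m" using v[OF that(1) j] nz ops_th[of "v i j" \<theta>]
          by (auto simp: ops_type_ring)
        ultimately show False using False \<theta> by (auto simp: mi_upto_def)
      qed
      then show ?thesis by (auto intro!: sum.neutral)
    qed
    finally show ?thesis .
  qed
  moreover have "\<exists>i\<in>I. X i \<noteq> 0"
  proof -
    from x(1) obtain i \<theta> where "i \<in> I" "\<theta> \<in> mi_upto m s" "x (i, \<theta>) \<noteq> 0" by auto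
    then have "X i \<theta> \<noteq> 0" by (simp add: X_def)
    with \<open>i \<in> I\<close> show ?thesis by (metis zero_fun_apply)
  qed
  ultimately show ?thesis using X by (intro exI[of _ X]) (auto simp: fun_eq_iff)
qed

end

section \<open>The ring of operators has no zero divisors\<close>

text \<open>Finitely supported maps carry a linear order compatible with addition, hence a monomial
  order; plain functions are only partially ordered.\<close>

abbreviation mi_pm :: "(nat \<Rightarrow> nat) \<Rightarrow> nat \<Rightarrow>\<^sub>0 nat" where
  "mi_pm \<equiv> Abs_poly_mapping"

lemma lookup_mi_pm [simp]: "\<theta> \<in> midx m \<Longrightarrow> Poly_Mapping.lookup (mi_pm \<theta>) = \<theta>"
  by (rule lookup_Abs_poly_mapping, rule finite_subset[of _ "{..<m}"]) (auto simp: midx_def intro: leI)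

lemma mi_pm_inj: "\<theta> \<in> midx m \<Longrightarrow> \<kappa> \<in> midx m \<Longrightarrow> mi_pm \<theta> = mi_pm \<kappa> \<longleftrightarrow> \<theta> = \<kappa>"
  by (metis lookup_mi_pm)

lemma mi_pm_add: "\<theta> \<in> midx m \<Longrightarrow> \<kappa> \<in> midx m \<Longrightarrow> mi_pm (\<theta> + \<kappa>) = mi_pm \<theta> + mi_pm \<kappa>"
  by (rule poly_mapping_eqI) (simp add: lookup_add lookup_mi_pm[of _ m])

lemma mi_pm_Suc:
  assumes "\<theta> \<in> midx m" "i < m"
  shows "mi_pm (\<theta>(i := Suc (\<theta> i))) = mi_pm \<theta> + Poly_Mapping.single i 1"
  using assms
  by (intro poly_mapping_eqI) (auto simp: lookup_add lookup_single lookup_mi_pm[of _ m] midx_upd_Suc when_def)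

lemma single_pos: "(0 :: nat \<Rightarrow>\<^sub>0 nat) < Poly_Mapping.single i 1"
  unfolding less_poly_mapping.rep_eq less_fun_def
  by (rule exI[of _ i]) (auto simp: lookup_single when_def)

context dfield
begin

text \<open>Applying \<partial>_i to a term at \<kappa> gives the same coefficient at \<kappa> plus
  the i-th unit vector, and a differentiated one at \<kappa> itself, which is smaller. So the
  leading exponent shifts by \<theta> and its coefficient is never differentiated.\<close>

lemma leading_th:
  assumes Y: "Y \<in> opset" and \<beta>: "\<beta> \<in> midx m" "\<And>\<kappa>. Y \<kappa> \<noteq> 0 \<Longrightarrow> mi_pm \<kappa> \<le> mi_pm \<beta>"
    and "\<theta> \<in> midx m"
  shows "(\<forall>\<kappa>. th \<theta> Y \<kappa> \<noteq> 0 \<longrightarrow> mi_pm \<kappa> \<le> mi_pm (\<theta> + \<beta>)) \<and> th \<theta> Y (\<theta> + \<beta>) = Y \<beta>"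
  using assms(4)
proof (induction \<theta> rule: midx_induct)
  case (Suc \<theta> i)
  let ?Z = "th \<theta> Y" and ?\<gamma> = "\<theta> + \<beta>"
  let ?g = "?\<gamma>(i := Suc (?\<gamma> i))"
  have Z: "?Z \<in> opset" using Y by simp
  have \<gamma>: "?\<gamma> \<in> midx m" using Suc \<beta> by simp
  have g: "\<theta>(i := Suc (\<theta> i)) + \<beta> = ?g" by auto
  have less: "mi_pm ?\<gamma> < mi_pm ?g"
    unfolding mi_pm_Suc[OF \<gamma> Suc.hyps(2)] using single_pos[of i]
    by (metis add.right_neutral add_strict_left_mono)
  have "mi_pm \<kappa> \<le> mi_pm ?g" if a: "op_D d i ?Z \<kappa> \<noteq> 0" for \<kappa>
  proof (cases "?Z \<kappa> = 0")
    case True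
    with a Suc.hyps have *: "\<kappa> i \<noteq> 0" "?Z (\<kappa>(i := \<kappa> i - 1)) \<noteq> 0"
      by (auto simp: op_D_def split: if_splits)
    then have "mi_pm (\<kappa>(i := \<kappa> i - 1)) + Poly_Mapping.single i 1 \<le> mi_pm ?\<gamma> + Poly_Mapping.single i 1"
      using Suc.IH by (intro add_right_mono) blast
    moreover have "\<kappa>(i := \<kappa> i - 1) \<in> midx m" using * Z by (auto simp: ops_type_ring)
    ultimately show ?thesis
      using mi_pm_Suc[of "\<kappa>(i := \<kappa> i - 1)" m i] mi_pm_Suc[OF \<gamma>, of i] Suc.hyps * by simp
  next
    case False
    then show ?thesis using Suc.IH less by (metis order.trans less_imp_le)
  qed
  moreover have "op_D d i ?Z ?g = Y \<beta>"
  proof -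
    have "?Z ?g = 0" using Suc.IH less by (metis leD)
    moreover have "?g(i := ?g i - 1) = ?\<gamma>" "?g i \<noteq> 0" by (simp_all only: fun_upd_same diff_Suc_1 fun_upd_upd fun_upd_triv)
    moreover have "?Z ?\<gamma> = Y \<beta>" using Suc.IH by blast
    ultimately show ?thesis using Suc.hyps(2)
      by (simp only: op_D_apply[of d i ?Z ?g] d_zero if_False add_0_left)
  qed
  ultimately show ?case by (simp only: g th_upd_Suc[OF Suc.hyps(2)]) blast
qed (use assms in \<open>simp add: dpow_zero\<close>)

lemma leading_exists:
  assumes "X \<in> opset" "X \<noteq> 0"
  obtains \<alpha> where "X \<alpha> \<noteq> 0" "\<alpha> \<in> midx m" "\<And>\<kappa>. X \<kappa> \<noteq> 0 \<Longrightarrow> mi_pm \<kappa> \<le> mi_pm \<alpha>"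
proof -
  let ?A = "mi_pm ` {\<theta>. X \<theta> \<noteq> 0}"
  have "finite ?A" "?A \<noteq> {}" using assms by (auto simp: ops_type_ring fun_eq_iff)
  then have "Max ?A \<in> ?A" "\<And>x. x \<in> ?A \<Longrightarrow> x \<le> Max ?A" by auto
  moreover from this(1) obtain \<alpha> where "X \<alpha> \<noteq> 0" "mi_pm \<alpha> = Max ?A" by auto
  ultimately show ?thesis using that[of \<alpha>] assms(1) by (auto simp: ops_type_ring)
qed

text \<open>Leading coefficients multiply: at exponent \<alpha> + \<beta> only the leading term of
  \<open>X\<close> contributes, and the scalars form a field.\<close>

lemma times_eq_0_iff:
  assumes X: "X \<in> opset" and Y: "Y \<in> opset"
  shows "X \<star> Y = 0 \<longleftrightarrow> X = 0 \<or> Y = 0"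
proof
  assume XY: "X \<star> Y = 0"
  show "X = 0 \<or> Y = 0"
  proof (rule ccontr)
    assume "\<not> (X = 0 \<or> Y = 0)"
    then have "X \<noteq> 0" "Y \<noteq> 0" by auto
    obtain \<alpha> where \<alpha>: "X \<alpha> \<noteq> 0" "\<alpha> \<in> midx m" "\<And>\<kappa>. X \<kappa> \<noteq> 0 \<Longrightarrow> mi_pm \<kappa> \<le> mi_pm \<alpha>"
      using leading_exists[OF X \<open>X \<noteq> 0\<close>] by blast
    obtain \<beta> where \<beta>: "Y \<beta> \<noteq> 0" "\<beta> \<in> midx m" "\<And>\<kappa>. Y \<kappa> \<noteq> 0 \<Longrightarrow> mi_pm \<kappa> \<le> mi_pm \<beta>"
      using leading_exists[OF Y \<open>Y \<noteq> 0\<close>] by blast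
    have zero: "th \<theta> Y (\<alpha> + \<beta>) = 0" if "X \<theta> \<noteq> 0" "\<theta> \<noteq> \<alpha>" for \<theta>
    proof -
      have \<theta>: "\<theta> \<in> midx m" using X that by (auto simp: ops_type_ring)
      have "mi_pm \<theta> < mi_pm \<alpha>" using \<alpha> that mi_pm_inj[OF \<theta> \<alpha>(2)] by (simp add: less_le)
      then have "mi_pm (\<theta> + \<beta>) < mi_pm (\<alpha> + \<beta>)"
        using \<theta> \<alpha>(2) \<beta>(2) by (simp add: mi_pm_add[of _ m])
      with leading_th[OF Y \<beta>(2,3) \<theta>] show ?thesis by (metis leD)
    qed
    have "0 = (X \<star> Y) (\<alpha> + \<beta>)" using XY by simp
    also have "\<dots> = (\<Sum>\<theta> | X \<theta> \<noteq> 0. X \<theta> * th \<theta> Y (\<alpha> + \<beta>))"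
      by (simp add: op_times_def op_scale_def sum_fun_apply)
    also have "\<dots> = (\<Sum>\<theta> | X \<theta> \<noteq> 0. if \<theta> = \<alpha> then X \<alpha> * Y \<beta> else 0)"
      by (rule sum.cong) (use zero leading_th[OF Y \<beta>(2,3) \<alpha>(2)] in auto)
    also have "\<dots> = X \<alpha> * Y \<beta>" using X \<alpha> by (simp add: ops_type_ring)
    finally show False using \<alpha> \<beta> by simp
  qed
qed auto

end

section \<open>Comparison with the Leibniz product\<close>

lemma mbinom_upd_Suc:
  assumes "i < m"
  shows "mbinom m (\<theta>(i := Suc (\<theta> i))) \<nu> =
    mbinom m \<theta> \<nu> + (if \<nu> i = 0 then 0 else mbinom m \<theta> (\<nu>(i := \<nu> i - 1)))"
proof -
  have rem: "mbinom m \<theta> \<nu> = (\<theta> i choose \<nu> i) * (\<Prod>k\<in>{..<m} - {i}. \<theta> k choose \<nu> k)" for \<theta> \<nu>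
    using assms by (simp add: mbinom_def prod.remove[of "{..<m}" i])
  have rest: "(\<Prod>k\<in>{..<m} - {i}. (\<theta>(i := a)) k choose (\<nu>(i := b)) k)
      = (\<Prod>k\<in>{..<m} - {i}. \<theta> k choose \<nu> k)" for a b \<nu>
    by (rule prod.cong) auto
  show ?thesis
    using rest[of "Suc (\<theta> i)" \<nu> "\<nu> i"] rest[of "\<theta> i" \<nu> "\<nu> i - 1"]
    by (cases "\<nu> i") (simp_all add: rem algebra_simps)
qed

lemma mbinom_eq_0: "i < m \<Longrightarrow> \<theta> i < \<nu> i \<Longrightarrow> mbinom m \<theta> \<nu> = 0"
  unfolding mbinom_def by (rule prod_zero) auto

lemma mbinom_self [simp]: "mbinom m \<theta> \<theta> = 1"
  by (simp add: mbinom_def)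

lemma finite_le_midx:
  assumes "\<theta> \<in> midx m"
  shows "finite {\<nu> :: nat \<Rightarrow> nat. \<nu> \<le> \<theta>}"
proof (rule finite_subset)
  show "{\<nu>. \<nu> \<le> \<theta>} \<subseteq> mi_upto m (mi_ord m \<theta>)"
    using assms midx_le by (auto simp: mi_upto_def mi_ord_def le_fun_def intro!: sum_mono)
qed simp

lemma op_single_add: "op_single \<theta> (a + b) = op_single \<theta> a + op_single \<theta> b"
  by (auto simp: op_single_def fun_eq_iff)

lemma op_single_apply: "op_single \<theta> c \<kappa> = (if \<theta> = \<kappa> then c else 0)"
  by (auto simp: op_single_def)

context dfield
begin

lemma d_dpow_Suc: "i < m \<Longrightarrow> dpow d m (\<nu>(i := Suc (\<nu> i))) x = d i (dpow d m \<nu> x)"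
  by (rule dpow_upd_Suc) (auto simp: d_comm)

text \<open>The multivariate Leibniz rule. Applying \<partial>_i splits each term in two, one
  raising the exponent and one differentiating the coefficient further; Pascal's rule
  \<open>mbinom_upd_Suc\<close> recombines them.\<close>

lemma th_single:
  assumes "\<theta> \<in> midx m"
  shows "th \<theta> (op_single \<beta> b) =
    (\<Sum>\<nu> | \<nu> \<le> \<theta>. op_single (\<lambda>i. \<theta> i - \<nu> i + \<beta> i) (of_nat (mbinom m \<theta> \<nu>) * dpow d m \<nu> b))"
  using assms
proof (induction \<theta> rule: midx_induct)
  case zero
  have "{\<nu> :: nat \<Rightarrow> nat. \<nu> \<le> (\<lambda>_. 0)} = {\<lambda>_. 0}" by (auto simp: le_fun_def)
  then show ?case by simp
next
  case (Suc \<theta> i)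
  note i = Suc.hyps(2)
  let ?t = "\<theta>(i := Suc (\<theta> i))"
  define g where "g = (\<lambda>(\<theta> :: nat \<Rightarrow> nat) \<nu> k. \<theta> k - \<nu> k + \<beta> k)"
  define f where "f = (\<lambda>\<nu> :: nat \<Rightarrow> nat. \<nu>(i := Suc (\<nu> i)))"
  have fin: "finite {\<nu>. \<nu> \<le> ?t}" "finite {\<nu>. \<nu> \<le> \<theta>}"
    using Suc.hyps by (auto intro: finite_le_midx midx_upd_Suc)
  have "th ?t (op_single \<beta> b) =
      op_D d i (\<Sum>\<nu> | \<nu> \<le> \<theta>. op_single (g \<theta> \<nu>) (of_nat (mbinom m \<theta> \<nu>) * dpow d m \<nu> b))"
    unfolding th_upd_Suc[OF i] g_def using Suc.IH by (simp only:)
  also have "\<dots> = (\<Sum>\<nu> | \<nu> \<le> \<theta>. op_single ((g \<theta> \<nu>)(i := Suc (g \<theta> \<nu> i))) (of_nat (mbinom m \<theta> \<nu>) * dpow d m \<nu> b))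
      + (\<Sum>\<nu> | \<nu> \<le> \<theta>. op_single (g \<theta> \<nu>) (of_nat (mbinom m \<theta> \<nu>) * dpow d m (f \<nu>) b))"
    unfolding D_sum[OF i] D_single[OF i] sum.distrib d_of_nat_mult[OF i] f_def d_dpow_Suc[OF i]
    by (simp only: add.commute)
  \<comment> \<open>Passing to the range below \<open>?t\<close> adds only \<nu> with \<nu> i =
    \<theta> i + 1, whose binomial vanishes. For the old \<nu> the natural subtraction in
    \<open>g\<close> is exact, so it commutes with the successor.\<close>
  also have "(\<Sum>\<nu> | \<nu> \<le> \<theta>. op_single ((g \<theta> \<nu>)(i := Suc (g \<theta> \<nu> i))) (of_nat (mbinom m \<theta> \<nu>) * dpow d m \<nu> b))
      = (\<Sum>\<nu> | \<nu> \<le> ?t. op_single (g ?t \<nu>) (of_nat (mbinom m \<theta> \<nu>) * dpow d m \<nu> b))"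
  proof (rule sum.mono_neutral_cong_left[OF fin(1)])
    show "{\<nu>. \<nu> \<le> \<theta>} \<subseteq> {\<nu>. \<nu> \<le> ?t}"
      by (auto simp: le_fun_def intro: le_SucI)
    show "\<forall>\<nu>\<in>{\<nu>. \<nu> \<le> ?t} - {\<nu>. \<nu> \<le> \<theta>}. op_single (g ?t \<nu>) (of_nat (mbinom m \<theta> \<nu>) * dpow d m \<nu> b) = 0"
    proof
      fix \<nu> assume \<nu>: "\<nu> \<in> {\<nu>. \<nu> \<le> ?t} - {\<nu>. \<nu> \<le> \<theta>}"
      then obtain k where k: "\<theta> k < \<nu> k" "\<nu> k \<le> ?t k" by (auto simp: le_fun_def not_le)
      then have "k = i" by (cases "k = i") auto
      with k have "\<theta> i < \<nu> i" by simp
      then show "op_single (g ?t \<nu>) (of_nat (mbinom m \<theta> \<nu>) * dpow d m \<nu> b) = 0"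
        by (simp add: mbinom_eq_0[OF i])
    qed
    fix \<nu> assume "\<nu> \<in> {\<nu>. \<nu> \<le> \<theta>}"
    then have "(g \<theta> \<nu>)(i := Suc (g \<theta> \<nu> i)) = g ?t \<nu>"
      by (auto simp: g_def fun_eq_iff le_fun_def Suc_diff_le)
    then show "op_single ((g \<theta> \<nu>)(i := Suc (g \<theta> \<nu> i))) (of_nat (mbinom m \<theta> \<nu>) * dpow d m \<nu> b)
        = op_single (g ?t \<nu>) (of_nat (mbinom m \<theta> \<nu>) * dpow d m \<nu> b)" by simp
  qed
  \<comment> \<open>Reindexing by \<open>f\<close> produces the second summand of Pascal's rule; its
    value 0 at \<open>\<nu> i = 0\<close> covers the indices outside the image of
    \<open>f\<close>.\<close>
  also have "(\<Sum>\<nu> | \<nu> \<le> \<theta>. op_single (g \<theta> \<nu>) (of_nat (mbinom m \<theta> \<nu>) * dpow d m (f \<nu>) b))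
      = (\<Sum>\<nu> \<in> f ` {\<nu>. \<nu> \<le> \<theta>}. op_single (g ?t \<nu>)
          (of_nat (if \<nu> i = 0 then 0 else mbinom m \<theta> (\<nu>(i := \<nu> i - 1))) * dpow d m \<nu> b))"
  proof (subst sum.reindex)
    show "inj_on f {\<nu>. \<nu> \<le> \<theta>}"
    proof (rule inj_onI)
      fix x y assume "f x = f y"
      then have "(f x)(i := f x i - 1) = (f y)(i := f y i - 1)" by simp
      then show "x = y" by (simp add: f_def)
    qed
    have "g \<theta> \<nu> = g ?t (f \<nu>)" for \<nu> by (auto simp: g_def f_def)
    moreover have "f \<nu> i \<noteq> 0" "(f \<nu>)(i := f \<nu> i - 1) = \<nu>" for \<nu> by (auto simp: f_def)
    ultimately show "(\<Sum>\<nu> | \<nu> \<le> \<theta>. op_single (g \<theta> \<nu>) (of_nat (mbinom m \<theta> \<nu>) * dpow d m (f \<nu>) b))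
      = sum ((\<lambda>\<nu>. op_single (g ?t \<nu>)
          (of_nat (if \<nu> i = 0 then 0 else mbinom m \<theta> (\<nu>(i := \<nu> i - 1))) * dpow d m \<nu> b)) \<circ> f) {\<nu>. \<nu> \<le> \<theta>}"
      by (simp only: o_def if_False)
  qed
  also have "\<dots> = (\<Sum>\<nu> | \<nu> \<le> ?t. op_single (g ?t \<nu>)
          (of_nat (if \<nu> i = 0 then 0 else mbinom m \<theta> (\<nu>(i := \<nu> i - 1))) * dpow d m \<nu> b))"
  proof (rule sum.mono_neutral_left[OF fin(1)])
    show "f ` {\<nu>. \<nu> \<le> \<theta>} \<subseteq> {\<nu>. \<nu> \<le> ?t}" by (auto simp: f_def le_fun_def)
    have "\<nu> \<in> f ` {\<nu>. \<nu> \<le> \<theta>}" if \<nu>: "\<nu> \<le> ?t" "\<nu> i \<noteq> 0" for \<nu>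
    proof
      show "\<nu> = f (\<nu>(i := \<nu> i - 1))" using that by (auto simp: f_def)
      show "\<nu>(i := \<nu> i - 1) \<in> {\<nu>. \<nu> \<le> \<theta>}"
      proof -
        have "(\<nu>(i := \<nu> i - 1)) k \<le> \<theta> k" for k using le_funD[OF \<nu>(1), of k] by (cases "k = i") auto
        then show ?thesis by (simp add: le_fun_def)
      qed
    qed
    then show "\<forall>\<nu>\<in>{\<nu>. \<nu> \<le> ?t} - f ` {\<nu>. \<nu> \<le> \<theta>}. op_single (g ?t \<nu>)
          (of_nat (if \<nu> i = 0 then 0 else mbinom m \<theta> (\<nu>(i := \<nu> i - 1))) * dpow d m \<nu> b) = 0"
      by auto
  qed
  also have "(\<Sum>\<nu> | \<nu> \<le> ?t. op_single (g ?t \<nu>) (of_nat (mbinom m \<theta> \<nu>) * dpow d m \<nu> b)) + \<dots>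
      = (\<Sum>\<nu> | \<nu> \<le> ?t. op_single (g ?t \<nu>) (of_nat (mbinom m ?t \<nu>) * dpow d m \<nu> b))"
    unfolding mbinom_upd_Suc[OF i] sum.distrib[symmetric] of_nat_add distrib_right op_single_add ..
  finally show ?case unfolding g_def .
qed

text \<open>Written with the nested summation ranges of \<open>op_mul\<close>, so that the two
  products agree term by term.\<close>

lemma times_apply:
  assumes X: "X \<in> opset" and Y: "Y \<in> opset"
  shows "(X \<star> Y) \<kappa> = (\<Sum>\<theta> | X \<theta> \<noteq> 0. \<Sum>\<theta>' | Y \<theta>' \<noteq> 0.
    \<Sum>\<nu> | \<nu> \<in> midx m \<and> (\<forall>i. \<nu> i \<le> \<theta> i) \<and> (\<lambda>i. \<theta> i - \<nu> i + \<theta>' i) = \<kappa>.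
      of_nat (mbinom m \<theta> \<nu>) * (X \<theta> * dpow d m \<nu> (Y \<theta>')))"
proof -
  have Y_eq: "Y = (\<Sum>\<theta>' | Y \<theta>' \<noteq> 0. op_single \<theta>' (Y \<theta>'))"
    by (rule ops_eq_sum_single) (use Y in \<open>auto simp: ops_type_ring\<close>)
  have "X \<theta> * th \<theta> Y \<kappa> = (\<Sum>\<theta>' | Y \<theta>' \<noteq> 0.
    \<Sum>\<nu> | \<nu> \<in> midx m \<and> (\<forall>i. \<nu> i \<le> \<theta> i) \<and> (\<lambda>i. \<theta> i - \<nu> i + \<theta>' i) = \<kappa>.
      of_nat (mbinom m \<theta> \<nu>) * (X \<theta> * dpow d m \<nu> (Y \<theta>')))" if "X \<theta> \<noteq> 0" for \<theta>
  proof -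
    have \<theta>: "\<theta> \<in> midx m" using that X by (auto simp: ops_type_ring)
    have "th \<theta> Y \<kappa> = (\<Sum>\<theta>' | Y \<theta>' \<noteq> 0. th \<theta> (op_single \<theta>' (Y \<theta>')) \<kappa>)"
      by (subst (1) Y_eq) (simp only: th_sum sum_fun_apply)
    also have "\<dots> = (\<Sum>\<theta>' | Y \<theta>' \<noteq> 0. \<Sum>\<nu> | \<nu> \<le> \<theta>.
        if (\<lambda>i. \<theta> i - \<nu> i + \<theta>' i) = \<kappa> then of_nat (mbinom m \<theta> \<nu>) * dpow d m \<nu> (Y \<theta>') else 0)"
      unfolding th_single[OF \<theta>] sum_fun_apply op_single_apply ..
    also have "\<dots> = (\<Sum>\<theta>' | Y \<theta>' \<noteq> 0.
      \<Sum>\<nu> | \<nu> \<in> midx m \<and> (\<forall>i. \<nu> i \<le> \<theta> i) \<and> (\<lambda>i. \<theta> i - \<nu> i + \<theta>' i) = \<kappa>.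
        of_nat (mbinom m \<theta> \<nu>) * dpow d m \<nu> (Y \<theta>'))"
    proof (rule sum.cong[OF refl])
      fix \<theta>'
      have "{\<nu>. \<nu> \<in> midx m \<and> (\<forall>i. \<nu> i \<le> \<theta> i) \<and> (\<lambda>i. \<theta> i - \<nu> i + \<theta>' i) = \<kappa>}
          = {\<nu> \<in> {\<nu>. \<nu> \<le> \<theta>}. (\<lambda>i. \<theta> i - \<nu> i + \<theta>' i) = \<kappa>}"
        using midx_le[OF \<theta>] by (auto simp: le_fun_def)
      then show "(\<Sum>\<nu> | \<nu> \<le> \<theta>.
          if (\<lambda>i. \<theta> i - \<nu> i + \<theta>' i) = \<kappa> then of_nat (mbinom m \<theta> \<nu>) * dpow d m \<nu> (Y \<theta>') else 0)
        = (\<Sum>\<nu> | \<nu> \<in> midx m \<and> (\<forall>i. \<nu> i \<le> \<theta> i) \<and> (\<lambda>i. \<theta> i - \<nu> i + \<theta>' i) = \<kappa>.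
          of_nat (mbinom m \<theta> \<nu>) * dpow d m \<nu> (Y \<theta>'))"
        using finite_le_midx[OF \<theta>] by (simp only: sum.inter_filter)
    qed
    finally show ?thesis by (simp add: sum_distrib_left mult.left_commute)
  qed
  then show ?thesis by (simp add: op_times_def sum_fun_apply op_scale_def)
qed

end

text \<open>Serves twice: with the identity it describes \<open>type_ring\<close>, and with an
  injection into \<open>'a list\<close> it describes the extension field, so the comparison with
  \<open>op_mul\<close> is made once.\<close>

locale field_copy =
  fixes R :: "'b ring" and h :: "'a::field \<Rightarrow> 'b"
  assumes inj_h: "inj h" and carrier_R: "carrier R = range h"
    and h_add: "h (x + y) = h x \<oplus>\<^bsub>R\<^esub> h y" and h_mult: "h (x * y) = h x \<otimes>\<^bsub>R\<^esub> h y"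
    and h_one: "h 1 = \<one>\<^bsub>R\<^esub>" and h_zero: "h 0 = \<zero>\<^bsub>R\<^esub>"
begin

lemma h_closed [simp]: "h x \<in> carrier R"
  by (simp add: carrier_R)

lemma field_R: "field R"
proof -
  have ex: "\<exists>x. y = h x" if "y \<in> carrier R" for y
    using that by (auto simp: carrier_R)
  have "abelian_group R"
  proof (rule abelian_groupI)
    fix y assume "y \<in> carrier R"
    then obtain x where x: "y = h x" using ex by blast
    then show "\<exists>z\<in>carrier R. z \<oplus>\<^bsub>R\<^esub> y = \<zero>\<^bsub>R\<^esub>"
      by (intro bexI[of _ "h (- x)"]) (simp_all flip: h_add h_zero)
  qed (auto dest!: ex simp: algebra_simps simp flip: h_add h_zero)
  moreover have "comm_monoid R"
    by unfold_locales (auto dest!: ex simp: algebra_simps simp flip: h_mult h_one)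
  ultimately interpret cring R
    by (rule cringI) (auto dest!: ex simp: algebra_simps simp flip: h_add h_mult)
  show ?thesis
  proof (rule cring_fieldI2)
    show "\<zero>\<^bsub>R\<^esub> \<noteq> \<one>\<^bsub>R\<^esub>" using inj_h by (auto simp flip: h_zero h_one dest: injD)
    fix y assume "y \<in> carrier R" "y \<noteq> \<zero>\<^bsub>R\<^esub>"
    then obtain x where x: "y = h x" "x \<noteq> 0" using ex h_zero by metis
    then show "\<exists>z\<in>carrier R. y \<otimes>\<^bsub>R\<^esub> z = \<one>\<^bsub>R\<^esub>"
      by (intro bexI[of _ "h (1 / x)"]) (simp_all flip: h_mult h_one)
  qed
qed

interpretation field R by (rule field_R)

lemma h_eq_zero [simp]: "h x = \<zero>\<^bsub>R\<^esub> \<longleftrightarrow> x = 0"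
  by (metis h_zero inj_h injD)

lemma finsum_copy: "finsum R (\<lambda>x. h (f x)) A = h (sum f A)"
proof (cases "finite A")
  case True
  then show ?thesis by (induction A) (simp_all add: h_zero h_add)
qed (simp add: finsum_infinite h_zero)

lemma add_pow_copy: "add_pow R k (h x) = h (of_nat k * x)" for k :: nat
  by (induction k) (simp_all add: h_zero h_add distrib_right add.commute a_comm)

lemma ops_copy: "X \<in> ops type_ring m \<Longrightarrow> (\<lambda>\<theta>. h (X \<theta>)) \<in> ops R m"
  by (simp add: ops_type_ring) (simp add: ops_def h_zero)

lemma ord_le_copy: "ord_le R m (\<lambda>\<theta>. h (X \<theta>)) r \<longleftrightarrow> ord_le type_ring m X r"
  by (simp add: ord_le_def)

lemma op_mul_copy:
  assumes "dfield d m" and dR: "\<And>i x. i < m \<Longrightarrow> dR i (h x) = h (d i x)"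
    and "X \<in> ops type_ring m" "Y \<in> ops type_ring m"
  shows "op_mul R dR m (\<lambda>\<theta>. h (X \<theta>)) (\<lambda>\<theta>. h (Y \<theta>)) = (\<lambda>\<kappa>. h (op_times d m X Y \<kappa>))"
proof -
  have dpow: "dpow dR m \<nu> (h x) = h (dpow d m \<nu> x)" for \<nu> x
    by (rule dpow_intertwine(1)[of m UNIV d dR h]) (auto simp: dR)
  have supp: "op_supp R (\<lambda>\<theta>. h (Z \<theta>)) = {\<theta>. Z \<theta> \<noteq> 0}" for Z
    by (simp add: op_supp_def)
  show ?thesis
    unfolding op_mul_def dfield.times_apply[OF assms(1,3,4)] supp dpow h_mult[symmetric]
      add_pow_copy finsum_copy ..
qed

end

lemma field_copy_type_ring: "field_copy (type_ring :: 'a::field ring) (\<lambda>x. x)"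
  by unfold_locales auto

section \<open>Independence over the ring of operators\<close>

context dfield
begin

definition indep :: "(nat \<Rightarrow> (nat \<Rightarrow> nat) \<Rightarrow> 'a) set \<Rightarrow> bool" where
  "indep B \<longleftrightarrow> finite B \<and> (\<forall>X. (\<forall>b\<in>B. X b \<in> opset) \<longrightarrow>
     (\<forall>j. (\<Sum>b\<in>B. X b \<star> b j) = 0) \<longrightarrow> (\<forall>b\<in>B. X b = 0))"

text \<open>Torsion modulo the left span of \<open>B\<close>. This replaces membership in a span,
  since the multiplier \<open>X\<close> cannot in general be divided away in the ring of
  operators.\<close>

definition dep :: "(nat \<Rightarrow> (nat \<Rightarrow> nat) \<Rightarrow> 'a) set \<Rightarrow> (nat \<Rightarrow> (nat \<Rightarrow> nat) \<Rightarrow> 'a) \<Rightarrow> bool" where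
  "dep B v \<longleftrightarrow> (\<exists>X Y. X \<in> opset \<and> X \<noteq> 0 \<and> (\<forall>b\<in>B. Y b \<in> opset) \<and>
     (\<forall>j. X \<star> v j = (\<Sum>b\<in>B. Y b \<star> b j)))"

lemma indepD:
  "indep B \<Longrightarrow> (\<And>b. b \<in> B \<Longrightarrow> X b \<in> opset) \<Longrightarrow> (\<And>j. (\<Sum>b\<in>B. X b \<star> b j) = 0) \<Longrightarrow> b \<in> B \<Longrightarrow> X b = 0"
  unfolding indep_def by blast

lemma op_scale_single: "op_scale a (op_single \<theta> b) = op_single \<theta> (a * b)"
  by (auto simp: op_scale_def op_single_def fun_eq_iff)

lemma d_one: "i < m \<Longrightarrow> d i 1 = 0"
  using d_mult[of i 1 1] by (metis add_cancel_right_right mult_1_left mult_1_right)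

lemma ops_uminus [simp]: "X \<in> opset \<Longrightarrow> - X \<in> opset"
  using ops_scale[of X m "-1"] by (simp add: op_scale_uminus)

lemma times_uminus_left: "X \<in> opset \<Longrightarrow> (- X) \<star> Y = - (X \<star> Y)"
  using times_scale_left[of X "-1" Y] by (simp add: op_scale_uminus)

lemma exists_ordle: "X \<in> opset \<Longrightarrow> \<exists>r. ordle X r"
  unfolding ordle_iff by (rule exI[of _ "Max (mi_ord m ` {\<theta>. X \<theta> \<noteq> 0})"]) (auto simp: ops_type_ring)

text \<open>A finite family of operators always has some order bounds, so the quantitative version
  applies and only the numbers of rows and columns matter.\<close>

lemma exists_relation':
  assumes fin: "finite I" "finite J" and card: "card J < card I"
    and v: "\<And>i j. i \<in> I \<Longrightarrow> j \<in> J \<Longrightarrow> v i j \<in> opset"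
  shows "\<exists>X. (\<forall>i. X i \<in> opset) \<and> (\<exists>i\<in>I. X i \<noteq> 0) \<and> (\<forall>j\<in>J. (\<Sum>i\<in>I. X i \<star> v i j) = 0)"
proof -
  obtain r where r: "ordle (v i j) (r i j)" if "i \<in> I" "j \<in> J" for i j
    using exists_ordle[OF v] by metis
  define e where "e = (\<lambda>j. \<Sum>i\<in>I. r i j)"
  have "r i j \<le> e j" if "i \<in> I" for i j
    unfolding e_def by (rule member_le_sum) (use that fin in auto)
  then have "v i j \<in> opset \<and> ordle (v i j) (e j)" if "i \<in> I" "j \<in> J" for i j
    using that v r[OF that] by (auto simp: ordle_iff intro: order.trans)
  from exists_relation[where v = v and e = e, OF fin card _ refl] this show ?thesis by blast
qed

text \<open>The left Ore condition, from two unknown operators and one equation; the absence of zero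
  divisors excludes X = 0.\<close>

lemma ore:
  assumes "A \<in> opset" "L \<in> opset" "L \<noteq> 0"
  obtains X Z where "X \<in> opset" "X \<noteq> 0" "Z \<in> opset" "X \<star> A = Z \<star> L"
proof -
  have "\<exists>X. (\<forall>i. X i \<in> opset) \<and> (\<exists>i\<in>UNIV. X i \<noteq> 0)
      \<and> (\<forall>j\<in>{()}. (\<Sum>i\<in>UNIV. X i \<star> (if i then A else L)) = 0)"
    by (rule exists_relation') (use assms in auto)
  then obtain X :: "bool \<Rightarrow> _" where X': "\<forall>i. X i \<in> opset" "\<exists>i. X i \<noteq> 0"
    "(\<Sum>i\<in>UNIV. X i \<star> (if i then A else L)) = 0" by auto
  then have "X True \<star> A + X False \<star> L = 0" by (simp add: UNIV_bool add.commute)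
  note X = X'(1,2) this
  have eq: "X True \<star> A = (- X False) \<star> L"
    using X by (simp add: times_uminus_left eq_neg_iff_add_eq_0)
  have "X True \<noteq> 0"
  proof
    assume 0: "X True = 0"
    then have "X False \<star> L = 0" using X(3) by simp
    then have "X False = 0" using times_eq_0_iff[of "X False" L] X assms by auto
    with 0 X(2) show False by (metis (full_types))
  qed
  with that[of "X True" "- X False"] X eq show ?thesis by auto
qed

lemma dep_zero: "dep B 0"
proof -
  have "op_single 0 1 \<noteq> (0 :: (nat \<Rightarrow> nat) \<Rightarrow> 'a)" by (auto simp: op_single_def fun_eq_iff)
  then show ?thesis unfolding dep_def
    by (intro exI[of _ "op_single 0 1"] exI[of _ "\<lambda>_. 0"]) (auto simp: sum.neutral)
qed

text \<open>A common left multiple of the two multipliers, supplied by \<open>ore\<close>, clears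
  both at once.\<close>

lemma dep_add:
  assumes "dep B v" "dep B w" and B: "\<forall>b\<in>B. \<forall>j. b j \<in> opset"
  shows "dep B (v + w)"
proof -
  obtain L Y where L: "L \<in> opset" "L \<noteq> 0" "\<forall>b\<in>B. Y b \<in> opset" "\<forall>j. L \<star> v j = (\<Sum>b\<in>B. Y b \<star> b j)"
    using assms(1) unfolding dep_def by blast
  obtain L' Y' where L': "L' \<in> opset" "L' \<noteq> 0" "\<forall>b\<in>B. Y' b \<in> opset" "\<forall>j. L' \<star> w j = (\<Sum>b\<in>B. Y' b \<star> b j)"
    using assms(2) unfolding dep_def by blast
  obtain P Z where P: "P \<in> opset" "P \<noteq> 0" "Z \<in> opset" "P \<star> L = Z \<star> L'"
    using ore[OF L(1) L'(1,2)] by blast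
  have "(P \<star> L) \<star> (v + w) j = (\<Sum>b\<in>B. (P \<star> Y b + Z \<star> Y' b) \<star> b j)" for j
  proof -
    have "(P \<star> L) \<star> (v + w) j = (P \<star> L) \<star> v j + (Z \<star> L') \<star> w j"
      using P by (simp add: times_add_right)
    also have "\<dots> = P \<star> (\<Sum>b\<in>B. Y b \<star> b j) + Z \<star> (\<Sum>b\<in>B. Y' b \<star> b j)"
      using L L' by (simp add: times_assoc)
    also have "\<dots> = (\<Sum>b\<in>B. P \<star> (Y b \<star> b j) + Z \<star> (Y' b \<star> b j))"
      by (simp only: times_sum_right sum.distrib)
    also have "\<dots> = (\<Sum>b\<in>B. (P \<star> Y b + Z \<star> Y' b) \<star> b j)"
      using L L' by (intro sum.cong) (simp_all add: times_add_left times_assoc)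
    finally show ?thesis .
  qed
  moreover have "P \<star> L \<noteq> 0" using times_eq_0_iff[OF P(1) L(1)] P(2) L(2) by blast
  ultimately show ?thesis unfolding dep_def using P L L'
    by (intro exI[of _ "P \<star> L"] exI[of _ "\<lambda>b. P \<star> Y b + Z \<star> Y' b"]) auto
qed

text \<open>The multiplier \<open>L\<close> known for \<open>v\<close> would have to act after
  \<open>A\<close>; \<open>ore\<close> turns P A into Z L, where \<open>L\<close> meets
  \<open>v\<close> directly.\<close>

lemma dep_times:
  assumes "dep B v" "A \<in> opset" and B: "\<forall>b\<in>B. \<forall>j. b j \<in> opset"
  shows "dep B (\<lambda>j. A \<star> v j)"
proof -
  obtain L Y where L: "L \<in> opset" "L \<noteq> 0" "\<forall>b\<in>B. Y b \<in> opset" "\<forall>j. L \<star> v j = (\<Sum>b\<in>B. Y b \<star> b j)"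
    using assms(1) unfolding dep_def by blast
  obtain P Z where P: "P \<in> opset" "P \<noteq> 0" "Z \<in> opset" "P \<star> A = Z \<star> L"
    using ore[OF assms(2) L(1,2)] by blast
  have "P \<star> (A \<star> v j) = (\<Sum>b\<in>B. (Z \<star> Y b) \<star> b j)" for j
  proof -
    have "P \<star> (A \<star> v j) = Z \<star> (L \<star> v j)"
      using P L assms(2) by (metis times_assoc)
    also have "\<dots> = (\<Sum>b\<in>B. Z \<star> (Y b \<star> b j))" using L by (simp add: times_sum_right)
    also have "\<dots> = (\<Sum>b\<in>B. (Z \<star> Y b) \<star> b j)"
      using L by (intro sum.cong) (simp_all add: times_assoc)
    finally show ?thesis .
  qed
  then show ?thesis unfolding dep_def using P L
    by (intro exI[of _ P] exI[of _ "\<lambda>b. Z \<star> Y b"]) auto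
qed

lemma dep_sum:
  assumes "\<And>s. s \<in> K \<Longrightarrow> dep B s \<and> L s \<in> opset" "\<forall>b\<in>B. \<forall>j. b j \<in> opset"
  shows "dep B (\<Sum>s\<in>K. (\<lambda>j. L s \<star> s j))"
proof -
  have "(\<Sum>s\<in>K. (\<lambda>j. L s \<star> s j)) \<in> Collect (dep B)"
    by (rule sum_closed_under_add) (use assms dep_zero dep_add dep_times in auto)
  then show ?thesis by simp
qed

text \<open>More than n vectors give more unknown multipliers than there are coordinate equations,
  hence a nontrivial relation.\<close>

lemma indep_card_le:
  assumes "indep B" "B \<subseteq> mvecs type_ring m n"
  shows "card B \<le> n"
proof (rule ccontr)
  assume "\<not> card B \<le> n"
  then have "\<exists>X. (\<forall>i. X i \<in> opset) \<and> (\<exists>b\<in>B. X b \<noteq> 0) \<and> (\<forall>j\<in>{1..n}. (\<Sum>b\<in>B. X b \<star> b j) = 0)"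
    by (intro exists_relation') (use assms in \<open>auto simp: indep_def mvecs_def\<close>)
  then obtain X where X: "\<forall>i. X i \<in> opset" "\<exists>b\<in>B. X b \<noteq> 0" "\<forall>j\<in>{1..n}. (\<Sum>b\<in>B. X b \<star> b j) = 0"
    by blast
  have "(\<Sum>b\<in>B. X b \<star> b j) = 0" for j
  proof (cases "j \<in> {1..n}")
    case False
    then have "b j = 0" if "b \<in> B" for b
      using that assms(2) by (auto simp: mvecs_def op_zero_def fun_eq_iff)
    then have "X b \<star> b j = 0" if "b \<in> B" for b
      using that by (simp only: times_zero_right)
    then show ?thesis by (intro sum.neutral ballI)
  qed (use X in auto)
  with indepD[OF assms(1), of X] X show False by blast
qed

lemma dep_of_maximal:
  assumes B: "indep B" and v: "\<not> indep (insert v B) \<or> v \<in> B"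
  shows "dep B v"
proof (cases "v \<in> B")
  case True
  have fin: "finite B" using B by (simp add: indep_def)
  have "op_single 0 1 \<noteq> (0 :: (nat \<Rightarrow> nat) \<Rightarrow> 'a)" by (auto simp: op_single_def fun_eq_iff)
  moreover have "op_single 0 1 \<star> v j = (\<Sum>b\<in>B. (if b = v then op_single 0 1 else 0) \<star> b j)" for j
  proof -
    have "(\<Sum>b\<in>B. (if b = v then op_single 0 1 else 0) \<star> b j)
        = (\<Sum>b\<in>B. if b = v then op_single 0 1 \<star> v j else 0)"
      by (rule sum.cong) auto
    also have "\<dots> = op_single 0 1 \<star> v j" using True fin by (simp only: sum.delta if_True)
    finally show ?thesis by simp
  qed
  ultimately show ?thesis unfolding dep_def
    by (intro exI[of _ "op_single 0 1"] exI[of _ "\<lambda>b. if b = v then op_single 0 1 else 0"]) auto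
next
  case False
  have fin: "finite B" using B by (simp add: indep_def)
  from False v obtain X where X: "\<forall>b\<in>insert v B. X b \<in> opset"
    "\<forall>j. (\<Sum>b\<in>insert v B. X b \<star> b j) = 0" "\<exists>b\<in>insert v B. X b \<noteq> 0"
    using fin by (auto simp: indep_def)
  have sum: "X v \<star> v j + (\<Sum>b\<in>B. X b \<star> b j) = 0" for j
    using X(2) fin False by (simp only: sum.insert simp_thms)
  have "X v \<noteq> 0"
  proof
    assume 0: "X v = 0"
    then have "(\<Sum>b\<in>B. X b \<star> b j) = 0" for j using sum[of j] by simp
    then show False using indepD[OF B, of X] X 0 by blast
  qed
  moreover have "X v \<star> v j = (\<Sum>b\<in>B. (- X b) \<star> b j)" for j
  proof -
    have "(\<Sum>b\<in>B. (- X b) \<star> b j) = - (\<Sum>b\<in>B. X b \<star> b j)"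
      unfolding sum_negf[symmetric] using X by (intro sum.cong) (auto simp: times_uminus_left)
    moreover have "X v \<star> v j = - (\<Sum>b\<in>B. X b \<star> b j)"
      using sum[of j] by (rule eq_neg_iff_add_eq_0[THEN iffD2])
    ultimately show ?thesis by (simp only:)
  qed
  ultimately show ?thesis unfolding dep_def using X
    by (intro exI[of _ "X v"] exI[of _ "\<lambda>b. - X b"]) auto
qed

definition unit_vec :: "nat \<Rightarrow> ((nat \<Rightarrow> nat) \<Rightarrow> 'a) \<Rightarrow> nat \<Rightarrow> (nat \<Rightarrow> nat) \<Rightarrow> 'a" where
  "unit_vec j L = (\<lambda>k. if k = j then L else 0)"

text \<open>If every m_j were torsion modulo \<open>B\<close>, the n coefficient rows
  \<open>Y j\<close>, of length below n, would satisfy a relation \<open>Z\<close>. Its k-th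
  coordinate then reads Z_k X_k = 0 with both factors nonzero for a suitable k.\<close>

lemma exists_not_dep:
  assumes B: "finite B" "card B < n" "\<forall>b\<in>B. \<forall>j. b j \<in> opset"
  shows "\<exists>j\<in>{1..n}. \<not> dep B (unit_vec j (op_single 0 1))"
proof (rule ccontr)
  assume "\<not> ?thesis"
  then have "\<forall>j\<in>{1..n}. \<exists>X Y. X \<in> opset \<and> X \<noteq> 0 \<and> (\<forall>b\<in>B. Y b \<in> opset) \<and>
     (\<forall>k. X \<star> unit_vec j (op_single 0 1) k = (\<Sum>b\<in>B. Y b \<star> b k))"
    unfolding dep_def by blast
  then obtain X where "\<forall>j\<in>{1..n}. \<exists>Y. X j \<in> opset \<and> X j \<noteq> 0 \<and> (\<forall>b\<in>B. Y b \<in> opset) \<and>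
     (\<forall>k. X j \<star> unit_vec j (op_single 0 1) k = (\<Sum>b\<in>B. Y b \<star> b k))"
    by (rule bchoice[THEN exE])
  then obtain Y where "\<forall>j\<in>{1..n}. X j \<in> opset \<and> X j \<noteq> 0 \<and> (\<forall>b\<in>B. Y j b \<in> opset) \<and>
     (\<forall>k. X j \<star> unit_vec j (op_single 0 1) k = (\<Sum>b\<in>B. Y j b \<star> b k))"
    by (rule bchoice[THEN exE])
  then have X: "X j \<in> opset" "X j \<noteq> 0" "\<forall>b\<in>B. Y j b \<in> opset"
    "\<forall>k. X j \<star> unit_vec j (op_single 0 1) k = (\<Sum>b\<in>B. Y j b \<star> b k)" if "j \<in> {1..n}" for j
    using that by blast+
  have "\<exists>Z. (\<forall>j. Z j \<in> opset) \<and> (\<exists>j\<in>{1..n}. Z j \<noteq> 0) \<and> (\<forall>b\<in>B. (\<Sum>j\<in>{1..n}. Z j \<star> Y j b) = 0)"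
    by (intro exists_relation') (use B X in auto)
  then obtain Z where Z: "\<And>j. Z j \<in> opset" "\<exists>j\<in>{1..n}. Z j \<noteq> 0"
    "\<forall>b\<in>B. (\<Sum>j\<in>{1..n}. Z j \<star> Y j b) = 0" by blast
  from Z(2) obtain k where k: "k \<in> {1..n}" "Z k \<noteq> 0" by blast
  have "(\<Sum>j\<in>{1..n}. Z j \<star> (X j \<star> unit_vec j (op_single 0 1) k)) = (\<Sum>j\<in>{1..n}. Z j \<star> (\<Sum>b\<in>B. Y j b \<star> b k))"
    using X by (intro sum.cong) auto
  also have "\<dots> = (\<Sum>j\<in>{1..n}. \<Sum>b\<in>B. (Z j \<star> Y j b) \<star> b k)"
    using X Z by (intro sum.cong refl) (simp add: times_sum_right times_assoc)
  also have "\<dots> = (\<Sum>b\<in>B. (\<Sum>j\<in>{1..n}. Z j \<star> Y j b) \<star> b k)"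
    by (subst sum.swap, intro sum.cong refl, subst times_sum_left) (use X Z in auto)
  also have "\<dots> = 0" using Z by (intro sum.neutral) auto
  finally have "(\<Sum>j\<in>{1..n}. Z j \<star> (X j \<star> unit_vec j (op_single 0 1) k)) = 0" .
  also have "(\<Sum>j\<in>{1..n}. Z j \<star> (X j \<star> unit_vec j (op_single 0 1) k))
      = (\<Sum>j\<in>{1..n}. if j = k then Z k \<star> (X k \<star> op_single 0 1) else 0)"
    by (rule sum.cong) (auto simp: unit_vec_def)
  also have "\<dots> = Z k \<star> (X k \<star> op_single 0 1)" using k(1) by (simp only: sum.delta finite_atLeastAtMost if_True)
  finally have "Z k \<star> (X k \<star> op_single 0 1) = 0" .
  moreover have "op_single 0 1 \<noteq> (0 :: (nat \<Rightarrow> nat) \<Rightarrow> 'a)" by (auto simp: op_single_def fun_eq_iff)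
  ultimately show False using k X[OF k(1)] Z by (simp add: times_eq_0_iff)
qed

lemma op_mul_type_ring:
  assumes "X \<in> opset" "Y \<in> opset"
  shows "op_mul type_ring d m X Y = X \<star> Y"
  using field_copy.op_mul_copy[OF field_copy_type_ring dfield_axioms _ assms, of d] by simp

lemma dsubmod_type_ring:
  assumes "\<forall>s\<in>S. \<forall>j. s j \<in> opset"
  shows "w \<in> dsubmod type_ring d m S \<longleftrightarrow>
    (\<exists>K L. finite K \<and> K \<subseteq> S \<and> (\<forall>s\<in>K. L s \<in> opset) \<and> w = (\<Sum>s\<in>K. (\<lambda>j. L s \<star> s j)))"
proof -
  have "(\<lambda>j \<theta>. finsum type_ring (\<lambda>s. op_act type_ring d m (L s) s j \<theta>) K) = (\<Sum>s\<in>K. (\<lambda>j. L s \<star> s j))"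
    if "K \<subseteq> S" "\<forall>s\<in>K. L s \<in> opset" for K L
  proof (intro ext)
    fix j \<theta>
    have "finsum type_ring (\<lambda>s. op_act type_ring d m (L s) s j \<theta>) K = (\<Sum>s\<in>K. op_act type_ring d m (L s) s j \<theta>)"
      using field_copy.finsum_copy[OF field_copy_type_ring] .
    also have "\<dots> = (\<Sum>s\<in>K. (L s \<star> s j) \<theta>)"
      using that assms by (intro sum.cong) (auto simp: op_act_def op_mul_type_ring)
    finally show "finsum type_ring (\<lambda>s. op_act type_ring d m (L s) s j \<theta>) K = (\<Sum>s\<in>K. (\<lambda>j. L s \<star> s j)) j \<theta>"
      by (simp add: sum_fun_apply)
  qed
  note eq = this
  show ?thesis
  proof
    assume "w \<in> dsubmod type_ring d m S"
    then obtain K L where *: "finite K" "K \<subseteq> S" "\<forall>s\<in>K. L s \<in> opset"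
      "w = (\<lambda>j \<theta>. finsum type_ring (\<lambda>s. op_act type_ring d m (L s) s j \<theta>) K)"
      unfolding dsubmod_def by blast
    from *(4) have "w = (\<Sum>s\<in>K. (\<lambda>j. L s \<star> s j))" unfolding eq[OF *(2,3)] .
    with * show "\<exists>K L. finite K \<and> K \<subseteq> S \<and> (\<forall>s\<in>K. L s \<in> opset) \<and> w = (\<Sum>s\<in>K. (\<lambda>j. L s \<star> s j))"
      by blast
  next
    assume "\<exists>K L. finite K \<and> K \<subseteq> S \<and> (\<forall>s\<in>K. L s \<in> opset) \<and> w = (\<Sum>s\<in>K. (\<lambda>j. L s \<star> s j))"
    then obtain K L where *: "finite K" "K \<subseteq> S" "\<forall>s\<in>K. L s \<in> opset" "w = (\<Sum>s\<in>K. (\<lambda>j. L s \<star> s j))"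
      by blast
    from *(4) have "w = (\<lambda>j \<theta>. finsum type_ring (\<lambda>s. op_act type_ring d m (L s) s j \<theta>) K)"
      unfolding eq[OF *(2,3)] .
    with * show "w \<in> dsubmod type_ring d m S" unfolding dsubmod_def by blast
  qed
qed

text \<open>For a largest independent \<open>B\<close> in \<open>S\<close>, every element of
  \<open>S\<close>, hence of the generated module, is torsion modulo \<open>B\<close>. Some m_j is
  not, as \<open>B\<close> has fewer than n elements; but L m_j in the module with L nonzero would
  make m_j torsion too.\<close>

lemma exists_free_unit_vec:
  assumes S: "S \<subseteq> mvecs type_ring m n"
    and no: "\<not> (\<exists>B\<subseteq>S. indep B \<and> card B = n)"
  shows "\<exists>j\<in>{1..n}. \<forall>L\<in>opset. unit_vec j L \<in> dsubmod type_ring d m S \<longrightarrow> L = 0"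
proof -
  have S': "\<forall>s\<in>S. \<forall>j. s j \<in> opset" using S by (auto simp: mvecs_def)
  have "indep {}" by (simp add: indep_def)
  then have "\<exists>B. (B \<subseteq> S \<and> indep B) \<and> (\<forall>B'. B' \<subseteq> S \<and> indep B' \<longrightarrow> card B' \<le> card B)"
    by (intro Lattices_Big.ex_has_greatest_nat[where k = "{}" and b = "Suc n"])
      (use S indep_card_le in \<open>auto simp: less_Suc_eq_le\<close>)
  then obtain B where B: "B \<subseteq> S" "indep B" "\<And>B'. B' \<subseteq> S \<Longrightarrow> indep B' \<Longrightarrow> card B' \<le> card B"
    by blast
  have fin: "finite B" using B by (simp add: indep_def)
  have ops: "\<forall>b\<in>B. \<forall>j. b j \<in> opset" using S' B by blast
  have "card B < n" using no B indep_card_le[of B n] S by (metis order.trans nat_less_le)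
  then obtain j where j: "j \<in> {1..n}" "\<not> dep B (unit_vec j (op_single 0 1))"
    using exists_not_dep[OF fin _ ops] by blast
  have dep: "dep B s" if "s \<in> S" for s
  proof (rule dep_of_maximal[OF B(2)])
    show "\<not> indep (insert s B) \<or> s \<in> B"
      using B(3)[of "insert s B"] B(1) that fin by (cases "s \<in> B") auto
  qed
  have "L = 0" if L: "L \<in> opset" "unit_vec j L \<in> dsubmod type_ring d m S" for L
  proof (rule ccontr)
    assume "L \<noteq> 0"
    obtain K A where "K \<subseteq> S" "\<forall>s\<in>K. A s \<in> opset" "unit_vec j L = (\<Sum>s\<in>K. (\<lambda>j. A s \<star> s j))"
      using L(2) unfolding dsubmod_type_ring[OF S'] by blast
    then have "dep B (unit_vec j L)" using dep dep_sum[OF _ ops, of K A] by (simp add: subset_iff)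
    then obtain X Y where X: "X \<in> opset" "X \<noteq> 0" "\<forall>b\<in>B. Y b \<in> opset"
      "\<forall>k. X \<star> unit_vec j L k = (\<Sum>b\<in>B. Y b \<star> b k)" unfolding dep_def by blast
    have "(X \<star> L) \<star> unit_vec j (op_single 0 1) k = X \<star> unit_vec j L k" for k
    proof -
      have "L \<star> op_single 0 1 = L"
      proof -
        have "th \<theta> (op_single 0 1) = op_single \<theta> 1" if "\<theta> \<in> midx m" for \<theta>
          using that
        proof (induction \<theta> rule: midx_induct)
          case (Suc \<theta> i)
          have "d i 1 = 0" using d_one Suc.hyps by blast
          then show ?case using Suc D_single[of i \<theta> 1] by (simp only: th_upd_Suc op_single_0 add_0_left)
        qed simp
        moreover have mid: "\<theta> \<in> midx m" if "L \<theta> \<noteq> 0" for \<theta>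
          using L(1) that by (auto simp: ops_type_ring)
        ultimately have "L \<star> op_single 0 1 = (\<Sum>\<theta> | L \<theta> \<noteq> 0. op_single \<theta> (L \<theta>))"
          unfolding op_times_def using mid by (intro sum.cong refl) (simp add: op_scale_single)
        also have "\<dots> = L" using L(1) by (intro ops_eq_sum_single[symmetric]) (auto simp: ops_type_ring)
        finally show ?thesis .
      qed
      then show ?thesis using times_assoc[OF L(1), of X "op_single 0 1"] by (simp add: unit_vec_def)
    qed
    then have "dep B (unit_vec j (op_single 0 1))"
      unfolding dep_def using X L \<open>L \<noteq> 0\<close>
      by (intro exI[of _ "X \<star> L"] exI[of _ Y]) (simp add: times_eq_0_iff)
    with j show False by simp
  qed
  with j show ?thesis by blast
qed

end

section \<open>Dimension count\<close>

interpretation fvs: vector_space "fscale :: 'a::field \<Rightarrow> _"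
  by unfold_locales (auto simp: fscale_def fun_eq_iff algebra_simps)

definition elt_vec :: "nat \<times> (nat \<Rightarrow> nat) \<Rightarrow> nat \<Rightarrow> (nat \<Rightarrow> nat) \<Rightarrow> 'a::field" where
  "elt_vec p = (\<lambda>k \<kappa>. if (k, \<kappa>) = p then 1 else 0)"

lemma inj_elt_vec: "inj (elt_vec :: _ \<Rightarrow> _ \<Rightarrow> _ \<Rightarrow> 'a::field)"
proof (rule injI)
  fix p q :: "nat \<times> (nat \<Rightarrow> nat)" assume "elt_vec p = (elt_vec q :: _ \<Rightarrow> _ \<Rightarrow> 'a)"
  then have "elt_vec p (fst p) (snd p) = (elt_vec q (fst p) (snd p) :: 'a)" by simp
  then show "p = q" by (auto simp: elt_vec_def split: if_splits)
qed

lemma sum_elt_vec: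
  assumes "finite A"
  shows "(\<Sum>p\<in>A. fscale (c p) (elt_vec p)) k \<kappa> = (if (k, \<kappa>) \<in> A then c (k, \<kappa>) else 0 :: 'a::field)"
proof -
  have "(\<Sum>p\<in>A. fscale (c p) (elt_vec p)) k \<kappa> = (\<Sum>p\<in>A. if (k, \<kappa>) = p then c p else 0)"
    by (simp add: sum_fun_apply fscale_def elt_vec_def if_distrib cong: if_cong)
  also have "\<dots> = (if (k, \<kappa>) \<in> A then c (k, \<kappa>) else 0)" using assms by (simp add: sum.delta')
  finally show ?thesis .
qed

lemma filt_eq_span:
  "filt m n s = fvs.span (elt_vec ` ({1..n} \<times> mi_upto m s) :: (nat \<Rightarrow> (nat \<Rightarrow> nat) \<Rightarrow> 'a::field) set)"
proof
  let ?P = "{1..n} \<times> mi_upto m s"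
  have fin: "finite ?P" by simp
  have supp: "v k \<kappa> = 0" if "v \<in> filt m n s" "(k, \<kappa>) \<notin> ?P" for v :: "nat \<Rightarrow> (nat \<Rightarrow> nat) \<Rightarrow> 'a" and k \<kappa>
    using that by (force simp: filt_def mvecs_def mi_upto_def ops_type_ring ord_le_def op_zero_def)
  have eq: "v = (\<Sum>p\<in>?P. fscale (v (fst p) (snd p)) (elt_vec p))" if "v \<in> filt m n s" for v :: "nat \<Rightarrow> (nat \<Rightarrow> nat) \<Rightarrow> 'a"
  proof (intro ext)
    fix k \<kappa>
    show "v k \<kappa> = (\<Sum>p\<in>?P. fscale (v (fst p) (snd p)) (elt_vec p)) k \<kappa>"
      unfolding sum_elt_vec[OF fin] using supp[OF that, of k \<kappa>] by simp
  qed
  have mem: "(\<Sum>p\<in>?P. fscale (v (fst p) (snd p)) (elt_vec p)) \<in> fvs.span (elt_vec ` ?P)"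
    for v :: "nat \<Rightarrow> (nat \<Rightarrow> nat) \<Rightarrow> 'a"
    by (intro fvs.span_sum fvs.span_scale fvs.span_base) auto
  show "filt m n s \<subseteq> fvs.span (elt_vec ` ?P :: (nat \<Rightarrow> (nat \<Rightarrow> nat) \<Rightarrow> 'a) set)" 
  proof (intro subsetI)
    fix v :: "nat \<Rightarrow> (nat \<Rightarrow> nat) \<Rightarrow> 'a" assume "v \<in> filt m n s"
    from eq[OF this] mem[of v] show "v \<in> fvs.span (elt_vec ` ?P)"
      by (rule ssubst[where P = "\<lambda>x. x \<in> fvs.span (elt_vec ` ?P)"])
  qed
  show "fvs.span (elt_vec ` ?P :: (nat \<Rightarrow> (nat \<Rightarrow> nat) \<Rightarrow> 'a) set) \<subseteq> filt m n s"
  proof (rule fvs.span_minimal)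
    have "elt_vec (k, \<kappa>) j = (if j = k then op_single \<kappa> 1 else (0 :: (nat \<Rightarrow> nat) \<Rightarrow> 'a))" for k \<kappa> j
      by (auto simp: elt_vec_def op_single_def fun_eq_iff)
    then show "elt_vec ` ?P \<subseteq> (filt m n s :: (nat \<Rightarrow> (nat \<Rightarrow> nat) \<Rightarrow> 'a) set)"
      by (auto simp: filt_def mvecs_def mi_upto_def ord_le_def op_zero_def op_single_def
          simp flip: zero_fun_def split: if_splits) (auto simp: ops_type_ring)
    have scale: "fscale c v j = op_scale c (v j)" for c and v :: "nat \<Rightarrow> (nat \<Rightarrow> nat) \<Rightarrow> 'a" and j
      by (simp add: fscale_def op_scale_def)
    show "fvs.subspace (filt m n s :: (nat \<Rightarrow> (nat \<Rightarrow> nat) \<Rightarrow> 'a) set)"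
    proof (rule fvs.subspaceI)
      fix x y :: "nat \<Rightarrow> (nat \<Rightarrow> nat) \<Rightarrow> 'a" assume "x \<in> filt m n s" "y \<in> filt m n s"
      then show "x + y \<in> filt m n s"
        by (auto simp: filt_def mvecs_def ord_le_def op_zero_def fun_eq_iff) (metis add_0_left)
    next
      fix c and x :: "nat \<Rightarrow> (nat \<Rightarrow> nat) \<Rightarrow> 'a" assume "x \<in> filt m n s"
      then show "fscale c x \<in> filt m n s"
        by (auto simp: filt_def mvecs_def ord_le_def op_zero_def fun_eq_iff scale op_scale_def)
          (auto simp flip: op_scale_def)
    qed (auto simp: filt_def mvecs_def ord_le_def op_zero_def)
  qed
qed

context dfield
begin

text \<open>The binomial counts the vectors \<theta> m_j of order at most s. Their span meets
  \<open>modN\<close> only in 0, so together with a basis of the filtered part of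
  \<open>modN\<close> they remain independent inside the filtered free module.\<close>

lemma hilb_ge:
  assumes S: "fst ` \<Sigma> \<subseteq> mvecs type_ring m n" and j: "j \<in> {1..n}"
    and free: "\<And>L. L \<in> opset \<Longrightarrow> unit_vec j L \<in> modN d m \<Sigma> \<Longrightarrow> L = 0"
  shows "(s + m) choose m \<le> hilb d m n \<Sigma> s"
proof -
  let ?P = "{1..n} \<times> mi_upto m s" and ?N = "modN d m \<Sigma>"
  let ?E = "elt_vec ` ?P :: (nat \<Rightarrow> (nat \<Rightarrow> nat) \<Rightarrow> 'a) set"
  let ?U = "elt_vec ` ({j} \<times> mi_upto m s) :: (nat \<Rightarrow> (nat \<Rightarrow> nat) \<Rightarrow> 'a) set"
  have S': "\<forall>s\<in>fst ` \<Sigma>. \<forall>j. s j \<in> opset" using S by (auto simp: mvecs_def)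
  have subN: "fvs.subspace ?N"
  proof (rule fvs.subspaceI)
    show "0 \<in> ?N" unfolding modN_def dsubmod_type_ring[OF S']
      by (intro exI[of _ "{}"]) auto
  next
    fix x y assume "x \<in> ?N" "y \<in> ?N"
    then obtain K L K' L' where x: "finite K" "K \<subseteq> fst ` \<Sigma>" "\<forall>s\<in>K. L s \<in> opset" "x = (\<Sum>s\<in>K. (\<lambda>j. L s \<star> s j))"
      and y: "finite K'" "K' \<subseteq> fst ` \<Sigma>" "\<forall>s\<in>K'. L' s \<in> opset" "y = (\<Sum>s\<in>K'. (\<lambda>j. L' s \<star> s j))"
      unfolding modN_def dsubmod_type_ring[OF S'] by blast
    \<comment> \<open>Padding with zeros puts both combinations over the same finite set of
      generators.\<close>
    define M where "M = (\<lambda>s. (if s \<in> K then L s else 0))"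
    define M' where "M' = (\<lambda>s. (if s \<in> K' then L' s else 0))"
    have M: "M s \<in> opset" "M' s \<in> opset" for s using x y by (auto simp: M_def M'_def)
    have "x = (\<Sum>s\<in>K \<union> K'. (\<lambda>j. M s \<star> s j))"
      unfolding x(4) by (rule sum.mono_neutral_cong_left) (use x(1) y(1) in \<open>auto simp: M_def fun_eq_iff\<close>)
    moreover have "y = (\<Sum>s\<in>K \<union> K'. (\<lambda>j. M' s \<star> s j))"
      unfolding y(4) by (rule sum.mono_neutral_cong_left) (use x(1) y(1) in \<open>auto simp: M'_def fun_eq_iff\<close>)
    ultimately have "x + y = (\<Sum>s\<in>K \<union> K'. (\<lambda>j. (M s + M' s) \<star> s j))"
      unfolding times_add_left[OF M] by (simp add: fun_eq_iff sum_fun_apply sum.distrib)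
    then show "x + y \<in> ?N" unfolding modN_def dsubmod_type_ring[OF S']
      using x y M by (intro exI[of _ "K \<union> K'"] exI[of _ "\<lambda>s. M s + M' s"]) auto
  next
    fix c x assume "x \<in> ?N"
    then obtain K L where x: "finite K" "K \<subseteq> fst ` \<Sigma>" "\<forall>s\<in>K. L s \<in> opset" "x = (\<Sum>s\<in>K. (\<lambda>j. L s \<star> s j))"
      unfolding modN_def dsubmod_type_ring[OF S'] by blast
    have "fscale c x = (\<Sum>s\<in>K. (\<lambda>j. op_scale c (L s) \<star> s j))"
      unfolding x(4) using x(3)
      by (auto simp: fun_eq_iff fscale_def sum_fun_apply sum_distrib_left times_scale_left op_scale_def[of c "_ \<star> _"]
          intro!: sum.cong)
    then show "fscale c x \<in> ?N" unfolding modN_def dsubmod_type_ring[OF S']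
      using x by (intro exI[of _ K] exI[of _ "\<lambda>s. op_scale c (L s)"]) auto
  qed
  have indE: "fvs.independent ?E"
  proof
    assume "fvs.dependent ?E"
    then obtain u where u: "\<exists>v\<in>?E. u v \<noteq> 0" "(\<Sum>v\<in>?E. fscale (u v) v) = 0"
      by (subst (asm) fvs.dependent_finite) auto
    have "(\<Sum>p\<in>?P. fscale (u (elt_vec p)) (elt_vec p)) = 0"
      using u(2) by (subst (asm) sum.reindex) (auto simp: inj_on_subset[OF inj_elt_vec] o_def)
    then have "u (elt_vec p) = 0" if "p \<in> ?P" for p
      using sum_elt_vec[of ?P "\<lambda>p. u (elt_vec p)" "fst p" "snd p"] that
      by (metis finite_SigmaI finite_atLeastAtMost finite_mi_upto prod.collapse zero_fun_apply)
    with u(1) show False by blast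
  qed
  have UE: "?U \<subseteq> ?E" using j by auto
  have dimE: "fvs.dim (filt m n s :: (nat \<Rightarrow> (nat \<Rightarrow> nat) \<Rightarrow> 'a) set) = card ?E"
    unfolding filt_eq_span using indE by (simp add: fvs.dim_eq_card)
  obtain Bs where Bs: "Bs \<subseteq> filt m n s \<inter> ?N" "fvs.independent Bs" "filt m n s \<inter> ?N \<subseteq> fvs.span Bs"
    "card Bs = fvs.dim (filt m n s \<inter> ?N)" using fvs.basis_exists by blast
  have finE: "finite ?E" by simp
  have finB: "finite Bs"
    using fvs.independent_span_bound[OF finE Bs(2)] Bs(1) unfolding filt_eq_span by blast
  have finU: "finite ?U" by simp
  \<comment> \<open>A vector in the span of \<open>?U\<close> is concentrated in coordinate j, so it
    has the form L m_j and \<open>free\<close> applies.\<close>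
  have inter: "v = 0" if "v \<in> fvs.span ?U" "v \<in> ?N" for v
  proof -
    have v: "v \<in> filt m n s" using that(1) fvs.span_mono[OF UE] unfolding filt_eq_span by blast
    have "v k = 0" if "k \<noteq> j" for k
    proof -
      have "fvs.subspace {v :: nat \<Rightarrow> (nat \<Rightarrow> nat) \<Rightarrow> 'a. v k = 0}"
        by (rule fvs.subspaceI) (auto simp: fscale_def fun_eq_iff)
      moreover have "?U \<subseteq> {v. v k = 0}" using that by (auto simp: elt_vec_def fun_eq_iff)
      ultimately show ?thesis using \<open>v \<in> fvs.span ?U\<close> fvs.span_minimal[of ?U "{v. v k = 0}"] by blast
    qed
    then have eq: "unit_vec j (v j) = v" by (auto simp: unit_vec_def fun_eq_iff)
    have "v j \<in> opset" using v by (auto simp: filt_def mvecs_def)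
    then have "v j = 0" using free[of "v j"] that(2) by (simp only: eq)
    with \<open>\<And>k. k \<noteq> j \<Longrightarrow> v k = 0\<close> show ?thesis by (metis ext zero_fun_apply)
  qed
  have disj: "Bs \<inter> ?U = {}"
  proof (rule ccontr)
    assume "Bs \<inter> ?U \<noteq> {}"
    then obtain v where v: "v \<in> Bs" "v \<in> ?U" by blast
    then have "v = 0" using inter[OF fvs.span_base[OF v(2)]] Bs(1) by blast
    with v Bs(2) fvs.dependent_zero[of Bs] show False by simp
  qed
  have "fvs.independent (Bs \<union> ?U)"
  proof
    assume "fvs.dependent (Bs \<union> ?U)"
    then have "\<exists>u. (\<exists>v\<in>Bs \<union> ?U. u v \<noteq> 0) \<and> (\<Sum>v\<in>Bs \<union> ?U. fscale (u v) v) = 0"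
      unfolding fvs.dependent_finite[OF finite_UnI[OF finB finU]] .
    then obtain u where u': "(\<exists>v\<in>Bs \<union> ?U. u v \<noteq> 0) \<and> (\<Sum>v\<in>Bs \<union> ?U. fscale (u v) v) = 0" ..
    note u = conjunct1[OF u'] conjunct2[OF u']
    have sum: "(\<Sum>v\<in>Bs. fscale (u v) v) + (\<Sum>v\<in>?U. fscale (u v) v) = 0"
      using u(2) sum.union_disjoint[OF finB finU disj, of "\<lambda>v. fscale (u v) v"] by simp
    have "(\<Sum>v\<in>Bs. fscale (u v) v) \<in> ?N"
    proof (rule fvs.subspace_sum[OF subN])
      fix v assume "v \<in> Bs"
      then have "v \<in> ?N" using Bs(1) by blast
      then show "fscale (u v) v \<in> ?N" by (rule fvs.subspace_scale[OF subN])
    qed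
    then have "- (\<Sum>v\<in>Bs. fscale (u v) v) \<in> ?N" by (rule fvs.subspace_neg[OF subN])
    moreover have neg: "- (\<Sum>v\<in>Bs. fscale (u v) v) = (\<Sum>v\<in>?U. fscale (u v) v)"
      using sum by (rule add.inverse_unique)
    ultimately have "(\<Sum>v\<in>?U. fscale (u v) v) \<in> ?N" by (simp only:)
    moreover have "(\<Sum>v\<in>?U. fscale (u v) v) \<in> fvs.span ?U"
      by (rule fvs.span_sum) (rule fvs.span_scale[OF fvs.span_base])
    ultimately have U0: "(\<Sum>v\<in>?U. fscale (u v) v) = 0" by (intro inter)
    then have B0: "(\<Sum>v\<in>Bs. fscale (u v) v) = 0" using neg by (simp only: neg_equal_0_iff_equal)
    have "fvs.independent ?U" by (rule fvs.independent_mono[OF indE UE])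
    from fvs.independentD[OF this finU subset_refl U0]
    have "u v = 0" if "v \<in> ?U" for v using that .
    moreover from fvs.independentD[OF Bs(2) finB subset_refl B0]
    have "u v = 0" if "v \<in> Bs" for v using that .
    ultimately show False using u(1) by (meson UnE)
  qed
  moreover have "Bs \<union> ?U \<subseteq> fvs.span ?E" using Bs(1) UE fvs.span_superset[of ?E] unfolding filt_eq_span by blast
  ultimately have "card (Bs \<union> ?U) \<le> card ?E" using fvs.independent_span_bound[OF finE] by blast
  moreover have "card (Bs \<union> ?U) = card Bs + card ?U" by (rule card_Un_disjoint[OF finB finU disj])
  moreover have "card ?U = (s + m) choose m"
    by (subst card_image) (auto simp: inj_on_subset[OF inj_elt_vec] card_cartesian_product card_mi_upto)
  ultimately show ?thesis unfolding hilb_def dimE using Bs(4) by simp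
qed

end

text \<open>With \<open>a m = 0\<close> the sum has degree below m in s, while the lower bound grows
  with degree m. For m = 0 the remaining sum is empty, but the bound is 1.\<close>

lemma top_coeff_zero_contradiction:
  fixes a :: "nat \<Rightarrow> int"
  assumes ev: "\<forall>\<^sub>F s in sequentially. int (f s) = (\<Sum>i\<le>m. a i * int ((s + i) choose i))"
    and "a m = 0" and ge: "\<And>s. (s + m) choose m \<le> f s"
  shows False
proof -
  obtain s0 where s0: "\<And>s. s \<ge> s0 \<Longrightarrow> int (f s) = (\<Sum>i\<le>m. a i * int ((s + i) choose i))"
    using ev unfolding eventually_sequentially by blast
  have f: "int (f s) = (\<Sum>i<m. a i * int ((s + i) choose i))" if "s \<ge> s0" for s
    using s0[OF that] assms(2) by (simp add: lessThan_Suc_atMost[symmetric])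
  show False
  proof (cases m)
    case 0
    then show False using f[of s0] ge[of s0] by simp
  next
    case (Suc k)
    define A where "A = (\<Sum>i<m. \<bar>a i\<bar>)"
    \<comment> \<open>Beyond \<open>s0\<close> for the formula to apply, and at least m A because m
      binomial (s + m) m = (s + m) binomial (s + k) k is compared with m A binomial (s + k)
      k.\<close>
    define s where "s = s0 + nat (int m * A)"
    have A: "A \<ge> 0" by (simp add: A_def sum_nonneg)
    have "(s + i) choose i \<le> (s + k) choose k" if "i \<le> k" for i
    proof -
      have "(s + i) choose s \<le> (s + k) choose s" by (rule binomial_right_mono) (use that in simp)
      then show ?thesis using binomial_symmetric[of s "s + i"] binomial_symmetric[of s "s + k"] by simp
    qed
    then have "(\<Sum>i<m. a i * int ((s + i) choose i)) \<le> (\<Sum>i<m. \<bar>a i\<bar> * int ((s + k) choose k))"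
      using Suc by (intro sum_mono mult_mono) auto
    also have "\<dots> = A * int ((s + k) choose k)" by (simp add: A_def sum_distrib_right)
    finally have "int (f s) \<le> A * int ((s + k) choose k)" using f[of s] by (simp add: s_def)
    then have "int ((s + m) choose m) \<le> A * int ((s + k) choose k)" using ge[of s] by linarith
    then have le: "int m * int ((s + m) choose m) \<le> int m * (A * int ((s + k) choose k))"
      by (rule mult_left_mono) simp
    have "m * ((s + m) choose m) = (s + m) * ((s + k) choose k)"
      using Suc_times_binomial[of k "s + k"] Suc by simp
    then have "int m * int ((s + m) choose m) = int (s + m) * int ((s + k) choose k)"
      by (metis of_nat_mult)
    with le have "int (s + m) * int ((s + k) choose k) \<le> (int m * A) * int ((s + k) choose k)" by simp
    moreover have "int ((s + k) choose k) > 0" by simp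
    ultimately have "int (s + m) \<le> int m * A" by (simp only: mult_le_cancel_right)
    moreover have "int s \<ge> int m * A" using A by (simp add: s_def)
    ultimately show False using Suc by simp
  qed
qed

section \<open>Independent elements from the Kolchin condition\<close>

context dfield
begin

lemma exists_indep_subset:
  assumes S: "fst ` \<Sigma> \<subseteq> mvecs type_ring m n" and "kolchin_top_coeff_zero d m n \<Sigma>"
  shows "\<exists>B\<subseteq>fst ` \<Sigma>. indep B \<and> card B = n"
proof (rule ccontr)
  assume "\<not> ?thesis"
  from exists_free_unit_vec[OF S this] obtain j where j: "j \<in> {1..n}"
    "\<And>L. L \<in> opset \<Longrightarrow> unit_vec j L \<in> modN d m \<Sigma> \<Longrightarrow> L = 0" unfolding modN_def by blast
  from assms(2) show False unfolding kolchin_top_coeff_zero_def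
    using top_coeff_zero_contradiction[where f = "hilb d m n \<Sigma>" and m = m] hilb_ge[OF S j] by blast
qed

end

section \<open>Derivations of polynomial rings and fraction fields\<close>

definition derivation :: "('r::comm_ring_1 \<Rightarrow> 'r) \<Rightarrow> bool" where
  "derivation D \<longleftrightarrow> (\<forall>x y. D (x + y) = D x + D y) \<and> (\<forall>x y. D (x * y) = x * D y + D x * y)"

lemma derivationD:
  assumes "derivation D"
  shows derivation_add: "D (x + y) = D x + D y"
    and derivation_mult: "D (x * y) = x * D y + D x * y"
    and derivation_zero: "D 0 = 0"
    and derivation_one: "D 1 = 0"
    and derivation_sum: "D (sum f A) = (\<Sum>a\<in>A. D (f a))"
proof -
  show add: "D (x + y) = D x + D y" and mult: "D (x * y) = x * D y + D x * y" for x y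
    using assms by (auto simp: derivation_def)
  show zero: "D 0 = 0" using add[of 0 0] by (metis add_cancel_right_right add_0_left)
  show "D 1 = 0" using mult[of 1 1] by (metis add_cancel_right_right mult_1_left mult_1_right)
  show "D (sum f A) = (\<Sum>a\<in>A. D (f a))" by (rule additive_sum) (auto simp: zero add)
qed

text \<open>Reduces commutation of two derivations to generators: the commutator is itself a
  derivation, so it is zero once it vanishes there.\<close>

lemma derivation_commutator:
  assumes "derivation D" "derivation E"
  shows "derivation (\<lambda>x. D (E x) - E (D x))"
  using assms unfolding derivation_def by (simp add: algebra_simps)

lemma poly_mapping_eq_sum_single:
  assumes "finite A" "Poly_Mapping.keys p \<subseteq> A"
  shows "p = (\<Sum>a\<in>A. Poly_Mapping.single a (Poly_Mapping.lookup p a))"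
proof (rule poly_mapping_eqI)
  fix k
  have "Poly_Mapping.lookup (\<Sum>a\<in>A. Poly_Mapping.single a (Poly_Mapping.lookup p a)) k
      = (\<Sum>a\<in>A. if a = k then Poly_Mapping.lookup p k else 0)"
    unfolding lookup_sum by (rule sum.cong) (auto simp: lookup_single when_def)
  also have "\<dots> = Poly_Mapping.lookup p k" using assms by (auto simp: sum.delta in_keys_iff)
  finally show "Poly_Mapping.lookup p k
      = Poly_Mapping.lookup (\<Sum>a\<in>A. Poly_Mapping.single a (Poly_Mapping.lookup p a)) k" by simp
qed

text \<open>Chain rule for the monomial with exponent \<open>a\<close>, where \<open>g k\<close> is
  the prescribed image of the variable \<open>k\<close>. The exponent of each \<open>k\<close> in
  the sum is positive, so the subtraction is exact.\<close>

definition monom_deriv :: "('v \<Rightarrow> ('v \<Rightarrow>\<^sub>0 nat) \<Rightarrow>\<^sub>0 'a::comm_ring_1) \<Rightarrow> ('v \<Rightarrow>\<^sub>0 nat) \<Rightarrow> ('v \<Rightarrow>\<^sub>0 nat) \<Rightarrow>\<^sub>0 'a" where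
  "monom_deriv g a = (\<Sum>k\<in>Poly_Mapping.keys a.
     Poly_Mapping.single (a - Poly_Mapping.single k 1) (of_nat (Poly_Mapping.lookup a k)) * g k)"

text \<open>The derivation that extends \<delta> from the coefficients and sends the variable
  \<open>v\<close> to \<open>g v\<close>; this one formula yields both the extended field
  derivations and the partial derivatives.\<close>

definition poly_deriv :: "('a::comm_ring_1 \<Rightarrow> 'a) \<Rightarrow> ('v \<Rightarrow> ('v \<Rightarrow>\<^sub>0 nat) \<Rightarrow>\<^sub>0 'a) \<Rightarrow>
    (('v \<Rightarrow>\<^sub>0 nat) \<Rightarrow>\<^sub>0 'a) \<Rightarrow> ('v \<Rightarrow>\<^sub>0 nat) \<Rightarrow>\<^sub>0 'a" where
  "poly_deriv \<delta> g p = (\<Sum>a\<in>Poly_Mapping.keys p. Poly_Mapping.single a (\<delta> (Poly_Mapping.lookup p a))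
     + Poly_Mapping.single 0 (Poly_Mapping.lookup p a) * monom_deriv g a)"

lemma monom_deriv_superset:
  assumes "finite A" "Poly_Mapping.keys a \<subseteq> A"
  shows "monom_deriv g a = (\<Sum>k\<in>A.
     Poly_Mapping.single (a - Poly_Mapping.single k 1) (of_nat (Poly_Mapping.lookup a k)) * g k)"
  unfolding monom_deriv_def
  by (rule sum.mono_neutral_left) (use assms in \<open>auto simp: in_keys_iff\<close>)

lemma monom_deriv_add:
  "monom_deriv g (a + b) = monom_deriv g a * Poly_Mapping.single b 1 + Poly_Mapping.single a 1 * monom_deriv g b"
proof -
  let ?A = "Poly_Mapping.keys a \<union> Poly_Mapping.keys b"
  let ?s = "Poly_Mapping.single" and ?l = "Poly_Mapping.lookup"
  have "?s (a + b - ?s k 1) (of_nat (?l (a + b) k) :: 'b) =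
      ?s b 1 * ?s (a - ?s k 1) (of_nat (?l a k)) + ?s a 1 * ?s (b - ?s k 1) (of_nat (?l b k))" for k
  proof -
    have 1: "a + b - ?s k 1 = b + (a - ?s k 1)" if "?l a k \<noteq> 0" for a b :: "'a \<Rightarrow>\<^sub>0 nat"
      using that by (intro poly_mapping_eqI) (auto simp: lookup_add lookup_minus lookup_single when_def)
    have "?s (a + b - ?s k 1) (of_nat (?l a k)) = ?s b 1 * ?s (a - ?s k 1) (of_nat (?l a k) :: 'b)"
    proof (cases "?l a k = 0")
      case False
      then show ?thesis by (simp only: 1 mult_single mult_1_left not_False_eq_True)
    qed simp
    moreover have "?s (a + b - ?s k 1) (of_nat (?l b k)) = ?s a 1 * ?s (b - ?s k 1) (of_nat (?l b k) :: 'b)"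
    proof (cases "?l b k = 0")
      case False
      then show ?thesis by (simp only: 1[of b a] add.commute[of a b] mult_single mult_1_left not_False_eq_True)
    qed simp
    ultimately show ?thesis by (simp add: lookup_add single_add)
  qed
  then show ?thesis
    by (subst (1 2 3) monom_deriv_superset[of ?A])
      (auto simp: sum_distrib_left sum.distrib algebra_simps dest: keys_add[THEN subsetD])
qed

locale coeff_derivation =
  fixes \<delta> :: "'a::comm_ring_1 \<Rightarrow> 'a"
  assumes der: "derivation \<delta>"
begin

lemma poly_deriv_superset:
  assumes "finite A" "Poly_Mapping.keys p \<subseteq> A"
  shows "poly_deriv \<delta> g p = (\<Sum>a\<in>A. Poly_Mapping.single a (\<delta> (Poly_Mapping.lookup p a))
     + Poly_Mapping.single 0 (Poly_Mapping.lookup p a) * monom_deriv g a)"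
  unfolding poly_deriv_def
  by (rule sum.mono_neutral_left) (use assms in \<open>auto simp: in_keys_iff derivation_zero[OF der]\<close>)

lemma poly_deriv_add: "poly_deriv \<delta> g (p + q) = poly_deriv \<delta> g p + poly_deriv \<delta> g q"
  by (subst (1 2 3) poly_deriv_superset[of "Poly_Mapping.keys p \<union> Poly_Mapping.keys q"])
    (auto simp: lookup_add derivation_add[OF der] single_add sum.distrib algebra_simps dest: keys_add[THEN subsetD])

lemma poly_deriv_sum: "poly_deriv \<delta> g (sum f A) = (\<Sum>x\<in>A. poly_deriv \<delta> g (f x))"
  by (rule additive_sum) (auto simp: poly_deriv_add, simp add: poly_deriv_def)

lemma poly_deriv_single:
  "poly_deriv \<delta> g (Poly_Mapping.single a c) = Poly_Mapping.single a (\<delta> c) + Poly_Mapping.single 0 c * monom_deriv g a"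
  by (subst poly_deriv_superset[of "{a}"]) auto

lemma derivation_poly_deriv: "derivation (poly_deriv \<delta> g)"
proof -
  let ?s = "Poly_Mapping.single" and ?l = "Poly_Mapping.lookup" and ?D = "poly_deriv \<delta> g"
  have single: "?D (?s a x * ?s b y) = ?s a x * ?D (?s b y) + ?D (?s a x) * ?s b y" for a b x y
  proof -
    have x: "?s a x = ?s 0 x * ?s a 1" "?s b y = ?s 0 y * ?s b 1" "?s 0 (x * y) = ?s 0 x * ?s 0 y"
      by (simp_all add: mult_single)
    have "?D (?s a x * ?s b y) = ?s (a + b) (x * \<delta> y) + ?s (a + b) (\<delta> x * y)
        + ?s 0 (x * y) * (monom_deriv g a * ?s b 1 + ?s a 1 * monom_deriv g b)"
      by (simp add: mult_single poly_deriv_single monom_deriv_add derivation_mult[OF der] single_add)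
    also have "\<dots> = ?s a x * ?s b (\<delta> y) + ?s a (\<delta> x) * ?s b y
        + (?s 0 x * monom_deriv g a * ?s b y + ?s a x * (?s 0 y * monom_deriv g b))"
    proof -
      have "?s 0 (x * y) * (monom_deriv g a * ?s b 1 + ?s a 1 * monom_deriv g b)
          = ?s 0 x * monom_deriv g a * ?s b y + ?s a x * (?s 0 y * monom_deriv g b)"
        by (simp only: x) (simp only: algebra_simps)
      then show ?thesis by (simp add: mult_single)
    qed
    also have "\<dots> = ?s a x * ?D (?s b y) + ?D (?s a x) * ?s b y"
      by (simp add: poly_deriv_single algebra_simps)
    finally show ?thesis .
  qed
  have "?D (p * q) = p * ?D q + ?D p * q" for p q
  proof -
    let ?P = "Poly_Mapping.keys p" and ?Q = "Poly_Mapping.keys q"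
    define P where "P = (\<lambda>a. ?s a (?l p a))"
    define Q where "Q = (\<lambda>b. ?s b (?l q b))"
    have p: "p = sum P ?P" and q: "q = sum Q ?Q"
      unfolding P_def Q_def by (auto intro!: poly_mapping_eq_sum_single)
    have "?D (sum P ?P * sum Q ?Q) = (\<Sum>a\<in>?P. \<Sum>b\<in>?Q. ?D (P a * Q b))"
      by (simp add: sum_product poly_deriv_sum)
    also have "\<dots> = (\<Sum>a\<in>?P. \<Sum>b\<in>?Q. P a * ?D (Q b)) + (\<Sum>a\<in>?P. \<Sum>b\<in>?Q. ?D (P a) * Q b)"
      by (simp add: P_def Q_def single sum.distrib)
    also have "\<dots> = sum P ?P * ?D (sum Q ?Q) + ?D (sum P ?P) * sum Q ?Q"
      by (simp add: sum_product poly_deriv_sum)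
    finally show ?thesis using p q by simp
  qed
  then show ?thesis unfolding derivation_def using poly_deriv_add by blast
qed

lemma poly_deriv_const: "poly_deriv \<delta> g (Poly_Mapping.single 0 c) = Poly_Mapping.single 0 (\<delta> c)"
  by (simp add: poly_deriv_single monom_deriv_def)

lemma poly_deriv_var: "poly_deriv \<delta> g (Poly_Mapping.single (Poly_Mapping.single v 1) 1) = g v"
  by (simp add: poly_deriv_single monom_deriv_def derivation_one[OF der])

end

text \<open>By the product rule, the monomials killed by \<open>E\<close> are closed under
  multiplication, so constants and variables generate everything.\<close>

lemma derivation_eq_0:
  fixes E :: "(('v \<Rightarrow>\<^sub>0 nat) \<Rightarrow>\<^sub>0 'a::comm_ring_1) \<Rightarrow> ('v \<Rightarrow>\<^sub>0 nat) \<Rightarrow>\<^sub>0 'a"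
  assumes E: "derivation E"
    and const: "\<And>c. E (Poly_Mapping.single 0 c) = 0"
    and var: "\<And>v. E (Poly_Mapping.single (Poly_Mapping.single v 1) 1) = 0"
  shows "E p = 0"
proof -
  let ?s = "Poly_Mapping.single" and ?l = "Poly_Mapping.lookup"
  let ?Z = "{a. E (?s a 1) = 0}"
  have add: "a + b \<in> ?Z" if "a \<in> ?Z" "b \<in> ?Z" for a b
  proof -
    have "?s (a + b) 1 = ?s a 1 * ?s b (1 :: 'a)" by (simp add: mult_single)
    then show ?thesis using that derivation_mult[OF E] by simp
  qed
  have zero: "0 \<in> ?Z" using const[of 1] by simp
  have "?s k n \<in> ?Z" for k n
  proof (induction n)
    case (Suc n)
    have "?s k (Suc n) = ?s k 1 + ?s k n" by (simp flip: single_add)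
    then show ?case using add[of "?s k 1" "?s k n"] var Suc by simp
  qed (use zero in simp)
  then have sumZ: "(\<Sum>k\<in>Poly_Mapping.keys a. ?s k (?l a k)) \<in> ?Z" for a :: "'v \<Rightarrow>\<^sub>0 nat"
    using zero add by (intro sum_closed_under_add)
  have mono: "E (?s a 1) = 0" for a
    using sumZ[of a] unfolding poly_mapping_eq_sum_single[OF finite_keys subset_refl, of a, symmetric] by simp
  have "E (?s a c) = 0" for a c
  proof -
    have "?s a c = ?s 0 c * ?s a 1" by (simp add: mult_single)
    then show ?thesis using derivation_mult[OF E] const mono by simp
  qed
  then have "E (\<Sum>a\<in>Poly_Mapping.keys p. ?s a (?l p a)) = 0"
    by (simp add: derivation_sum[OF E])
  then show ?thesis using poly_mapping_eq_sum_single[OF finite_keys subset_refl, of p] by simp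
qed

section \<open>Extension of derivations to fraction fields\<close>

definition fract_deriv :: "('r::idom \<Rightarrow> 'r) \<Rightarrow> 'r fract \<Rightarrow> 'r fract" where
  "fract_deriv D q = (SOME r. \<exists>a b. b \<noteq> 0 \<and> q = Fract a b \<and> r = Fract (b * D a - a * D b) (b * b))"

context
  fixes D :: "'r::idom \<Rightarrow> 'r"
  assumes D: "derivation D"
begin

text \<open>The quotient rule does not depend on the representative: after cross-multiplying, the
  difference of two values is a combination of a y - x b and of its derivative, both of which are
  zero.\<close>

lemma fract_deriv_Fract:
  assumes "b \<noteq> 0"
  shows "fract_deriv D (Fract a b) = Fract (b * D a - a * D b) (b * b)"
proof -
  have "Fract (y * D x - x * D y) (y * y) = Fract (b * D a - a * D b) (b * b)"
    if "y \<noteq> 0" "Fract a b = Fract x y" for x y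
  proof -
    have eq: "a * y = x * b" using that assms by (simp add: eq_fract)
    then have "D (a * y) = D (x * b)" by simp
    then have "a * D y + D a * y = x * D b + D x * b" by (simp add: derivation_mult[OF D])
    moreover have "(y * D x - x * D y) * (b * b) - (b * D a - a * D b) * (y * y)
        = (y * b) * ((x * D b + D x * b) - (a * D y + D a * y)) + (a * y - x * b) * (b * D y + y * D b)"
      by (simp add: algebra_simps)
    ultimately have "(y * D x - x * D y) * (b * b) = (b * D a - a * D b) * (y * y)" using eq by simp
    then show ?thesis using that assms by (simp add: eq_fract)
  qed
  then show ?thesis unfolding fract_deriv_def
    by (intro some_equality) (use assms in blast)+
qed

lemma derivation_fract_deriv: "derivation (fract_deriv D)"
  unfolding derivation_def
proof (intro conjI allI)
  fix p q :: "'r fract"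
  obtain a b where p: "p = Fract a b" "b \<noteq> 0" by (cases p) auto
  obtain x y where q: "q = Fract x y" "y \<noteq> 0" by (cases q) auto
  show "fract_deriv D (p + q) = fract_deriv D p + fract_deriv D q"
    using p q by (simp add: fract_deriv_Fract derivation_add[OF D] derivation_mult[OF D] eq_fract algebra_simps)
  show "fract_deriv D (p * q) = p * fract_deriv D q + fract_deriv D p * q"
    using p q by (simp add: fract_deriv_Fract derivation_add[OF D] derivation_mult[OF D] eq_fract algebra_simps)
qed

lemma fract_deriv_of_ring: "fract_deriv D (Fract a 1) = Fract (D a) 1"
  by (simp add: fract_deriv_Fract derivation_one[OF D])

end

lemma derivation_fract_eq_0:
  fixes E :: "'r::idom fract \<Rightarrow> 'r fract"
  assumes E: "derivation E" and ring: "\<And>a. E (Fract a 1) = 0"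
  shows "E q = 0"
proof -
  obtain a b where q: "q = Fract a b" "b \<noteq> 0" by (cases q) auto
  then have "q * Fract b 1 = Fract a 1" by (simp add: eq_fract)
  then have "E (q * Fract b 1) = 0" using ring by simp
  then have "E q * Fract b 1 = 0" using derivation_mult[OF E] ring by simp
  moreover have "Fract b 1 \<noteq> 0" using q by (simp add: Zero_fract_def eq_fract)
  ultimately show ?thesis by simp
qed

section \<open>The field of differential rational functions\<close>

text \<open>The indeterminates are indexed by finitely supported exponent vectors \<open>v\<close>, and \<open>\<partial>\<^sub>i\<close> adds the
  \<open>i\<close>-th unit vector to the index. Coordinates \<open>\<ge> m\<close> distinguish independent differential
  indeterminates.\<close>

type_synonym 'a drat = "(((nat \<Rightarrow>\<^sub>0 nat) \<Rightarrow>\<^sub>0 nat) \<Rightarrow>\<^sub>0 'a) fract"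

definition drat_const :: "'a::field \<Rightarrow> 'a drat" where
  "drat_const c = Fract (Poly_Mapping.single 0 c) 1"

definition drat_var :: "(nat \<Rightarrow>\<^sub>0 nat) \<Rightarrow> 'a::field drat" where
  "drat_var v = Fract (Poly_Mapping.single (Poly_Mapping.single v 1) 1) 1"

definition drat_deriv :: "(nat \<Rightarrow> 'a::field \<Rightarrow> 'a) \<Rightarrow> nat \<Rightarrow> 'a drat \<Rightarrow> 'a drat" where
  "drat_deriv d i = fract_deriv (poly_deriv (d i)
     (\<lambda>v. Poly_Mapping.single (Poly_Mapping.single (v + Poly_Mapping.single i 1) 1) 1))"

definition drat_partial :: "(nat \<Rightarrow>\<^sub>0 nat) \<Rightarrow> 'a::field drat \<Rightarrow> 'a drat" where
  "drat_partial w = fract_deriv (poly_deriv (\<lambda>_. 0) (\<lambda>v. if v = w then 1 else 0))"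

lemma drat_const_hom:
  "drat_const (a + b) = drat_const a + drat_const b"
  "drat_const (a * b) = drat_const a * drat_const b"
  "drat_const 0 = 0" "drat_const 1 = 1"
  by (simp_all add: drat_const_def single_add mult_single Zero_fract_def One_fract_def)

lemma derivation_zero_map: "derivation (\<lambda>_. 0)"
  by (simp add: derivation_def)

lemma derivation_drat_partial: "derivation (drat_partial w)"
  unfolding drat_partial_def
  by (intro derivation_fract_deriv coeff_derivation.derivation_poly_deriv coeff_derivation.intro derivation_zero_map)

lemma drat_partial_const: "drat_partial w (drat_const c) = 0"
  unfolding drat_partial_def drat_const_def
  by (subst fract_deriv_of_ring)
    (simp_all add: coeff_derivation.derivation_poly_deriv coeff_derivation.poly_deriv_const
      coeff_derivation.intro derivation_zero_map Zero_fract_def)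

lemma drat_partial_var: "drat_partial w (drat_var v) = (if v = w then 1 else 0)"
  unfolding drat_partial_def drat_var_def
  unfolding fract_deriv_of_ring[OF coeff_derivation.derivation_poly_deriv[OF coeff_derivation.intro[OF derivation_zero_map]]]
    coeff_derivation.poly_deriv_var[OF coeff_derivation.intro[OF derivation_zero_map]]
  by (simp add: Zero_fract_def One_fract_def)

context dfield
begin

lemma derivation_d: "i < m \<Longrightarrow> derivation (d i)"
  by (simp add: derivation_def d_add d_mult)

lemma coeff_derivation_d: "i < m \<Longrightarrow> coeff_derivation (d i)"
  by (simp add: coeff_derivation_def derivation_d)

lemma drat_deriv_ring:
  assumes "i < m"
  shows "drat_deriv d i (Fract p 1) = Fract (poly_deriv (d i)
     (\<lambda>v. Poly_Mapping.single (Poly_Mapping.single (v + Poly_Mapping.single i 1) 1) 1) p) 1"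
  unfolding drat_deriv_def
  by (rule fract_deriv_of_ring[OF coeff_derivation.derivation_poly_deriv[OF coeff_derivation_d[OF assms]]])

lemma derivation_drat_deriv: "i < m \<Longrightarrow> derivation (drat_deriv d i)"
  unfolding drat_deriv_def
  by (intro derivation_fract_deriv coeff_derivation.derivation_poly_deriv coeff_derivation_d)

lemma drat_deriv_const: "i < m \<Longrightarrow> drat_deriv d i (drat_const c) = drat_const (d i c)"
  unfolding drat_const_def by (simp add: drat_deriv_ring coeff_derivation.poly_deriv_const[OF coeff_derivation_d])

lemma drat_deriv_var: "i < m \<Longrightarrow> drat_deriv d i (drat_var v) = drat_var (v + Poly_Mapping.single i 1)"
  unfolding drat_var_def by (simp only: drat_deriv_ring coeff_derivation.poly_deriv_var[OF coeff_derivation_d])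

text \<open>Checked on constants and variables, then lifted to polynomials by
  \<open>derivation_eq_0\<close> and to fractions by \<open>derivation_fract_eq_0\<close>, each
  applied to the commutator.\<close>

lemma drat_deriv_comm:
  assumes "i < m" "j < m"
  shows "drat_deriv d i (drat_deriv d j q) = drat_deriv d j (drat_deriv d i q)"
proof -
  let ?g = "\<lambda>i (v :: nat \<Rightarrow>\<^sub>0 nat). Poly_Mapping.single (Poly_Mapping.single (v + Poly_Mapping.single i 1) (1 :: nat)) (1 :: 'a)"
  let ?P = "\<lambda>i. poly_deriv (d i) (?g i)"
  note cd = coeff_derivation_d[OF assms(1)] coeff_derivation_d[OF assms(2)]
  have "?P i (?P j p) - ?P j (?P i p) = 0" for p
  proof (rule derivation_eq_0[where E = "\<lambda>p. ?P i (?P j p) - ?P j (?P i p)"])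
    show "derivation (\<lambda>p. ?P i (?P j p) - ?P j (?P i p))"
      by (intro derivation_commutator coeff_derivation.derivation_poly_deriv cd)
    show "?P i (?P j (Poly_Mapping.single 0 c)) - ?P j (?P i (Poly_Mapping.single 0 c)) = 0" for c
      using cd assms by (simp add: coeff_derivation.poly_deriv_const d_comm)
    show "?P i (?P j (Poly_Mapping.single (Poly_Mapping.single v 1) 1))
        - ?P j (?P i (Poly_Mapping.single (Poly_Mapping.single v 1) 1)) = 0" for v
    proof -
      have "v + Poly_Mapping.single j 1 + Poly_Mapping.single i 1
          = v + Poly_Mapping.single i (1::nat) + Poly_Mapping.single j 1" by (simp only: ac_simps)
      then show ?thesis using cd by (simp only: coeff_derivation.poly_deriv_var diff_self)
    qed
  qed
  then have P: "?P i (?P j p) = ?P j (?P i p)" for p by (metis eq_iff_diff_eq_0)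
  have "drat_deriv d i (drat_deriv d j q) - drat_deriv d j (drat_deriv d i q) = 0"
  proof (rule derivation_fract_eq_0[where E = "\<lambda>q. drat_deriv d i (drat_deriv d j q) - drat_deriv d j (drat_deriv d i q)"])
    show "derivation (\<lambda>q. drat_deriv d i (drat_deriv d j q) - drat_deriv d j (drat_deriv d i q))"
      using assms by (intro derivation_commutator derivation_drat_deriv)
    show "drat_deriv d i (drat_deriv d j (Fract a 1)) - drat_deriv d j (drat_deriv d i (Fract a 1)) = 0" for a
      using assms by (simp only: drat_deriv_ring P diff_self)
  qed
  then show ?thesis by simp
qed

lemma dfield_drat: "dfield (drat_deriv d) m"
  by unfold_locales (auto simp: derivation_add derivation_mult derivation_drat_deriv drat_deriv_comm)

lemma dpow_drat_var:
  assumes "\<nu> \<in> midx m"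
  shows "dpow (drat_deriv d) m \<nu> (drat_var v) = drat_var (v + mi_pm \<nu>)"
  using assms
proof (induction \<nu> rule: midx_induct)
  case zero
  have "mi_pm (\<lambda>_. 0) = 0" by simp
  then show ?case by simp
next
  case (Suc \<nu> i)
  then show ?case
    by (simp only: dfield.d_dpow_Suc[OF dfield_drat] drat_deriv_var mi_pm_Suc add.assoc)
qed

end

text \<open>Multi-indices live in the coordinates below m and the tag of c_j sits at m + j, so both
  can be read off from the sum. Hence distinct derivatives of the c_j are distinct
  variables.\<close>

lemma single_plus_mi_pm_inj:
  assumes "\<nu> \<in> midx m" "\<mu> \<in> midx m"
    and eq: "Poly_Mapping.single (m + j) (1::nat) + mi_pm \<nu> = Poly_Mapping.single (m + k) 1 + mi_pm \<mu>"
  shows "j = k \<and> \<nu> = \<mu>"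
proof -
  have l: "(if m + j = i then 1 else 0) + \<nu> i = (if m + k = i then 1 else 0) + \<mu> i" for i
    using arg_cong[OF eq, of "\<lambda>p. Poly_Mapping.lookup p i"] assms
    by (simp add: lookup_add lookup_single when_def split: if_splits)
  have "j = k" using l[of "m + j"] assms(1,2) by (auto simp: midx_def split: if_splits)
  moreover from this have "\<nu> i = \<mu> i" for i using l[of i] by (cases "m + k = i") auto
  ultimately show ?thesis by auto
qed

section \<open>Encoding by lists of scalars\<close>

lemma inj_items: "inj (Poly_Mapping.items :: ('k::linorder \<Rightarrow>\<^sub>0 'c::zero) \<Rightarrow> _)"
  by (rule injI) (metis the_value_items)

lemma inj_flatten: "inj (\<lambda>l. concat (map (\<lambda>(x, y). [x, y]) l))"
proof (rule injI)
  fix k l :: "('a \<times> 'a) list"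
  assume "concat (map (\<lambda>(x, y). [x, y]) k) = concat (map (\<lambda>(x, y). [x, y]) l)"
  then show "k = l"
  proof (induction k arbitrary: l)
    case Nil
    then show ?case by (cases l) (auto split: prod.splits)
  next
    case (Cons p k)
    then show ?case by (cases l) (auto split: prod.splits)
  qed
qed

lemma exists_inj_exponents: "\<exists>g :: ((nat \<Rightarrow>\<^sub>0 nat) \<Rightarrow>\<^sub>0 nat) \<Rightarrow> nat. inj g"
proof -
  define f where "f = (\<lambda>v :: nat \<Rightarrow>\<^sub>0 nat. to_nat (Poly_Mapping.items v))"
  have f: "inj f" unfolding f_def by (auto intro!: injI dest!: injD[OF inj_to_nat] injD[OF inj_items])
  have "inj (\<lambda>a :: (nat \<Rightarrow>\<^sub>0 nat) \<Rightarrow>\<^sub>0 nat. to_nat (map (map_prod f id) (Poly_Mapping.items a)))"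
  proof (rule injI)
    fix a b :: "(nat \<Rightarrow>\<^sub>0 nat) \<Rightarrow>\<^sub>0 nat"
    assume "to_nat (map (map_prod f id) (Poly_Mapping.items a)) = to_nat (map (map_prod f id) (Poly_Mapping.items b))"
    then have "map (map_prod f id) (Poly_Mapping.items a) = map (map_prod f id) (Poly_Mapping.items b)" by simp
    moreover have "inj (map (map_prod f id))" using f by (simp add: prod.inj_map)
    ultimately have "Poly_Mapping.items a = Poly_Mapping.items b" by (rule injD[rotated])
    then show "a = b" by (metis the_value_items)
  qed
  then show ?thesis by blast
qed

text \<open>Provides the carrier inside \<open>'a list\<close>. Exponents are countable and become
  scalars via \<open>of_nat\<close>, which is injective in characteristic 0; a fraction becomes the
  term lists of a chosen numerator and denominator.\<close>

lemma exists_inj_drat: "\<exists>h :: 'a::field_char_0 drat \<Rightarrow> 'a list. inj h"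
proof -
  obtain g :: "((nat \<Rightarrow>\<^sub>0 nat) \<Rightarrow>\<^sub>0 nat) \<Rightarrow> nat" where g: "inj g" using exists_inj_exponents by blast
  define e where "e = (\<lambda>p :: ((nat \<Rightarrow>\<^sub>0 nat) \<Rightarrow>\<^sub>0 nat) \<Rightarrow>\<^sub>0 'a. map (map_prod (of_nat \<circ> g) id) (Poly_Mapping.items p) :: ('a \<times> 'a) list)"
  have "inj (of_nat \<circ> g :: _ \<Rightarrow> 'a)" using g by (auto intro: inj_compose simp: inj_on_def)
  then have "inj (map (map_prod (of_nat \<circ> g :: _ \<Rightarrow> 'a) (id :: 'a \<Rightarrow> 'a)))" by (simp add: prod.inj_map)
  then have e: "inj e" unfolding e_def by (intro injI) (metis inj_items injD)
  define r where "r = (\<lambda>q :: 'a drat. SOME p. q = Fract (fst p) (snd p))"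
  have r: "q = Fract (fst (r q)) (snd (r q))" for q
    unfolding r_def by (rule someI_ex) (metis Fract_cases fst_conv snd_conv)
  \<comment> \<open>The leading length tells where the numerator ends; its companion 0 only fills up
    the pair.\<close>
  define h where "h = (\<lambda>q :: 'a drat. (of_nat (length (e (fst (r q)))), 0) # e (fst (r q)) @ e (snd (r q)))"
  have "inj h"
  proof (rule injI)
    fix p q assume "h p = h q"
    then have "length (e (fst (r p))) = length (e (fst (r q)))"
      "e (fst (r p)) @ e (snd (r p)) = e (fst (r q)) @ e (snd (r q))" by (auto simp: h_def)
    then have "e (fst (r p)) = e (fst (r q))" "e (snd (r p)) = e (snd (r q))" by auto
    then have "fst (r p) = fst (r q)" "snd (r p) = snd (r q)" using e by (auto dest: injD)
    then show "p = q" using r by metis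
  qed
  then have "inj ((\<lambda>l. concat (map (\<lambda>(x, y). [x, y]) l)) \<circ> h)" using inj_flatten by (rule inj_compose[rotated])
  then show ?thesis by blast
qed

section \<open>Extension of scalars\<close>

locale dfield_ext = F: dfield d m + G: dfield dG m
  for d :: "nat \<Rightarrow> 'a::field \<Rightarrow> 'a" and dG :: "nat \<Rightarrow> 'g::field \<Rightarrow> 'g" and m :: nat +
  fixes \<iota> :: "'a \<Rightarrow> 'g"
  assumes \<iota>_add: "\<iota> (x + y) = \<iota> x + \<iota> y" and \<iota>_mult: "\<iota> (x * y) = \<iota> x * \<iota> y" and \<iota>_one: "\<iota> 1 = 1"
    and \<iota>_d: "i < m \<Longrightarrow> dG i (\<iota> x) = \<iota> (d i x)"
begin

abbreviation ext :: "((nat \<Rightarrow> nat) \<Rightarrow> 'a) \<Rightarrow> (nat \<Rightarrow> nat) \<Rightarrow> 'g" where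
  "ext X \<equiv> \<lambda>\<kappa>. \<iota> (X \<kappa>)"

abbreviation gtimes (infixl "\<circle>" 75) where "X \<circle> Y \<equiv> op_times dG m X Y"

lemma \<iota>_zero [simp]: "\<iota> 0 = 0"
  using \<iota>_add[of 0 0] by (metis add_cancel_right_right add_0_left)

lemma \<iota>_eq_0 [simp]: "\<iota> x = 0 \<longleftrightarrow> x = 0"
  by (metis \<iota>_mult \<iota>_one \<iota>_zero mult_zero_left nonzero_divide_eq_eq zero_neq_one divide_self times_divide_eq_left mult.commute)

lemma \<iota>_sum: "\<iota> (sum f A) = (\<Sum>x\<in>A. \<iota> (f x))"
  by (rule additive_sum[where h = \<iota>]) (simp_all add: \<iota>_add)

lemma inj_\<iota>: "inj \<iota>"
proof (rule injI)
  fix x y assume "\<iota> x = \<iota> y"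
  then have "\<iota> (x - y) = 0" using \<iota>_add[of "x - y" y] by simp
  then show "x = y" by simp
qed

lemma ops_ext: "X \<in> ops type_ring m \<Longrightarrow> ext X \<in> ops type_ring m"
  by (simp add: ops_type_ring)

lemma ord_le_ext: "ord_le type_ring m (ext X) r \<longleftrightarrow> ord_le type_ring m X r"
  by (simp add: ord_le_def)

lemma th_ext: "G.th \<theta> (ext X) = ext (F.th \<theta> X)"
proof -
  have "op_D dG i (ext Y) = ext (op_D d i Y)" if "i < m" for i Y
    using that by (auto simp: op_D_def \<iota>_d \<iota>_add fun_eq_iff)
  then show ?thesis by (intro dpow_intertwine(1)[of m UNIV, where h = ext]) auto
qed

text \<open>The larger field is a vector space over the base field via \<iota>, so the map sending
  \<open>x0\<close> to 1 extends linearly from the line through \<open>x0\<close>.\<close>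

lemma exists_functional:
  assumes "x0 \<noteq> 0"
  shows "\<exists>\<phi>. (\<forall>x y. \<phi> (x + y) = \<phi> x + \<phi> y) \<and> (\<forall>a x. \<phi> (\<iota> a * x) = a * \<phi> x) \<and> \<phi> x0 = 1"
proof -
  interpret V: vector_space_pair "\<lambda>a x. \<iota> a * x" "(*) :: 'a \<Rightarrow> 'a \<Rightarrow> 'a"
    by unfold_locales (auto simp: algebra_simps \<iota>_add \<iota>_mult \<iota>_one)
  have "V.vs1.independent {x0}" using assms by simp
  from V.linear_independent_extend[OF this, of "\<lambda>_. 1"] obtain \<phi>
    where \<phi>: "Vector_Spaces.linear (\<lambda>a x. \<iota> a * x) (*) \<phi>" "\<phi> x0 = 1" by auto
  interpret Vector_Spaces.linear "\<lambda>a x. \<iota> a * x" "(*)" \<phi> by (rule \<phi>)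
  show ?thesis using add scale \<phi>(2) by blast
qed

text \<open>In a relation over the larger field, the unknown scalars multiply base-field
  coefficients. A base-linear functional applied to each of them gives a relation over the base
  field, and the functional is chosen to keep one nonzero scalar nonzero.\<close>

lemma indep_ext:
  assumes B: "F.indep B" and X: "\<And>b. b \<in> B \<Longrightarrow> X b \<in> G.opset"
    and rel: "\<And>j. (\<Sum>b\<in>B. X b \<circle> ext (b j)) = 0" and b: "b \<in> B"
  shows "X b = 0"
proof (rule ccontr)
  assume "X b \<noteq> 0"
  then obtain \<theta>0 where "X b \<theta>0 \<noteq> 0" by (auto simp: fun_eq_iff)
  then obtain \<phi> where \<phi>: "\<And>x y. \<phi> (x + y) = \<phi> x + \<phi> y" "\<And>a x. \<phi> (\<iota> a * x) = a * \<phi> x" "\<phi> (X b \<theta>0) = 1"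
    using exists_functional by blast
  have zero: "\<phi> 0 = 0" using \<phi>(2)[of 0 0] by simp
  have sum: "\<phi> (sum f A) = (\<Sum>x\<in>A. \<phi> (f x))" for A and f :: "'c \<Rightarrow> 'g"
    by (rule additive_sum[where h = \<phi>]) (simp_all add: zero \<phi>(1))
  define Y where "Y = (\<lambda>b \<theta>. \<phi> (X b \<theta>))"
  have supp: "{\<theta>. Y b \<theta> \<noteq> 0} \<subseteq> {\<theta>. X b \<theta> \<noteq> 0}" for b by (auto simp: Y_def zero)
  have Y: "Y b \<in> F.opset" if "b \<in> B" for b
    using X[OF that] finite_subset[OF supp[of b]] by (auto simp: ops_type_ring Y_def zero)
  have "(\<Sum>b\<in>B. op_times d m (Y b) (b j)) = 0" for j
  proof
    fix \<kappa>
    have "op_times d m (Y b) (b j) \<kappa> = \<phi> ((X b \<circle> ext (b j)) \<kappa>)" if "b \<in> B" for b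
    proof -
      have fin: "finite {\<theta>. X b \<theta> \<noteq> 0}" using X[OF that] by (simp add: ops_type_ring)
      have "op_times d m (Y b) (b j) \<kappa> = (\<Sum>\<theta> | X b \<theta> \<noteq> 0. F.th \<theta> (b j) \<kappa> * Y b \<theta>)"
        by (subst F.times_superset[OF fin supp]) (simp add: sum_fun_apply op_scale_def mult.commute)
      also have "\<dots> = \<phi> (\<Sum>\<theta> | X b \<theta> \<noteq> 0. \<iota> (F.th \<theta> (b j) \<kappa>) * X b \<theta>)"
        by (simp only: sum \<phi>(2) Y_def)
      also have "\<dots> = \<phi> ((X b \<circle> ext (b j)) \<kappa>)"
        by (simp add: op_times_def sum_fun_apply op_scale_def th_ext mult.commute)
      finally show ?thesis .
    qed
    then have "(\<Sum>b\<in>B. op_times d m (Y b) (b j)) \<kappa> = \<phi> ((\<Sum>b\<in>B. X b \<circle> ext (b j)) \<kappa>)"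
      by (simp add: sum_fun_apply sum)
    then show "(\<Sum>b\<in>B. op_times d m (Y b) (b j)) \<kappa> = 0 \<kappa>" by (simp add: rel zero)
  qed
  from F.indepD[OF B Y this b] have "Y b = 0" .
  then show False using \<phi>(3) by (simp add: Y_def fun_eq_iff)
qed

text \<open>In each term the right factor contributes \<iota> of a base-field scalar, which
  \<open>D\<close> kills, so only the coefficients of \<open>L\<close> are differentiated.\<close>

lemma derivation_times_ext:
  assumes D: "derivation D" and const: "\<And>a. D (\<iota> a) = 0" and L: "L \<in> G.opset"
  shows "D ((L \<circle> ext Y) \<kappa>) = ((\<lambda>\<theta>. D (L \<theta>)) \<circle> ext Y) \<kappa>"
proof -
  have fin: "finite {\<theta>. L \<theta> \<noteq> 0}" using L by (simp add: ops_type_ring)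
  have supp: "{\<theta>. D (L \<theta>) \<noteq> 0} \<subseteq> {\<theta>. L \<theta> \<noteq> 0}" by (auto simp: derivation_zero[OF D])
  show ?thesis
    by (subst G.times_superset[OF fin supp])
      (simp add: op_times_def sum_fun_apply op_scale_def derivation_sum[OF D] derivation_mult[OF D] th_ext const)
qed

text \<open>The extra term stems from the summand \<nu> = \<theta>0 in the Leibniz expansion of
  \<theta> c. It occurs only for \<theta>0 <= \<theta>, and maximality of the order forces \<theta>
  = \<theta>0, which leaves the coefficient of \<theta>0 at exponent 0. The flag \<open>P\<close>
  records whether \<open>c\<close> is the indeterminate that \<open>D\<close> refers to.\<close>

lemma derivation_times_const:
  assumes D: "derivation D" and L: "L \<in> G.opset" "L \<theta>0 \<noteq> 0"
    and max: "\<And>\<theta>. L \<theta> \<noteq> 0 \<Longrightarrow> mi_ord m \<theta> \<le> mi_ord m \<theta>0"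
    and c: "\<And>\<nu>. \<nu> \<in> midx m \<Longrightarrow> D (dpow dG m \<nu> c) = (if P \<and> \<nu> = \<theta>0 then 1 else 0)"
  shows "D ((L \<circle> op_single 0 c) \<kappa>) = ((\<lambda>\<theta>. D (L \<theta>)) \<circle> op_single 0 c) \<kappa> + (if P \<and> \<kappa> = 0 then L \<theta>0 else 0)"
proof -
  have fin: "finite {\<theta>. L \<theta> \<noteq> 0}" using L by (simp add: ops_type_ring)
  have supp: "{\<theta>. D (L \<theta>) \<noteq> 0} \<subseteq> {\<theta>. L \<theta> \<noteq> 0}" by (auto simp: derivation_zero[OF D])
  have of_nat: "D (of_nat k * x) = of_nat k * D x" for k x
    by (induction k) (simp_all add: derivation_zero[OF D] derivation_add[OF D] distrib_right)
  have th: "D (G.th \<theta> (op_single 0 c) \<kappa>) = (if P \<and> \<theta> = \<theta>0 \<and> \<kappa> = 0 then 1 else 0)" if "L \<theta> \<noteq> 0" for \<theta>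
  proof -
    have \<theta>: "\<theta> \<in> midx m" using that L by (auto simp: ops_type_ring)
    have \<theta>0: "\<theta>0 \<in> midx m" using L by (auto simp: ops_type_ring)
    have "D (G.th \<theta> (op_single 0 c) \<kappa>)
        = (\<Sum>\<nu> | \<nu> \<le> \<theta>. if (\<lambda>i. \<theta> i - \<nu> i) = \<kappa> then of_nat (mbinom m \<theta> \<nu>) * D (dpow dG m \<nu> c) else 0)"
      unfolding G.th_single[OF \<theta>] sum_fun_apply derivation_sum[OF D] op_single_apply
      by (rule sum.cong) (auto simp: of_nat derivation_zero[OF D])
    also have "\<dots> = (\<Sum>\<nu> | \<nu> \<le> \<theta>. if \<nu> = \<theta>0 then (if P \<and> \<theta> = \<theta>0 \<and> \<kappa> = 0 then 1 else 0) else 0)"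
    proof (rule sum.cong[OF refl])
      fix \<nu> assume "\<nu> \<in> {\<nu>. \<nu> \<le> \<theta>}"
      then have \<nu>: "\<nu> \<le> \<theta>" "\<nu> \<in> midx m" using midx_le[OF \<theta>] by auto
      have eq: "\<theta> = \<theta>0" if "\<nu> = \<theta>0"
      proof -
        have "\<theta> = \<theta>0 + (\<lambda>i. \<theta> i - \<theta>0 i)" using \<nu>(1) that by (auto simp: le_fun_def fun_eq_iff)
        then have "mi_ord m \<theta> = mi_ord m \<theta>0 + mi_ord m (\<lambda>i. \<theta> i - \<theta>0 i)" by (metis mi_ord_add)
        then have "mi_ord m (\<lambda>i. \<theta> i - \<theta>0 i) = 0" using max[OF \<open>L \<theta> \<noteq> 0\<close>] by simp
        moreover have "(\<lambda>i. \<theta> i - \<theta>0 i) \<in> midx m" using \<theta> by (auto simp: midx_def)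
        ultimately have "(\<lambda>i. \<theta> i - \<theta>0 i) = 0" by (intro mi_ord_eq_0)
        with \<open>\<theta> = \<theta>0 + (\<lambda>i. \<theta> i - \<theta>0 i)\<close> show ?thesis by simp
      qed
      show "(if (\<lambda>i. \<theta> i - \<nu> i) = \<kappa> then of_nat (mbinom m \<theta> \<nu>) * D (dpow dG m \<nu> c) else 0)
          = (if \<nu> = \<theta>0 then (if P \<and> \<theta> = \<theta>0 \<and> \<kappa> = 0 then 1 else 0) else 0)"
      proof (cases "\<nu> = \<theta>0")
        case True
        with eq have "\<theta> = \<theta>0" "\<nu> = \<theta>0" by auto
        moreover have "(\<lambda>i. \<theta>0 i - \<theta>0 i) = 0" by (simp add: fun_eq_iff)
        ultimately show ?thesis using c[OF \<nu>(2)] by (auto simp del: diff_self_eq_0)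
      qed (use c[OF \<nu>(2)] in simp)
    qed
    also have "\<dots> = (if P \<and> \<theta> = \<theta>0 \<and> \<kappa> = 0 then 1 else 0)"
      using finite_le_midx[OF \<theta>] by (auto simp: sum.delta)
    finally show ?thesis .
  qed
  have "D ((L \<circle> op_single 0 c) \<kappa>) = ((\<lambda>\<theta>. D (L \<theta>)) \<circle> op_single 0 c) \<kappa>
      + (\<Sum>\<theta> | L \<theta> \<noteq> 0. L \<theta> * D (G.th \<theta> (op_single 0 c) \<kappa>))"
    by (subst G.times_superset[OF fin supp])
      (simp add: op_times_def sum_fun_apply op_scale_def derivation_sum[OF D] derivation_mult[OF D] sum.distrib)
  also have "(\<Sum>\<theta> | L \<theta> \<noteq> 0. L \<theta> * D (G.th \<theta> (op_single 0 c) \<kappa>))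
      = (\<Sum>\<theta> | L \<theta> \<noteq> 0. if \<theta> = \<theta>0 then (if P \<and> \<kappa> = 0 then L \<theta>0 else 0) else 0)"
    by (rule sum.cong) (auto simp: th)
  also have "\<dots> = (if P \<and> \<kappa> = 0 then L \<theta>0 else 0)" using fin L(2) by (simp add: sum.delta)
  finally show ?thesis .
qed

section \<open>Bounded multipliers expressing the basis vectors through \<open>psi\<close>\<close>

definition psi :: "nat \<Rightarrow> (nat \<Rightarrow> 'g) \<Rightarrow> nat \<Rightarrow> (nat \<Rightarrow> nat) \<Rightarrow> 'g" where
  "psi n c k = (if k = 1 then op_single 0 1 else if k \<in> {2..n} then op_single 0 (c k) else 0)"

text \<open>\<open>D j \<theta>\<close> plays the role of the partial derivative with respect to \<open>\<theta> c\<^sub>j\<close>.\<close>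
lemma exists_cyclic_multipliers:
  fixes D :: "nat \<Rightarrow> (nat \<Rightarrow> nat) \<Rightarrow> 'g \<Rightarrow> 'g"
  assumes D: "\<And>j \<theta>. derivation (D j \<theta>)" "\<And>j \<theta> a. D j \<theta> (\<iota> a) = 0"
    and c: "\<And>j k \<theta> \<nu>. \<theta> \<in> midx m \<Longrightarrow> \<nu> \<in> midx m \<Longrightarrow>
      D j \<theta> (dpow dG m \<nu> (c k)) = (if j = k \<and> \<nu> = \<theta> then 1 else 0)"
    and B: "F.indep B" "B \<subseteq> mvecs type_ring m n" "card B = n" and n: "n \<ge> 1"
    and e: "\<forall>b\<in>B. \<forall>j\<in>{1..n}. ord_le type_ring m (b j) (e j)"
    and j: "j \<in> {1..n}"
  shows "\<exists>lam L. lam \<in> G.opset \<and> G.ordle lam (2 ^ m * (\<Sum>k=1..n. e k)) \<and> (\<forall>b\<in>B. L b \<in> G.opset) \<and>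
    (\<forall>k. lam \<circle> psi n c k = G.unit_vec j (op_single 0 1) k + (\<Sum>b\<in>B. L b \<circle> ext (b k)))"
proof -
  define s where "s = 2 ^ m * (\<Sum>k=1..n. e k)"
  have fin: "finite B" using B(1) by (simp add: F.indep_def)
  have ops: "b k \<in> F.opset" if "b \<in> B" for b k using B(2) that by (auto simp: mvecs_def)
  have psi: "psi n c k \<in> G.opset" for k by (simp add: psi_def)
  \<comment> \<open>\<open>None\<close> stands for \<psi> with multiplier \<lambda>, and
    \<open>Some b\<close> for an element of \<open>B\<close>: n + 1 rows against n coordinates. The
    row of \<psi> has order 0, so it satisfies every bound e_k.\<close>
  define v where "v = (\<lambda>i k. case i of None \<Rightarrow> psi n c k | Some b \<Rightarrow> ext (b k))"
  have "\<exists>X. (\<forall>i. X i \<in> G.opset \<and> G.ordle (X i) s) \<and> (\<exists>i\<in>insert None (Some ` B). X i \<noteq> 0) \<and>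
      (\<forall>k\<in>{1..n}. (\<Sum>i\<in>insert None (Some ` B). X i \<circle> v i k) = 0)"
  proof (rule G.exists_relation[where e = e])
    show "card {1..n} < card (insert None (Some ` B))"
      using fin B(3) by (simp add: card_image)
    show "v i k \<in> G.opset \<and> G.ordle (v i k) (e k)" if "i \<in> insert None (Some ` B)" "k \<in> {1..n}" for i k
    proof (cases i)
      case None
      then show ?thesis using psi by (auto simp: v_def psi_def G.ordle_iff op_single_def)
    next
      case (Some b)
      then show ?thesis using that e ops by (auto simp: v_def ops_ext ord_le_ext)
    qed
  qed (use fin s_def in auto)
  then obtain X where X: "\<And>i. X i \<in> G.opset" "\<And>i. G.ordle (X i) s" "\<exists>i\<in>insert None (Some ` B). X i \<noteq> 0"
    "\<forall>k\<in>{1..n}. (\<Sum>i\<in>insert None (Some ` B). X i \<circle> v i k) = 0" by blast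
  define lam where "lam = X None"
  define L where "L = (\<lambda>b. X (Some b))"
  have rel: "lam \<circle> psi n c k + (\<Sum>b\<in>B. L b \<circle> ext (b k)) = 0" for k
  proof (cases "k \<in> {1..n}")
    case True
    have "(\<Sum>i\<in>insert None (Some ` B). X i \<circle> v i k) = lam \<circle> psi n c k + (\<Sum>b\<in>B. L b \<circle> ext (b k))"
      using fin by (subst sum.insert) (auto simp: lam_def L_def v_def sum.reindex)
    with X(4) True show ?thesis by simp
  next
    case False
    then have "b k = 0" if "b \<in> B" for b
      using that B(2) by (auto simp: mvecs_def op_zero_def fun_eq_iff)
    then have "L b \<circle> ext (b k) = 0" if "b \<in> B" for b
      using that by (simp flip: zero_fun_def)
    then have "(\<Sum>b\<in>B. L b \<circle> ext (b k)) = 0" by (intro sum.neutral ballI)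
    moreover have "psi n c k = 0" using False n by (auto simp: psi_def)
    ultimately show ?thesis by (simp only: G.times_zero_right add_0_left)
  qed
  have lam: "lam \<in> G.opset" "G.ordle lam s" and L: "L b \<in> G.opset" for b
    using X by (auto simp: lam_def L_def)
  have "lam \<noteq> 0"
  proof
    assume 0: "lam = 0"
    have "(\<Sum>b\<in>B. L b \<circle> ext (b k)) = 0" for k using rel[of k] by (simp add: 0)
    then have "L b = 0" if "b \<in> B" for b using indep_ext[of B L, OF B(1)] L that by blast
    with 0 X(3) show False by (auto simp: lam_def L_def)
  qed
  then have ne: "{\<theta>. lam \<theta> \<noteq> 0} \<noteq> {}" "finite {\<theta>. lam \<theta> \<noteq> 0}" using lam by (auto simp: ops_type_ring fun_eq_iff)
  \<comment> \<open>Maximal order in the support, as \<open>derivation_times_const\<close> requires;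
    the same \<theta>0 serves for every j.\<close>
  then obtain \<theta>0 where \<theta>0: "lam \<theta>0 \<noteq> 0" "\<And>\<theta>. lam \<theta> \<noteq> 0 \<Longrightarrow> mi_ord m \<theta> \<le> mi_ord m \<theta>0"
  proof -
    have "Max (mi_ord m ` {\<theta>. lam \<theta> \<noteq> 0}) \<in> mi_ord m ` {\<theta>. lam \<theta> \<noteq> 0}" using ne by (intro Max_in) auto
    then obtain \<theta>0 where "lam \<theta>0 \<noteq> 0" "mi_ord m \<theta>0 = Max (mi_ord m ` {\<theta>. lam \<theta> \<noteq> 0})" by auto
    then show ?thesis using that[of \<theta>0] ne by simp
  qed
  have \<theta>0m: "\<theta>0 \<in> midx m" using \<theta>0(1) lam by (auto simp: ops_type_ring)
  have Dops: "(\<lambda>\<theta>. D j \<theta>0 (Z \<theta>)) \<in> G.opset" if "Z \<in> G.opset" for Z j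
  proof -
    have "{\<theta>. D j \<theta>0 (Z \<theta>) \<noteq> 0} \<subseteq> {\<theta>. Z \<theta> \<noteq> 0}" using derivation_zero[OF D(1)] by auto
    then have "finite {\<theta>. D j \<theta>0 (Z \<theta>) \<noteq> 0}"
      by (rule finite_subset) (use that in \<open>simp add: ops_type_ring\<close>)
    then show ?thesis using that derivation_zero[OF D(1)] by (auto simp: ops_type_ring)
  qed
  have main: "\<exists>lam' L'. lam' \<in> G.opset \<and> G.ordle lam' s \<and> (\<forall>b\<in>B. L' b \<in> G.opset) \<and>
    (\<forall>k. lam' \<circle> psi n c k = G.unit_vec j (op_single 0 1) k + (\<Sum>b\<in>B. L' b \<circle> ext (b k)))"
    if j: "j \<in> {2..n}" for j
  proof -
    let ?D = "D j \<theta>0"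
    define lam1 where "lam1 = (\<lambda>\<theta>. ?D (lam \<theta>))"
    define L1 where "L1 = (\<lambda>b \<theta>. ?D (L b \<theta>))"
    have ops1: "lam1 \<in> G.opset" "L1 b \<in> G.opset" for b unfolding lam1_def L1_def using Dops lam L by auto
    \<comment> \<open>The derivation reaches \<psi> only in coordinate j, through c_j, and leaves
      there the nonzero scalar \<open>lam \<theta>0\<close> in front of m_j; dividing by it isolates
      m_j.\<close>
    have psiD: "?D ((lam \<circle> psi n c k) \<kappa>) = (lam1 \<circle> psi n c k) \<kappa> + lam \<theta>0 * G.unit_vec j (op_single 0 1) k \<kappa>" for k \<kappa>
    proof -
      consider "k = 1" | "k \<in> {2..n}" | "k \<notin> {1..n}" using n by fastforce
      then show ?thesis
      proof cases
        case 1
        have ext: "op_single 0 1 = ext (op_single 0 1)" by (auto simp: op_single_def \<iota>_one fun_eq_iff)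
        have "psi n c k = op_single 0 1" using 1 by (simp add: psi_def)
        then show ?thesis using derivation_times_ext[OF D(1,2) lam(1), of j \<theta>0 "op_single 0 1" \<kappa>] j 1
          by (simp add: lam1_def ext[symmetric] G.unit_vec_def)
      next
        case 2
        have "psi n c k = op_single 0 (c k)" using 2 by (simp add: psi_def)
        then show ?thesis
          using derivation_times_const[OF D(1) lam(1) \<theta>0 c[OF \<theta>0m, of _ j k], of \<kappa>]
          by (auto simp: lam1_def G.unit_vec_def op_single_def)
      next
        case 3
        then have "psi n c k = 0" using n by (auto simp: psi_def)
        then show ?thesis using 3 j by (auto simp: derivation_zero[OF D(1)] G.unit_vec_def)
      qed
    qed
    have eq: "(lam1 \<circle> psi n c k) \<kappa> + lam \<theta>0 * G.unit_vec j (op_single 0 1) k \<kappa>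
        + (\<Sum>b\<in>B. (L1 b \<circle> ext (b k)) \<kappa>) = 0" for k \<kappa>
    proof -
      have "0 = ?D ((lam \<circle> psi n c k + (\<Sum>b\<in>B. L b \<circle> ext (b k))) \<kappa>)"
        unfolding rel by (simp add: derivation_zero[OF D(1)])
      also have "\<dots> = ?D ((lam \<circle> psi n c k) \<kappa>) + (\<Sum>b\<in>B. ?D ((L b \<circle> ext (b k)) \<kappa>))"
        by (simp add: derivation_add[OF D(1)] derivation_sum[OF D(1)] sum_fun_apply)
      finally show ?thesis
        by (simp add: psiD derivation_times_ext[OF D(1,2) L] L1_def)
    qed
    let ?a = "1 / lam \<theta>0"
    have "op_scale (- ?a) lam1 \<circle> psi n c k
        = G.unit_vec j (op_single 0 1) k + (\<Sum>b\<in>B. op_scale ?a (L1 b) \<circle> ext (b k))" for k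
    proof
      fix \<kappa>
      have "(op_scale (- ?a) lam1 \<circle> psi n c k) \<kappa> = - ?a * (lam1 \<circle> psi n c k) \<kappa>"
        unfolding G.times_scale_left[OF ops1(1)] by (simp add: op_scale_def)
      also have "(lam1 \<circle> psi n c k) \<kappa> = - (lam \<theta>0 * G.unit_vec j (op_single 0 1) k \<kappa>
          + (\<Sum>b\<in>B. (L1 b \<circle> ext (b k)) \<kappa>))"
        by (rule eq_neg_iff_add_eq_0[THEN iffD2]) (use eq[of k \<kappa>] in \<open>simp only: add.assoc\<close>)
      also have "- ?a * \<dots> = G.unit_vec j (op_single 0 1) k \<kappa> + ?a * (\<Sum>b\<in>B. (L1 b \<circle> ext (b k)) \<kappa>)"
        using \<theta>0(1) by (simp add: field_simps)
      also have "?a * (\<Sum>b\<in>B. (L1 b \<circle> ext (b k)) \<kappa>) = (\<Sum>b\<in>B. op_scale ?a (L1 b) \<circle> ext (b k)) \<kappa>"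
        unfolding G.times_scale_left[OF ops1(2)] by (simp add: op_scale_def sum_fun_apply sum_distrib_left)
      finally show "(op_scale (- ?a) lam1 \<circle> psi n c k) \<kappa>
        = (G.unit_vec j (op_single 0 1) k + (\<Sum>b\<in>B. op_scale ?a (L1 b) \<circle> ext (b k))) \<kappa>"
        by (simp only: plus_fun_apply)
    qed
    \<comment> \<open>A zero coefficient stays zero under the derivation, so the support of
      \<open>lam1\<close> lies in that of \<open>lam\<close>.\<close>
    moreover have "G.ordle (op_scale (- ?a) lam1) s"
    proof -
      have "lam \<theta> \<noteq> 0" if "lam1 \<theta> \<noteq> 0" for \<theta>
        using that derivation_zero[OF D(1)] unfolding lam1_def by metis
      then show ?thesis using lam(2) by (simp add: G.ordle_iff op_scale_def)
    qed
    ultimately show ?thesis using ops1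
      by (intro exI[of _ "op_scale (- ?a) lam1"] exI[of _ "\<lambda>b. op_scale ?a (L1 b)"]) auto
  qed
  show ?thesis
  proof (cases "j = 1")
    case False
    then show ?thesis using main[of j] j unfolding s_def by auto
  next
    case True
    have "\<forall>j\<in>{2..n}. \<exists>lam'. \<exists>L'. lam' \<in> G.opset \<and> G.ordle lam' s \<and> (\<forall>b\<in>B. L' b \<in> G.opset) \<and>
      (\<forall>k. lam' \<circle> psi n c k = G.unit_vec j (op_single 0 1) k + (\<Sum>b\<in>B. L' b \<circle> ext (b k)))"
      using main by blast
    then obtain M where "\<forall>j\<in>{2..n}. \<exists>L'. M j \<in> G.opset \<and> G.ordle (M j) s \<and> (\<forall>b\<in>B. L' b \<in> G.opset) \<and>
      (\<forall>k. M j \<circle> psi n c k = G.unit_vec j (op_single 0 1) k + (\<Sum>b\<in>B. L' b \<circle> ext (b k)))"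
      by (rule bchoice[THEN exE])
    then obtain A where A: "\<forall>j\<in>{2..n}. M j \<in> G.opset \<and> G.ordle (M j) s \<and> (\<forall>b\<in>B. A j b \<in> G.opset) \<and>
      (\<forall>k. M j \<circle> psi n c k = G.unit_vec j (op_single 0 1) k + (\<Sum>b\<in>B. A j b \<circle> ext (b k)))"
      by (rule bchoice[THEN exE])
    \<comment> \<open>From m_1 = \<psi> minus the sum of the c_j m_j, with each m_j replaced by M_j
      \<psi> modulo the submodule. The summand 1 has order 0, and left scalars do not raise the
      order.\<close>
    define lam' where "lam' = op_single 0 1 + (\<Sum>j\<in>{2..n}. op_scale (- c j) (M j))"
    define L' where "L' = (\<lambda>b. \<Sum>j\<in>{2..n}. op_scale (- c j) (A j b))"
    have sM: "(\<Sum>j\<in>{2..n}. op_scale (- c j) (M j)) \<in> G.opset" using A by (intro ops_sum) auto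
    have "lam' \<circle> psi n c k = G.unit_vec j (op_single 0 1) k + (\<Sum>b\<in>B. L' b \<circle> ext (b k))" for k
    proof -
      have "lam' \<circle> psi n c k = psi n c k + (\<Sum>j\<in>{2..n}. op_scale (- c j) (M j \<circle> psi n c k))"
        unfolding lam'_def using A
        by (subst G.times_add_left[OF _ sM], simp, subst G.times_sum_left)
          (auto simp: G.times_one_left G.times_scale_left intro!: sum.cong)
      also have "(\<Sum>j\<in>{2..n}. op_scale (- c j) (M j \<circle> psi n c k)) = (\<Sum>j\<in>{2..n}. op_scale (- c j) (G.unit_vec j (op_single 0 1) k))
          + (\<Sum>j\<in>{2..n}. \<Sum>b\<in>B. op_scale (- c j) (A j b \<circle> ext (b k)))"
        unfolding sum.distrib[symmetric] using A by (intro sum.cong refl) (simp add: op_scale_sum)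
      also have "(\<Sum>j\<in>{2..n}. \<Sum>b\<in>B. op_scale (- c j) (A j b \<circle> ext (b k))) = (\<Sum>b\<in>B. L' b \<circle> ext (b k))"
      proof (subst sum.swap, rule sum.cong[OF refl])
        fix b assume "b \<in> B"
        then show "(\<Sum>j\<in>{2..n}. op_scale (- c j) (A j b \<circle> ext (b k))) = L' b \<circle> ext (b k)"
          unfolding L'_def using A by (subst G.times_sum_left) (auto simp: G.times_scale_left intro!: sum.cong)
      qed
      also have "(\<Sum>j\<in>{2..n}. op_scale (- c j) (G.unit_vec j (op_single 0 1) k))
          = (if k \<in> {2..n} then op_single 0 (- c k) else 0)"
      proof -
        have "(\<Sum>j\<in>{2..n}. op_scale (- c j) (G.unit_vec j (op_single 0 1) k))
            = (\<Sum>j\<in>{2..n}. if k = j then op_single 0 (- c k) else 0)"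
          by (rule sum.cong) (auto simp: G.unit_vec_def G.op_scale_single)
        then show ?thesis by (simp add: sum.delta')
      qed
      also have "psi n c k + ((if k \<in> {2..n} then op_single 0 (- c k) else 0) + (\<Sum>b\<in>B. L' b \<circle> ext (b k)))
          = G.unit_vec j (op_single 0 1) k + (\<Sum>b\<in>B. L' b \<circle> ext (b k))"
        using True n by (auto simp: psi_def G.unit_vec_def op_single_def fun_eq_iff)
      finally show ?thesis .
    qed
    moreover have "lam' \<in> G.opset" unfolding lam'_def using sM by simp
    moreover have "G.ordle lam' s"
      unfolding G.ordle_iff
    proof (intro allI impI)
      fix \<theta> assume "lam' \<theta> \<noteq> 0"
      then have "\<theta> = 0 \<or> (\<exists>j\<in>{2..n}. M j \<theta> \<noteq> 0)"
        by (rule contrapos_np) (simp add: lam'_def op_single_def op_scale_def sum_fun_apply)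
      then show "mi_ord m \<theta> \<le> s" using A by (auto simp: G.ordle_iff)
    qed
    moreover have "L' b \<in> G.opset" if "b \<in> B" for b unfolding L'_def using A that by (intro ops_sum) auto
    ultimately show ?thesis unfolding s_def by (intro exI[of _ lam'] exI[of _ L']) auto
  qed
qed

end

section \<open>Cyclic vectors\<close>

lemma (in field_copy) finsum_copy_cong:
  assumes "\<And>x. x \<in> A \<Longrightarrow> g x = h (f x)"
  shows "finsum R g A = h (sum f A)"
proof -
  interpret field R by (rule field_R)
  have "finsum R g A = finsum R (\<lambda>x. h (f x)) A" by (rule finsum_cong') (simp_all add: assms)
  then show ?thesis by (simp add: finsum_copy)
qed

lemma diff_ring_dfield:
  assumes "diff_ring (type_ring :: 'a::field ring) d m"
  shows "dfield d m"
  using assms by unfold_locales (auto simp: diff_ring_def is_derivation_def)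

theorem theorem3p3:
  fixes d :: "nat \<Rightarrow> 'a::field_char_0 \<Rightarrow> 'a"
    and m n :: nat
    and \<Sigma> :: "((nat \<Rightarrow> (nat \<Rightarrow> nat) \<Rightarrow> 'a) \<times> 'a) set"
    and e :: "nat \<Rightarrow> nat"
  assumes "diff_ring (type_ring :: 'a ring) d m"
    and "n \<ge> 1"
    and "\<forall>f\<in>\<Sigma>. lin_dpoly m n f"
    and "\<forall>f\<in>\<Sigma>. \<forall>j\<in>{1..n}. ord_le (type_ring :: 'a ring) m (fst f j) (e j)"
    and "kolchin_top_coeff_zero d m n \<Sigma>"
  shows "\<exists>(G :: 'a list ring) dG \<iota> c.
     field G \<and> diff_ring G dG m \<and> \<iota> \<in> ring_hom type_ring G \<and>
     (\<forall>i<m. \<forall>x. dG i (\<iota> x) = \<iota> (d i x)) \<and>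
     (\<forall>j\<in>{2..n}. c j \<in> carrier G) \<and>
     (let \<psi> = (\<lambda>k. if k = 1 then op_const G \<one>\<^bsub>G\<^esub>
                   else if k \<in> {2..n} then op_const G (c k) else op_zero G);
          N' = dsubmod G dG m ((\<lambda>v j \<theta>. \<iota> (v j \<theta>)) ` fst ` \<Sigma>)
      in \<forall>j\<in>{1..n}. \<exists>lam\<in>ops G m. ord_le G m lam (2 ^ m * (\<Sum>k=1..n. e k)) \<and>
            (\<exists>w\<in>N'. \<forall>k \<theta>. op_act G dG m lam \<psi> k \<theta> = basis_vec G j k \<theta> \<oplus>\<^bsub>G\<^esub> w k \<theta>))"
proof -
  interpret F: dfield d m by (rule diff_ring_dfield[OF assms(1)])
  define D where "D = drat_deriv d"
  interpret E: dfield_ext d D m "drat_const"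
  proof -
    have "dfield D m" unfolding D_def by (rule F.dfield_drat)
    then interpret G: dfield D m .
    show "dfield_ext d D m drat_const"
      by unfold_locales (simp_all add: drat_const_hom D_def F.drat_deriv_const)
  qed
  have S: "fst ` \<Sigma> \<subseteq> mvecs type_ring m n" using assms(3) by (auto simp: lin_dpoly_def)
  obtain B where B: "B \<subseteq> fst ` \<Sigma>" "F.indep B" "card B = n"
    using F.exists_indep_subset[OF S assms(5)] by blast
  have fin: "finite B" using B(2) by (simp add: F.indep_def)
  define c where "c = (\<lambda>j. drat_var (Poly_Mapping.single (m + j) 1) :: 'a drat)"
  define P where "P = (\<lambda>j \<theta>. drat_partial (Poly_Mapping.single (m + j) 1 + mi_pm \<theta>) :: 'a drat \<Rightarrow> 'a drat)"
  have Pc: "P j \<theta> (dpow D m \<nu> (c k)) = (if j = k \<and> \<nu> = \<theta> then 1 else 0)"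
    if "\<theta> \<in> midx m" "\<nu> \<in> midx m" for j k \<theta> \<nu>
  proof -
    have "P j \<theta> (dpow D m \<nu> (c k))
        = (if Poly_Mapping.single (m + k) (1::nat) + mi_pm \<nu> = Poly_Mapping.single (m + j) 1 + mi_pm \<theta> then 1 else 0)"
      unfolding P_def c_def D_def F.dpow_drat_var[OF that(2)] drat_partial_var ..
    then show ?thesis using single_plus_mi_pm_inj[OF that(2,1), of k j] by auto
  qed
  have ex: "\<exists>lam L. lam \<in> ops type_ring m \<and> ord_le type_ring m lam (2 ^ m * (\<Sum>k=1..n. e k)) \<and>
      (\<forall>b\<in>B. L b \<in> ops type_ring m) \<and>
      (\<forall>k. op_times D m lam (E.psi n c k) = E.G.unit_vec j (op_single 0 1) k
        + (\<Sum>b\<in>B. op_times D m (L b) (\<lambda>\<theta>. drat_const (b k \<theta>))))" if "j \<in> {1..n}" for j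
    by (rule E.exists_cyclic_multipliers[where D = P])
      (use B S assms(2,4) that Pc in \<open>auto simp: P_def derivation_drat_partial drat_partial_const\<close>)
  obtain h :: "'a drat \<Rightarrow> 'a list" where h: "inj h" using exists_inj_drat by blast
  \<comment> \<open>The operations of the rational function field carried over along
    \<open>h\<close>, so that \<open>field_copy\<close> holds by construction.\<close>
  define R :: "'a list ring" where "R = \<lparr>carrier = range h, mult = (\<lambda>x y. h (inv_into UNIV h x * inv_into UNIV h y)), one = h 1,
    zero = h 0, add = (\<lambda>x y. h (inv_into UNIV h x + inv_into UNIV h y))\<rparr>"
  interpret R: field_copy R h
    by unfold_locales (simp_all add: R_def h)
  define dR where "dR = (\<lambda>i y. h (D i (inv_into UNIV h y)))"
  have dR: "dR i (h x) = h (D i x)" for i x by (simp add: dR_def h)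
  define \<iota> where "\<iota> = (\<lambda>x. h (drat_const x))"
  have "diff_ring R dR m"
    unfolding diff_ring_def is_derivation_def R.carrier_R
    by (auto simp: dR E.G.d_add E.G.d_mult E.G.d_comm simp flip: R.h_add R.h_mult)
  moreover have "\<iota> \<in> ring_hom type_ring R"
    by (rule ring_hom_memI) (simp_all add: \<iota>_def drat_const_hom R.h_add R.h_mult R.h_one)
  moreover have "\<forall>i<m. \<forall>x. dR i (\<iota> x) = \<iota> (d i x)"
    by (simp add: \<iota>_def dR E.\<iota>_d)
  moreover have "\<forall>j\<in>{2..n}. h (c j) \<in> carrier R" by simp
  moreover have "\<exists>lam\<in>ops R m. ord_le R m lam (2 ^ m * (\<Sum>k=1..n. e k)) \<and>
      (\<exists>w\<in>dsubmod R dR m ((\<lambda>v j \<theta>. \<iota> (v j \<theta>)) ` fst ` \<Sigma>). \<forall>k \<theta>. op_act R dR m lam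
        (\<lambda>k. if k = 1 then op_const R \<one>\<^bsub>R\<^esub> else if k \<in> {2..n} then op_const R (h (c k)) else op_zero R) k \<theta>
        = basis_vec R j k \<theta> \<oplus>\<^bsub>R\<^esub> w k \<theta>)" if j: "j \<in> {1..n}" for j
  proof -
    obtain lam L where lam: "lam \<in> ops type_ring m" "ord_le type_ring m lam (2 ^ m * (\<Sum>k=1..n. e k))"
      and L: "\<forall>b\<in>B. L b \<in> ops type_ring m"
      and eq: "\<And>k. op_times D m lam (E.psi n c k) = E.G.unit_vec j (op_single 0 1) k
        + (\<Sum>b\<in>B. op_times D m (L b) (\<lambda>\<theta>. drat_const (b k \<theta>)))" using ex[OF j] by blast
    define w where "w = (\<lambda>k \<theta>. h ((\<Sum>b\<in>B. op_times D m (L b) (\<lambda>\<theta>. drat_const (b k \<theta>))) \<theta>))"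
    define g where "g = (\<lambda>(v :: nat \<Rightarrow> (nat \<Rightarrow> nat) \<Rightarrow> 'a) j \<theta>. \<iota> (v j \<theta>))"
    have g: "inj g"
    proof (rule injI)
      fix v w assume "g v = g w"
      then have "drat_const (v k \<theta>) = drat_const (w k \<theta>)" for k \<theta>
        using h by (auto simp: g_def \<iota>_def fun_eq_iff dest: injD)
      then show "v = w" using E.inj_\<iota> by (auto simp: fun_eq_iff dest: injD)
    qed
    \<comment> \<open>In \<open>dsubmod\<close> the multipliers are indexed by the generators
      themselves, here the images \<open>g b\<close>; injectivity of \<open>g\<close> recovers
      b.\<close>
    define Lf where "Lf = (\<lambda>s \<theta>. h (L (inv_into UNIV g s) \<theta>))"
    have "w \<in> dsubmod R dR m (g ` fst ` \<Sigma>)"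
      unfolding dsubmod_def mem_Collect_eq
    proof (intro exI[of _ "g ` B"] exI[of _ Lf] conjI ballI ext)
      show "finite (g ` B)" "g ` B \<subseteq> g ` fst ` \<Sigma>" using fin B(1) by auto
      show "Lf s \<in> ops R m" if "s \<in> g ` B" for s
        using that L g by (auto simp: Lf_def intro!: R.ops_copy)
      fix k \<theta>
      have "finsum R (\<lambda>s. op_act R dR m (Lf s) s k \<theta>) (g ` B)
          = h (\<Sum>s\<in>g ` B. op_times D m (L (inv_into UNIV g s)) (\<lambda>\<theta>. drat_const (inv_into UNIV g s k \<theta>)) \<theta>)"
      proof (rule R.finsum_copy_cong)
        fix s assume "s \<in> g ` B"
        then obtain b where b: "b \<in> B" "s = g b" by blast
        have "b k \<in> ops type_ring m" using b(1) B(1) S by (auto simp: mvecs_def)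
        then have ops: "(\<lambda>\<theta>. drat_const (b k \<theta>)) \<in> ops type_ring m" by (rule E.ops_ext)
        have "op_act R dR m (Lf s) s k \<theta> = op_mul R dR m (\<lambda>\<theta>. h (L b \<theta>)) (\<lambda>\<theta>. h (drat_const (b k \<theta>))) \<theta>"
          using g b by (simp add: op_act_def Lf_def) (simp add: g_def \<iota>_def)
        also have "\<dots> = h (op_times D m (L b) (\<lambda>\<theta>. drat_const (b k \<theta>)) \<theta>)"
          by (subst R.op_mul_copy[OF E.G.dfield_axioms dR _ ops]) (use L b in auto)
        finally show "op_act R dR m (Lf s) s k \<theta>
            = h (op_times D m (L (inv_into UNIV g s)) (\<lambda>\<theta>. drat_const (inv_into UNIV g s k \<theta>)) \<theta>)" using g b by simp
      qed
      also have "(\<Sum>s\<in>g ` B. op_times D m (L (inv_into UNIV g s)) (\<lambda>\<theta>. drat_const (inv_into UNIV g s k \<theta>)) \<theta>)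
          = (\<Sum>b\<in>B. op_times D m (L b) (\<lambda>\<theta>. drat_const (b k \<theta>)) \<theta>)"
        using g by (subst sum.reindex) (auto intro: inj_on_subset)
      finally show "w k \<theta> = finsum R (\<lambda>s. op_act R dR m (Lf s) s k \<theta>) (g ` B)"
        by (simp add: w_def sum_fun_apply)
    qed
    moreover have "op_act R dR m (\<lambda>\<theta>. h (lam \<theta>))
        (\<lambda>k. if k = 1 then op_const R \<one>\<^bsub>R\<^esub> else if k \<in> {2..n} then op_const R (h (c k)) else op_zero R) k \<theta>
        = basis_vec R j k \<theta> \<oplus>\<^bsub>R\<^esub> w k \<theta>" for k \<theta>
    proof -
      have const: "op_const R (h a) = (\<lambda>\<theta>. h (op_single 0 a \<theta>))" for a
        by (auto simp: op_const_def op_single_def fun_eq_iff R.h_zero)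
      have zero: "op_zero R = (\<lambda>\<theta>. h 0)" by (simp add: op_zero_def R.h_zero)
      have psi: "(if k = 1 then op_const R \<one>\<^bsub>R\<^esub> else if k \<in> {2..n} then op_const R (h (c k)) else op_zero R)
          = (\<lambda>\<theta>. h (E.psi n c k \<theta>))"
        by (simp add: E.psi_def const zero flip: R.h_one)
      have ops: "E.psi n c k \<in> ops type_ring m" by (simp add: E.psi_def)
      have "op_mul R dR m (\<lambda>\<theta>. h (lam \<theta>)) (\<lambda>\<theta>. h (E.psi n c k \<theta>)) \<theta> = h (op_times D m lam (E.psi n c k) \<theta>)"
        by (subst R.op_mul_copy[OF E.G.dfield_axioms dR lam(1) ops]) auto
      also have "\<dots> = h (E.G.unit_vec j (op_single 0 1) k \<theta>) \<oplus>\<^bsub>R\<^esub> w k \<theta>"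
        unfolding eq by (simp add: w_def R.h_add)
      also have "h (E.G.unit_vec j (op_single 0 1) k \<theta>) = basis_vec R j k \<theta>"
        by (simp add: E.G.unit_vec_def basis_vec_def const zero flip: R.h_one)
      finally show ?thesis unfolding op_act_def psi .
    qed
    ultimately show ?thesis unfolding g_def using R.ops_copy[OF lam(1)] lam(2) R.ord_le_copy by blast
  qed
  ultimately show ?thesis unfolding Let_def using R.field_R
    by (intro exI[of _ R] exI[of _ dR] exI[of _ \<iota>] exI[of _ "\<lambda>k. h (c k)"]) blast
qed

end
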